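(* Let $\underline{\omega}(0)$ be any smooth hypersymplectic structure of simple type on $\mathbb{T}^4$, and let $\underline{\omega}(t)=(\omega_1(t),\omega_2(t),\omega_3(t))$, $t\in[0,\infty)$, be the hypersymplectic flow starting from it. Then $\underline{\omega}(t)$ converges smoothly, modulo diffeomorphisms, to the standard hyperk\"ahler structure $\underline{\omega}^0=(\omega_1^0,\omega_2^0,\omega_3^0)$ on $\mathbb{T}^4$. More precisely, there exists a family of orientation preserving diffeomorphisms $F_t$ of $\mathbb{T}^4=S^1\times\mathbb{T}^3$, all fixing the $\mathbb{T}^3$ factor pointwise (i.e. each $F_t$ acts only on the $S^1$ coordinate, $F_t(x_0,x_1,x_2,x_3)=(h_t(x_0),x_1,x_2,x_3)$), such that $F_t^*\underline{\omega}(t)\to\underline{\omega}^0$ in $C^\infty$ (that is, in $C^k$ for every $k\in\mathbb{N}$) as $t\to\infty$.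
   Context: Let $S^1=\mathbb{R}/2\pi\mathbb{Z}$ and $\mathbb{T}^4=S^1\times\mathbb{T}^3$ with standard coordinates $x_0$ on $S^1$ and $x_1,x_2,x_3$ on $\mathbb{T}^3$ (all of period $2\pi$). The standard hyperk\"ahler triple is $\omega_i^0=dx_0\wedge dx_i+dx_j\wedge dx_k$ for each cyclic permutation $(i,j,k)$ of $(1,2,3)$. Hypersymplectic structure. A triple $\underline\omega=(\omega_1,\omega_2,\omega_3)$ of closed 2-forms on a 4-manifold $X$ is a hypersymplectic structure if there is a nowhere vanishing 4-form $\mu_0$ such that the matrix $\big(\frac{\omega_i\wedge\omega_j}{2\mu_0}\big)$ is positive definite everywhere. It determines a Riemannian metric $g$ by $g(u,v)\,d\mathrm{vol}_g=\frac16\epsilon_{ijk}\,\iota_u\omega_i\wedge\iota_v\omega_j\wedge\omega_k$. Put $\mu=d\mathrm{vol}_g$ and $Q=(Q_{ij})=\big(\frac{\omega_i\wedge\omega_j}{2\mu}\big)$. Let $*$ be the Hodge star of $g$, let $E_i(\alpha)=-*(\alpha\wedge\omega_i)$ on 1-forms, and define the torsion 1-forms $\tau_i=-\sum_{j=1}^3E_j\big((dQ\,Q^{-1})_{ij}\big)$. The hypersymplectic flow is the system $\partial_t\omega_i=d\tau_i$, $i=1,2,3$. Simple type. A hypersymplectic structure on $\mathbb{T}^4$ is of simple type if $\omega_i=(1+\phi_i'')\,dx_0\wedge dx_i+dx_j\wedge dx_k$ for each cyclic permutation $(i,j,k)$ of $(1,2,3)$, where $\phi_1,\phi_2,\phi_3$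 are real functions on $S^1$ (functions of $x_0$ only), $'$ denotes $d/dx_0$, and $1+\phi_i''>0$. For such triples put $A_i=1+\phi_i''$, $V=(A_1A_2A_3)^{1/3}$, $f_i=A_i/V$. Then $g=V^2dx_0^2+\sum_{i=1}^3f_idx_i^2$, $Q=\mathrm{diag}(f_1,f_2,f_3)$, $\tau_i=\big(\log\frac{A_i}{V}\big)'\frac{A_i}{V^2}dx_i$. The hypersymplectic flow from a structure of simple type is understood as the flow through structures of simple type, i.e. it is the system $\partial_tA_i=\big((\log\frac{A_i}{V})'\frac{A_i}{V^2}\big)'$, $i=1,2,3$, for positive functions $A_i$; starting from a smooth structure of simple type this flow exists for all $t\in[0,\infty)$. *)

theory Defs
  imports "HOL-Analysis.Analysis"
begin

section \<open>Smooth functions and \<open>C\<^sup>k\<close> convergence\<close>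

primrec iter_deriv :: "'a set \<Rightarrow> 'a list \<Rightarrow> ('a::real_normed_vector \<Rightarrow> 'b::real_normed_vector) \<Rightarrow> 'a \<Rightarrow> 'b"
  where
    "iter_deriv S [] f = f"
  | "iter_deriv S (v # vs) f = (\<lambda>x. frechet_derivative (iter_deriv S vs f) (at x within S) v)"

text \<open>The derivatives are taken within \<open>S\<close>.  This is used only for \<open>S = UNIV\<close> and for the half-space
  \<open>S = [0,\<infinity>) \<times> \<real>\<^sup>4\<close>, where derivatives within \<open>S\<close> are unique; in the second case the
  definition expresses smoothness up to the boundary.\<close>

definition smooth_within :: "'a set \<Rightarrow> ('a::real_normed_vector \<Rightarrow> 'b::real_normed_vector) \<Rightarrow> bool"
  where "smooth_within S f \<longleftrightarrow> (\<forall>vs. iter_deriv S vs f differentiable_on S)"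

definition Ck_tendsto ::
  "nat \<Rightarrow> (real \<Rightarrow> 'a::euclidean_space \<Rightarrow> real) \<Rightarrow> ('a \<Rightarrow> real) \<Rightarrow> bool"
  where "Ck_tendsto k f g \<longleftrightarrow>
    (\<forall>vs. set vs \<subseteq> Basis \<and> length vs \<le> k \<longrightarrow>
       uniform_limit UNIV (\<lambda>t. iter_deriv UNIV vs (f t)) (iter_deriv UNIV vs g) at_top)"


section \<open>Exterior algebra on \<open>\<real>\<^sup>4\<close>\<close>

text \<open>The coordinates \<open>x\<^sub>0, x\<^sub>1, x\<^sub>2, x\<^sub>3\<close> are indexed by the four-element type \<open>4\<close> (in which
  \<open>4 = 0\<close>).  The triple is indexed by the three-element type \<open>3\<close>, whose elements are \<open>1\<close>, \<open>2\<close> and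
  \<open>3 = 0\<close>.  Addition in \<open>3\<close> is modulo three, so the cyclic permutations \<open>(i,j,k)\<close> of \<open>(1,2,3)\<close> are
  the triples \<open>(i, i + 1, i + 2)\<close>.\<close>

type_synonym R4 = "real ^ 4"
type_synonym cov1 = "R4 \<Rightarrow> real"
type_synonym cov2 = "R4 \<Rightarrow> R4 \<Rightarrow> real"
type_synonym cov3 = "R4 \<Rightarrow> R4 \<Rightarrow> R4 \<Rightarrow> real"
type_synonym cov4 = "R4 \<Rightarrow> R4 \<Rightarrow> R4 \<Rightarrow> R4 \<Rightarrow> real"
type_synonym triple = "3 \<Rightarrow> R4 \<Rightarrow> cov2"

definition cidx :: "3 \<Rightarrow> 4"
  where "cidx i = (if i = 1 then 1 else if i = 2 then 2 else 3)"

definition levi_civita :: "3 \<Rightarrow> 3 \<Rightarrow> 3 \<Rightarrow> real"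
  where "levi_civita i j k =
    (if j = i + 1 \<and> k = i + 2 then 1 else if j = i + 2 \<and> k = i + 1 then - 1 else 0)"

definition fr :: "4 \<Rightarrow> R4"
  where "fr a = axis a 1"

definition dx :: "4 \<Rightarrow> cov1"
  where "dx a = (\<lambda>u. u $ a)"

definition alt2 :: "cov2 \<Rightarrow> bool"
  where "alt2 \<alpha> \<longleftrightarrow> bilinear \<alpha> \<and> (\<forall>u. \<alpha> u u = 0)"

definition wedge11 :: "cov1 \<Rightarrow> cov1 \<Rightarrow> cov2"
  where "wedge11 \<alpha> \<beta> = (\<lambda>u v. \<alpha> u * \<beta> v - \<alpha> v * \<beta> u)"

definition wedge12 :: "cov1 \<Rightarrow> cov2 \<Rightarrow> cov3"
  where "wedge12 \<alpha> \<omega> = (\<lambda>u v w. \<alpha> u * \<omega> v w - \<alpha> v * \<omega> u w + \<alpha> w * \<omega> u v)"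

definition wedge22 :: "cov2 \<Rightarrow> cov2 \<Rightarrow> cov4"
  where "wedge22 \<alpha> \<beta> = (\<lambda>a b c d.
      \<alpha> a b * \<beta> c d - \<alpha> a c * \<beta> b d + \<alpha> a d * \<beta> b c
    + \<alpha> b c * \<beta> a d - \<alpha> b d * \<beta> a c + \<alpha> c d * \<beta> a b)"

text \<open>The coefficient of an alternating 4-form with respect to
  \<open>dx\<^sub>0 \<and> dx\<^sub>1 \<and> dx\<^sub>2 \<and> dx\<^sub>3\<close>.  Below, 4-forms are identified with these coefficients.\<close>

definition top4 :: "cov4 \<Rightarrow> real"
  where "top4 \<alpha> = \<alpha> (fr 0) (fr 1) (fr 2) (fr 3)"

definition inner_prod_form :: "cov2 \<Rightarrow> bool"
  where "inner_prod_form g \<longleftrightarrow>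
    bilinear g \<and> (\<forall>u v. g u v = g v u) \<and> (\<forall>u. u \<noteq> 0 \<longrightarrow> 0 < g u u)"

text \<open>\<open>m dx\<^sub>0 \<and> dx\<^sub>1 \<and> dx\<^sub>2 \<and> dx\<^sub>3\<close> is the volume form of \<open>g\<close> for one of the two orientations.\<close>

definition volume_coeff :: "cov2 \<Rightarrow> real \<Rightarrow> bool"
  where "volume_coeff g m \<longleftrightarrow> \<bar>m\<bar> = sqrt (det (\<chi> a b. g (fr a) (fr b)))"

definition oriented_orthonormal :: "cov2 \<Rightarrow> real \<Rightarrow> (4 \<Rightarrow> R4) \<Rightarrow> bool"
  where "oriented_orthonormal g m e \<longleftrightarrow>
    (\<forall>a b. g (e a) (e b) = (if a = b then 1 else 0)) \<and> 0 < m * det (\<chi> a. e a)"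

text \<open>Hodge star of a 3-covector: \<open>*(e\<^sup>0 \<and> e\<^sup>1 \<and> e\<^sup>2) = e\<^sup>3\<close> for every oriented
  orthonormal coframe, the orientation being given by the sign of \<open>m\<close>.\<close>

definition hodge3 :: "cov2 \<Rightarrow> real \<Rightarrow> cov3 \<Rightarrow> cov1"
  where "hodge3 g m \<beta> = (THE \<gamma>. linear \<gamma> \<and>
    (\<forall>e. oriented_orthonormal g m e \<longrightarrow> \<gamma> (e 3) = \<beta> (e 0) (e 1) (e 2)))"

definition posdef3 :: "real ^ 3 ^ 3 \<Rightarrow> bool"
  where "posdef3 M \<longleftrightarrow> transpose M = M \<and> (\<forall>v. v \<noteq> 0 \<longrightarrow> 0 < v \<bullet> (M *v v))"


section \<open>The metric at a point\<close>

text \<open>The matrix \<open>(w\<^sub>i \<and> w\<^sub>j / 2\<mu>)\<close> for \<open>\<mu> = m dx\<^sub>0 \<and> dx\<^sub>1 \<and> dx\<^sub>2 \<and> dx\<^sub>3\<close>.\<close>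

definition wedge_matrix :: "(3 \<Rightarrow> cov2) \<Rightarrow> real \<Rightarrow> real ^ 3 ^ 3"
  where "wedge_matrix w m = (\<chi> i j. top4 (wedge22 (w i) (w j)) / (2 * m))"

text \<open>The orientation is the one determined by the triple: \<open>w\<^sub>i \<and> w\<^sub>j\<close> is positive definite with
  respect to the volume form.  The metric and its volume form are uniquely determined
  by these conditions.\<close>

definition is_hs_metric :: "(3 \<Rightarrow> cov2) \<Rightarrow> cov2 \<Rightarrow> real \<Rightarrow> bool"
  where "is_hs_metric w g m \<longleftrightarrow>
    inner_prod_form g \<and> volume_coeff g m \<and> posdef3 (wedge_matrix w m) \<and>
    (\<forall>u v. g u v * m = 1 / 6 * (\<Sum>i\<in>UNIV. \<Sum>j\<in>UNIV. \<Sum>k\<in>UNIV.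
        levi_civita i j k * top4 (wedge22 (wedge11 (w i u) (w j v)) (w k))))"

definition hs_metric :: "(3 \<Rightarrow> cov2) \<Rightarrow> cov2"
  where "hs_metric w = (THE g. \<exists>m. is_hs_metric w g m)"

definition hs_vol :: "(3 \<Rightarrow> cov2) \<Rightarrow> real"
  where "hs_vol w = (THE m. \<exists>g. is_hs_metric w g m)"

definition E_op :: "(3 \<Rightarrow> cov2) \<Rightarrow> 3 \<Rightarrow> cov1 \<Rightarrow> cov1"
  where "E_op w i \<alpha> = (\<lambda>u. - hodge3 (hs_metric w) (hs_vol w) (wedge12 \<alpha> (w i)) u)"


section \<open>Forms on the torus\<close>

text \<open>Tensor fields on \<open>\<real>\<^sup>4/(2\<pi>\<int>)\<^sup>4\<close> are represented by their periodic lifts to \<open>\<real>\<^sup>4\<close>.\<close>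

definition periodic4 :: "(R4 \<Rightarrow> 'b) \<Rightarrow> bool"
  where "periodic4 f \<longleftrightarrow> (\<forall>x a. f (x + (2 * pi) *\<^sub>R fr a) = f x)"

definition two_form :: "(R4 \<Rightarrow> cov2) \<Rightarrow> bool"
  where "two_form \<alpha> \<longleftrightarrow> periodic4 \<alpha> \<and> (\<forall>x. alt2 (\<alpha> x)) \<and>
    (\<forall>u v. smooth_within UNIV (\<lambda>x. \<alpha> x u v))"

definition ext_d1 :: "(R4 \<Rightarrow> cov1) \<Rightarrow> R4 \<Rightarrow> cov2"
  where "ext_d1 \<alpha> x = (\<lambda>u v.
      frechet_derivative (\<lambda>y. \<alpha> y v) (at x) u - frechet_derivative (\<lambda>y. \<alpha> y u) (at x) v)"

definition ext_d2 :: "(R4 \<Rightarrow> cov2) \<Rightarrow> R4 \<Rightarrow> cov3"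
  where "ext_d2 \<alpha> x = (\<lambda>u v w.
      frechet_derivative (\<lambda>y. \<alpha> y v w) (at x) u
    - frechet_derivative (\<lambda>y. \<alpha> y u w) (at x) v
    + frechet_derivative (\<lambda>y. \<alpha> y u v) (at x) w)"

definition closed_form2 :: "(R4 \<Rightarrow> cov2) \<Rightarrow> bool"
  where "closed_form2 \<alpha> \<longleftrightarrow> (\<forall>x u v w. ext_d2 \<alpha> x u v w = 0)"

definition pullback2 :: "(R4 \<Rightarrow> R4) \<Rightarrow> (R4 \<Rightarrow> cov2) \<Rightarrow> R4 \<Rightarrow> cov2"
  where "pullback2 F \<alpha> x = (\<lambda>u v.
    \<alpha> (F x) (frechet_derivative F (at x) u) (frechet_derivative F (at x) v))"


section \<open>Hypersymplectic structures, simple type, and the flow\<close>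

definition hypersymplectic :: "triple \<Rightarrow> bool"
  where "hypersymplectic \<omega> \<longleftrightarrow>
    (\<forall>i. two_form (\<omega> i) \<and> closed_form2 (\<omega> i)) \<and>
    (\<exists>\<mu>\<^sub>0 :: R4 \<Rightarrow> real. periodic4 \<mu>\<^sub>0 \<and> smooth_within UNIV \<mu>\<^sub>0 \<and> (\<forall>x. \<mu>\<^sub>0 x \<noteq> 0) \<and>
       (\<forall>x. posdef3 (wedge_matrix (\<lambda>i. \<omega> i x) (\<mu>\<^sub>0 x))))"

definition Qmat :: "triple \<Rightarrow> R4 \<Rightarrow> real ^ 3 ^ 3"
  where "Qmat \<omega> x = wedge_matrix (\<lambda>i. \<omega> i x) (hs_vol (\<lambda>i. \<omega> i x))"

text \<open>The \<open>(i,j)\<close> entry of the matrix of 1-forms \<open>dQ Q\<^sup>-\<^sup>1\<close>.\<close>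

definition dQ_Qinv :: "triple \<Rightarrow> R4 \<Rightarrow> 3 \<Rightarrow> 3 \<Rightarrow> cov1"
  where "dQ_Qinv \<omega> x i j = (\<lambda>u. \<Sum>k\<in>UNIV.
    frechet_derivative (\<lambda>y. Qmat \<omega> y $ i $ k) (at x) u * matrix_inv (Qmat \<omega> x) $ k $ j)"

definition torsion :: "triple \<Rightarrow> 3 \<Rightarrow> R4 \<Rightarrow> cov1"
  where "torsion \<omega> i x = (\<lambda>u. - (\<Sum>j\<in>UNIV. E_op (\<lambda>l. \<omega> l x) j (dQ_Qinv \<omega> x i j) u))"

definition hypersymplectic_flow :: "(real \<Rightarrow> triple) \<Rightarrow> bool"
  where "hypersymplectic_flow \<omega> \<longleftrightarrow>
    (\<forall>t\<ge>0. hypersymplectic (\<omega> t)) \<and>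
    (\<forall>i u v. smooth_within ({0..} \<times> UNIV) (\<lambda>(t, x). \<omega> t i x u v)) \<and>
    (\<forall>t\<ge>0. \<forall>i x u v.
       ((\<lambda>s. \<omega> s i x u v) has_real_derivative ext_d1 (torsion (\<omega> t) i) x u v) (at t within {0..}))"

definition simple_triple :: "(3 \<Rightarrow> real \<Rightarrow> real) \<Rightarrow> triple"
  where "simple_triple A i x = (\<lambda>u v.
      A i (x $ 0) * wedge11 (dx 0) (dx (cidx i)) u v
    + wedge11 (dx (cidx (i + 1))) (dx (cidx (i + 2))) u v)"

definition standard_triple :: triple
  where "standard_triple i x = (\<lambda>u v.
      wedge11 (dx 0) (dx (cidx i)) u v + wedge11 (dx (cidx (i + 1))) (dx (cidx (i + 2))) u v)"

definition simple_type :: "triple \<Rightarrow> bool"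
  where "simple_type \<omega> \<longleftrightarrow> hypersymplectic \<omega> \<and>
    (\<exists>\<phi> :: 3 \<Rightarrow> real \<Rightarrow> real.
       (\<forall>i. smooth_within UNIV (\<phi> i) \<and> (\<forall>s. \<phi> i (s + 2 * pi) = \<phi> i s) \<and>
            (\<forall>s. 0 < 1 + deriv (deriv (\<phi> i)) s)) \<and>
       \<omega> = simple_triple (\<lambda>i s. 1 + deriv (deriv (\<phi> i)) s))"


section \<open>Diffeomorphisms of the torus\<close>

text \<open>Diffeomorphisms of \<open>\<real>\<^sup>4/(2\<pi>\<int>)\<^sup>4\<close> are represented by their lifts to the universal cover, that is,
  diffeomorphisms \<open>F\<close> of \<open>\<real>\<^sup>4\<close> such that \<open>F\<close> and its inverse both descend to the quotient.\<close>

definition descends :: "(R4 \<Rightarrow> R4) \<Rightarrow> bool"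
  where "descends F \<longleftrightarrow>
    (\<forall>x a b. \<exists>n :: int. F (x + (2 * pi) *\<^sub>R fr a) $ b - F x $ b = 2 * pi * of_int n)"

definition torus_diffeo :: "(R4 \<Rightarrow> R4) \<Rightarrow> bool"
  where "torus_diffeo F \<longleftrightarrow>
    bij F \<and> smooth_within UNIV F \<and> smooth_within UNIV (inv F) \<and> descends F \<and> descends (inv F)"

definition orientation_preserving :: "(R4 \<Rightarrow> R4) \<Rightarrow> bool"
  where "orientation_preserving F \<longleftrightarrow> (\<forall>x. 0 < det (matrix (frechet_derivative F (at x))))"

definition acts_on_S1_only :: "(R4 \<Rightarrow> R4) \<Rightarrow> bool"
  where "acts_on_S1_only F \<longleftrightarrow>
    (\<exists>h :: real \<Rightarrow> real. \<forall>x. F x = (\<chi> a. if a = 0 then h (x $ 0) else x $ a))"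

end

theory Submission
  imports Defs
begin

text \<open>
  Let \<open>W = ln V\<close>, \<open>u\<^sub>i = ln (A\<^sub>i / V)\<close> and let \<open>D = V\<^sup>-\<^sup>1 d/dx\<^sub>0\<close> be the arclength derivative of the circle
  factor. The \<open>u\<^sub>i\<close> sum to zero, and with \<open>r = (\<Sum>\<^sub>i (D u\<^sub>i)\<^sup>2) / 3\<close> the flow becomes
  \<open>\<partial>\<^sub>t W = r\<close> and \<open>\<partial>\<^sub>t u\<^sub>i = D\<^sup>2 u\<^sub>i + (D u\<^sub>i)\<^sup>2 - r\<close>, while \<open>[\<partial>\<^sub>t, D] = - r D\<close>. Let \<open>E\<^sub>k\<close> be the
  sum of the integrals of \<open>(D\<^sup>k u\<^sub>i)\<^sup>2\<close> with respect to arclength. For \<open>k = 1\<close> the cubic terms integrate to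
  zero, so \<open>E\<^sub>1' \<le> - 2 E\<^sub>2\<close>; since the length of the circle is at most \<open>2\<pi>\<close>, Poincare's inequality
  gives exponential decay. For larger \<open>k\<close> integration by parts leaves the error
  \<open>C (1 + E\<^sub>k\<^sub>-\<^sub>1) E\<^sub>k\<^sup>2\<close>, which the interpolation inequality \<open>E\<^sub>k\<^sup>2 \<le> 3 E\<^sub>k\<^sub>-\<^sub>1 E\<^sub>k\<^sub>+\<^sub>1\<close> absorbs into the good term
  \<open>- E\<^sub>k\<^sub>+\<^sub>1\<close> as soon as \<open>E\<^sub>k\<^sub>-\<^sub>1\<close> is small. Hence all \<open>E\<^sub>k\<close> tend to zero, and so do the suprema of the
  \<open>D\<^sup>k u\<^sub>i\<close>; for \<open>k = 0\<close> this uses that the \<open>A\<^sub>i\<close> have equal integrals. The diffeomorphism \<open>F\<^sub>t\<close>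
  parametrizes the circle proportionally to arclength. It turns \<open>A\<^sub>i dx\<^sub>0\<close> into \<open>c f\<^sub>i dx\<^sub>0\<close> with
  \<open>f\<^sub>i = exp u\<^sub>i\<close> and \<open>c \<rightarrow> 1\<close>, and turns \<open>d/dx\<^sub>0\<close> into \<open>c D\<close>.
\<close>


section \<open>Calculus of smooth functions\<close>

text \<open>The obstacle is \<open>V\<close>, for which only the integral is bounded directly:
  derivatives in \<open>x\<close> would bring in coefficients without a priori bounds. In arclength
  the equation for the u_i has leading coefficient 1, and \<open>V\<close> acts only through the
  commutator and the growth of the arclength element, both given by \<open>r\<close>. So no
  derivative of \<open>V\<close> is estimated, and the diffeomorphisms remove \<open>V\<close> from
  the limit. Energies are used from order 1 on because an arclength derivative of a periodic
  function has a zero; supremum bounds and Poincare's inequality then rest on an upper bound for the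
  length. This bound is AM-GM for the A_i, each of integral 2 pi because A_i - 1 is the second
  derivative of a periodic function. Absorption at order k presupposes that E_(k-1) is small. For k
  = 1 this would concern E_0, which is not known to be small at that stage; the exact cancellation
  of the cubic terms starts the induction instead. A separate task is the scalar system itself:
  metric, volume and Hodge star are definite descriptions, so existence and uniqueness must be
  settled for diagonal metrics before the torsion can be computed.\<close>

primrec diff_times :: "nat \<Rightarrow> 'a set \<Rightarrow> ('a::real_normed_vector \<Rightarrow> 'b::real_normed_vector) \<Rightarrow> bool"
  where
    "diff_times 0 S f \<longleftrightarrow> True"
  | "diff_times (Suc n) S f \<longleftrightarrow> f differentiable_on S \<and>
      (\<forall>v. diff_times n S (\<lambda>x. frechet_derivative f (at x within S) v))"

lemma iter_deriv_append:
  "iter_deriv S (vs @ ws) f = iter_deriv S vs (iter_deriv S ws f)"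
  by (induction vs) auto

text \<open>\<open>iter_deriv\<close> adds a new direction outside, \<open>diff_times\<close> strips
  the innermost one; splitting a list at its last entry reconciles the two. The second form suits
  induction on the order, because the Leibniz and chain rules then apply to the function
  itself.\<close>

lemma diff_times_iff:
  "diff_times n S f \<longleftrightarrow> (\<forall>vs. length vs < n \<longrightarrow> iter_deriv S vs f differentiable_on S)"
proof (induction n arbitrary: f)
  case (Suc n)
  have "(\<forall>vs. length vs < Suc n \<longrightarrow> iter_deriv S vs f differentiable_on S) \<longleftrightarrow>
    f differentiable_on S \<and>
    (\<forall>v vs. length vs < n \<longrightarrow> iter_deriv S (vs @ [v]) f differentiable_on S)" (is "?l \<longleftrightarrow> ?r")
  proof
    assume l: ?l
    have "iter_deriv S [] f differentiable_on S" using l by (metis length_0_conv zero_less_Suc)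
    then show ?r using l by auto
  next
    assume r: ?r
    show ?l
    proof (intro allI impI)
      fix vs :: "'a list" assume "length vs < Suc n"
      then show "iter_deriv S vs f differentiable_on S"
        using r by (cases vs rule: rev_cases) auto
    qed
  qed
  then show ?case by (simp add: Suc iter_deriv_append)
qed simp

lemma smooth_within_iff: "smooth_within S f \<longleftrightarrow> (\<forall>n. diff_times n S f)"
  unfolding diff_times_iff smooth_within_def by auto

lemma diff_times_Suc_D: "diff_times (Suc n) S f \<Longrightarrow> diff_times n S f"
  unfolding diff_times_iff by auto

lemma frechet_derivative_eqI:
  assumes "open S" "x \<in> S" "(f has_derivative f') (at x)"
  shows "frechet_derivative f (at x within S) = f'"
  using frechet_derivative_at[OF assms(3)] at_within_open[OF assms(2,1)] by simp

lemma frechet_derivative_worksI: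
  assumes "open S" "x \<in> S" "f differentiable_on S"
  shows "(f has_derivative frechet_derivative f (at x within S)) (at x)"
  using assms(3)[unfolded differentiable_on_def, rule_format, OF assms(2)] at_within_open[OF assms(2,1)]
  by (simp flip: frechet_derivative_works)

lemma frechet_derivative_transform:
  assumes "open S" "x \<in> S" "\<And>y. y \<in> S \<Longrightarrow> f y = g y"
  shows "frechet_derivative f (at x within S) = frechet_derivative g (at x within S)"
proof -
  have "(f has_derivative f') (at x within S) \<longleftrightarrow> (g has_derivative f') (at x within S)" for f'
    using has_derivative_transform[OF assms(2), of f g f'] has_derivative_transform[OF assms(2), of g f f']
      assms(3) by auto
  then show ?thesis unfolding frechet_derivative_def by simp
qed

text \<open>Many identities hold only for positive times, and outside \<open>S\<close> a derivative
  within \<open>S\<close> carries no information. Smoothness must therefore depend only on the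
  values on \<open>S\<close>, at every order.\<close>

lemma diff_times_cong:
  assumes "open S" "\<And>x. x \<in> S \<Longrightarrow> f x = g x" "diff_times n S f"
  shows "diff_times n S g"
  using assms(2,3)
proof (induction n arbitrary: f g)
  case (Suc n)
  have "g differentiable_on S"
    unfolding differentiable_on_def
  proof
    fix x assume "x \<in> S"
    then show "g differentiable at x within S"
      using Suc.prems differentiable_transform_within[of f x S 1 g] by (auto simp: differentiable_on_def)
  qed
  moreover have "diff_times n S (\<lambda>x. frechet_derivative g (at x within S) v)" for v
  proof (rule Suc.IH[of "\<lambda>x. frechet_derivative f (at x within S) v"])
    show "frechet_derivative f (at x within S) v = frechet_derivative g (at x within S) v"
      if "x \<in> S" for x
      using frechet_derivative_transform[OF assms(1) that, of f g] Suc.prems(1) by simp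
  qed (use Suc.prems(2) in simp)
  ultimately show ?case by simp
qed simp

lemma smooth_within_cong:
  assumes "open S" "\<And>x. x \<in> S \<Longrightarrow> f x = g x" "smooth_within S f"
  shows "smooth_within S g"
  unfolding smooth_within_iff
proof
  fix n show "diff_times n S g"
    by (rule diff_times_cong[OF assms(1,2)]) (use assms(3) in \<open>auto simp: smooth_within_iff\<close>)
qed

lemma smooth_within_differentiable: "smooth_within S f \<Longrightarrow> f differentiable_on S"
  unfolding smooth_within_iff using diff_times.simps(2)[of 0 S f] by blast

lemma smooth_within_iter_deriv: "smooth_within S f \<Longrightarrow> smooth_within S (iter_deriv S vs f)"
  unfolding smooth_within_def by (simp flip: iter_deriv_append)

lemma smooth_within_frechet_derivative:
  "smooth_within S f \<Longrightarrow> smooth_within S (\<lambda>x. frechet_derivative f (at x within S) v)"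
  using smooth_within_iter_deriv[of S f "[v]"] by simp

lemma diff_times_SucI:
  assumes "open S" "\<And>x. x \<in> S \<Longrightarrow> (f has_derivative f' x) (at x)"
    and "\<And>v. diff_times n S (\<lambda>x. f' x v)"
  shows "diff_times (Suc n) S f"
proof -
  have "f differentiable_on S"
    unfolding differentiable_on_def differentiable_def
    using assms(2) has_derivative_at_withinI by blast
  moreover have "diff_times n S (\<lambda>x. frechet_derivative f (at x within S) v)" for v
    by (rule diff_times_cong[OF assms(1) _ assms(3)[of v]])
      (simp add: frechet_derivative_eqI[OF assms(1) _ assms(2)])
  ultimately show ?thesis by simp
qed

lemma smooth_withinI:
  assumes "open S" "\<And>x. x \<in> S \<Longrightarrow> (f has_derivative f' x) (at x)"
    and "\<And>v. smooth_within S (\<lambda>x. f' x v)"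
  shows "smooth_within S f"
  unfolding smooth_within_iff
proof
  fix n show "diff_times n S f"
    by (rule diff_times_Suc_D, rule diff_times_SucI[OF assms(1,2)])
      (use assms(3) in \<open>auto simp: smooth_within_iff\<close>)
qed

lemma smooth_within_const: "open S \<Longrightarrow> smooth_within S (\<lambda>x. c)"
proof -
  have "diff_times n S (\<lambda>x. c)" if "open S" for n and S :: "'a set" and c :: 'b
    using that
  proof (induction n arbitrary: c)
    case (Suc n)
    show ?case by (rule diff_times_SucI[of _ _ "\<lambda>_ _. 0"]) (use Suc in auto)
  qed simp
  then show "open S \<Longrightarrow> smooth_within S (\<lambda>x. c)" unfolding smooth_within_iff by blast
qed

lemma smooth_within_linear:
  assumes "open S" "bounded_linear f"
  shows "smooth_within S f"
  by (rule smooth_withinI[OF assms(1), of _ "\<lambda>x. f"])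
    (use assms in \<open>auto intro: smooth_within_const bounded_linear_imp_has_derivative\<close>)

lemma diff_times_add:
  assumes "open S" "diff_times n S f" "diff_times n S g"
  shows "diff_times n S (\<lambda>x. f x + g x)"
  using assms(2,3)
proof (induction n arbitrary: f g)
  case (Suc n)
  show ?case
    by (rule diff_times_SucI[OF assms(1), of _ "\<lambda>x v. frechet_derivative f (at x within S) v + frechet_derivative g (at x within S) v"])
      (use Suc assms(1) in \<open>auto intro!: has_derivative_add frechet_derivative_worksI\<close>)
qed simp

text \<open>Leibniz' rule pairs each factor with a derivative of the other, so the induction has to
  vary both; \<open>diff_times_Suc_D\<close> lowers the order of the factor left alone.\<close>

lemma diff_times_bilinear:
  assumes "bounded_bilinear prd" "open S" "diff_times n S f" "diff_times n S g"
  shows "diff_times n S (\<lambda>x. prd (f x) (g x))"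
  using assms(3,4)
proof (induction n arbitrary: f g)
  case (Suc n)
  show ?case
    by (rule diff_times_SucI[OF assms(2), of _ "\<lambda>x v. prd (f x) (frechet_derivative g (at x within S) v) + prd (frechet_derivative f (at x within S) v) (g x)"])
      (use Suc diff_times_Suc_D[OF Suc.prems(1)] diff_times_Suc_D[OF Suc.prems(2)] assms in
        \<open>auto intro!: bounded_bilinear.FDERIV[OF assms(1)] diff_times_add frechet_derivative_worksI\<close>)
qed simp

text \<open>The last hypothesis makes the induction close: the derivative of \<open>\<psi>\<close> is again an admissible
  outer function, up to smooth factors.\<close>

lemma diff_times_comp:
  fixes f :: "'a::real_normed_vector \<Rightarrow> real" and \<psi> \<psi>' :: "real \<Rightarrow> real"
  assumes "open S" "diff_times n S f"
    and "\<And>x. x \<in> S \<Longrightarrow> (\<psi> has_real_derivative \<psi>' (f x)) (at (f x))"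
    and "\<And>m. m < n \<Longrightarrow> diff_times m S (\<lambda>x. \<psi> (f x)) \<Longrightarrow> diff_times m S (\<lambda>x. \<psi>' (f x))"
  shows "diff_times n S (\<lambda>x. \<psi> (f x))"
  using assms(2-4)
proof (induction n)
  case (Suc n)
  have n: "diff_times n S (\<lambda>x. \<psi> (f x))"
    using Suc diff_times_Suc_D[OF Suc.prems(1)] by auto
  show ?case
  proof (rule diff_times_SucI[OF assms(1), of _ "\<lambda>x v. \<psi>' (f x) * frechet_derivative f (at x within S) v"])
    show "((\<lambda>x. \<psi> (f x)) has_derivative (\<lambda>v. \<psi>' (f x) * frechet_derivative f (at x within S) v)) (at x)"
      if "x \<in> S" for x
      using has_derivative_compose[OF frechet_derivative_worksI[OF assms(1) that, of f]
          Suc.prems(2)[OF that, unfolded has_field_derivative_def]] Suc.prems(1) by simp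
    show "diff_times n S (\<lambda>x. \<psi>' (f x) * frechet_derivative f (at x within S) v)" for v
      by (rule diff_times_bilinear[OF bounded_bilinear_mult assms(1)])
        (use Suc.prems n in auto)
  qed
qed simp

section \<open>Closure properties of smooth functions\<close>

lemma smooth_within_add:
  assumes "open S" "smooth_within S f" "smooth_within S g"
  shows "smooth_within S (\<lambda>x. f x + g x)"
  using assms by (simp add: smooth_within_iff diff_times_add)

lemma smooth_within_mult:
  fixes f g :: "'a::real_normed_vector \<Rightarrow> real"
  shows "open S \<Longrightarrow> smooth_within S f \<Longrightarrow> smooth_within S g \<Longrightarrow> smooth_within S (\<lambda>x. f x * g x)"
  by (simp add: smooth_within_iff diff_times_bilinear[OF bounded_bilinear_mult])

lemma smooth_within_scaleR_const:
  fixes f :: "'a::real_normed_vector \<Rightarrow> real"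
  assumes "open S" "smooth_within S f"
  shows "smooth_within S (\<lambda>x. f x *\<^sub>R c)"
  using smooth_within_const[OF assms(1), of c] assms
  by (simp add: smooth_within_iff diff_times_bilinear[OF bounded_bilinear_scaleR])

lemma smooth_within_diff:
  fixes f g :: "'a::real_normed_vector \<Rightarrow> real"
  shows "open S \<Longrightarrow> smooth_within S f \<Longrightarrow> smooth_within S g \<Longrightarrow> smooth_within S (\<lambda>x. f x - g x)"
  using smooth_within_add[of S f "\<lambda>x. (-1) * g x"] smooth_within_mult[of S "\<lambda>_. -1" g]
    smooth_within_const[of S "-1::real"] by simp

lemma smooth_within_sum:
  assumes "open S" "\<And>i. i \<in> I \<Longrightarrow> smooth_within S (f i)"
  shows "smooth_within S (\<lambda>x. \<Sum>i\<in>I. f i x)"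
  using assms(2)
  by (induction I rule: infinite_finite_induct)
    (simp_all add: smooth_within_const smooth_within_add assms(1))

lemma smooth_within_exp:
  fixes f :: "'a::real_normed_vector \<Rightarrow> real"
  assumes "open S" "smooth_within S f"
  shows "smooth_within S (\<lambda>x. exp (f x))"
  unfolding smooth_within_iff
  by (rule allI, rule diff_times_comp[OF assms(1), where \<psi> = exp and \<psi>' = exp])
    (use assms(2) in \<open>auto simp: smooth_within_iff\<close>)

lemma smooth_within_inverse:
  fixes f :: "'a::real_normed_vector \<Rightarrow> real"
  assumes "open S" "smooth_within S f" "\<And>x. x \<in> S \<Longrightarrow> f x \<noteq> 0"
  shows "smooth_within S (\<lambda>x. inverse (f x))"
proof -
  have c: "diff_times n S (\<lambda>x. - 1 :: real)" for n
    using smooth_within_const[OF assms(1)] unfolding smooth_within_iff by blast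
  \<comment> \<open>The derivative of \<open>inverse\<close> is a polynomial in
    \<open>inverse\<close> itself, which is what the closure hypothesis of the chain rule asks
    for.\<close>
  have "diff_times n S (\<lambda>x. inverse (f x))" for n
  proof (rule diff_times_comp[OF assms(1), where \<psi> = inverse
        and \<psi>' = "\<lambda>y. (-1) * (inverse y * inverse y)"])
    show "(inverse has_real_derivative (-1) * (inverse (f x) * inverse (f x))) (at (f x))"
      if "x \<in> S" for x
      using DERIV_inverse[OF assms(3)[OF that]] by (simp add: power2_eq_square)
    show "diff_times m S (\<lambda>x. (-1) * (inverse (f x) * inverse (f x)))"
      if "diff_times m S (\<lambda>x. inverse (f x))" for m
      by (intro diff_times_bilinear[OF bounded_bilinear_mult assms(1)] c that)
  qed (use assms(2) in \<open>simp add: smooth_within_iff\<close>)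
  then show ?thesis unfolding smooth_within_iff by blast
qed

lemma smooth_within_ln:
  fixes f :: "'a::real_normed_vector \<Rightarrow> real"
  assumes "open S" "smooth_within S f" "\<And>x. x \<in> S \<Longrightarrow> f x > 0"
  shows "smooth_within S (\<lambda>x. ln (f x))"
proof -
  have i: "smooth_within S (\<lambda>x. inverse (f x))"
    by (rule smooth_within_inverse[OF assms(1,2)]) (use assms(3) in force)
  have "diff_times n S (\<lambda>x. ln (f x))" for n
  proof (rule diff_times_comp[OF assms(1), where \<psi> = ln and \<psi>' = inverse])
    show "(ln has_real_derivative inverse (f x)) (at (f x))" if "x \<in> S" for x
      using DERIV_ln[OF assms(3)[OF that]] .
  qed (use assms(2) i in \<open>simp_all add: smooth_within_iff\<close>)
  then show ?thesis unfolding smooth_within_iff by blast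
qed

section \<open>Smooth periodic functions on the half-plane\<close>

text \<open>Time 0 is left out, which makes the set open, so that derivatives within it are ordinary
  derivatives; the limit for large times is unaffected.\<close>

definition half_plane :: "(real \<times> real) set"
  where "half_plane = {0<..} \<times> UNIV"

definition deriv_t :: "(real \<times> real \<Rightarrow> real) \<Rightarrow> real \<times> real \<Rightarrow> real"
  where "deriv_t F p = frechet_derivative F (at p within half_plane) (1, 0)"

definition deriv_x :: "(real \<times> real \<Rightarrow> real) \<Rightarrow> real \<times> real \<Rightarrow> real"
  where "deriv_x F p = frechet_derivative F (at p within half_plane) (0, 1)"

definition smooth_periodic :: "(real \<times> real \<Rightarrow> real) \<Rightarrow> bool"
  where "smooth_periodic F \<longleftrightarrow> smooth_within half_plane F \<and> (\<forall>t>0. \<forall>x. F (t, x + 2 * pi) = F (t, x))"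

lemma open_half_plane: "open half_plane"
  unfolding half_plane_def by (intro open_Times) auto

lemma mem_half_plane [simp]: "(t, x) \<in> half_plane \<longleftrightarrow> 0 < t"
  unfolding half_plane_def by simp

lemma smooth_periodic_has_derivative:
  assumes "smooth_within half_plane F" "0 < t"
  shows "(F has_derivative (\<lambda>h. fst h * deriv_t F (t, x) + snd h * deriv_x F (t, x))) (at (t, x))"
proof -
  let ?D = "frechet_derivative F (at (t, x) within half_plane)"
  have D: "(F has_derivative ?D) (at (t, x))"
    by (intro frechet_derivative_worksI open_half_plane smooth_within_differentiable assms)
      (simp add: assms)
  then have lin: "linear ?D" by (rule has_derivative_linear)
  have "?D h = fst h * deriv_t F (t, x) + snd h * deriv_x F (t, x)" for h
  proof -
    have "h = fst h *\<^sub>R (1, 0) + snd h *\<^sub>R (0, 1)" by (cases h) simp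
    then have "?D h = ?D (fst h *\<^sub>R (1, 0) + snd h *\<^sub>R (0, 1))" by simp
    also have "\<dots> = fst h * deriv_t F (t, x) + snd h * deriv_x F (t, x)"
      using lin by (simp only: linear_add linear_scale deriv_t_def deriv_x_def real_scaleR_def)
    finally show ?thesis .
  qed
  then show ?thesis using D by presburger
qed

lemma has_real_derivative_deriv_t:
  assumes "smooth_within half_plane F" "0 < t"
  shows "((\<lambda>s. F (s, x)) has_real_derivative deriv_t F (t, x)) (at t)"
proof -
  have "((\<lambda>s. (s, x)) has_derivative (\<lambda>h. (h, 0))) (at t)"
    by (auto intro!: derivative_eq_intros)
  from has_derivative_compose[OF this smooth_periodic_has_derivative[OF assms]]
  show ?thesis by (simp add: has_field_derivative_def mult_commute_abs)
qed

lemma has_real_derivative_deriv_x: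
  assumes "smooth_within half_plane F" "0 < t"
  shows "((\<lambda>y. F (t, y)) has_real_derivative deriv_x F (t, x)) (at x)"
proof -
  have "((\<lambda>y. (t, y)) has_derivative (\<lambda>h. (0, h))) (at x)"
    by (auto intro!: derivative_eq_intros)
  from has_derivative_compose[OF this smooth_periodic_has_derivative[OF assms]]
  show ?thesis by (simp add: has_field_derivative_def mult_commute_abs)
qed

lemma deriv_t_eqI:
  assumes "smooth_within half_plane F" "0 < t"
    and "((\<lambda>s. F (s, x)) has_real_derivative d) (at t)"
  shows "deriv_t F (t, x) = d"
  using has_real_derivative_deriv_t[OF assms(1,2)] assms(3) by (rule DERIV_unique)

lemma deriv_x_eqI:
  assumes "smooth_within half_plane F" "0 < t"
    and "((\<lambda>y. F (t, y)) has_real_derivative d) (at x)"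
  shows "deriv_x F (t, x) = d"
  using has_real_derivative_deriv_x[OF assms(1,2)] assms(3) by (rule DERIV_unique)

lemma smooth_deriv_t: "smooth_within half_plane F \<Longrightarrow> smooth_within half_plane (deriv_t F)"
  unfolding deriv_t_def by (rule smooth_within_frechet_derivative)

lemma smooth_deriv_x: "smooth_within half_plane F \<Longrightarrow> smooth_within half_plane (deriv_x F)"
  unfolding deriv_x_def by (rule smooth_within_frechet_derivative)

lemma smooth_continuous_on:
  "smooth_within half_plane F \<Longrightarrow> continuous_on half_plane F"
  by (intro differentiable_imp_continuous_on smooth_within_differentiable)

lemma smooth_continuous_on_slice:
  fixes F :: "real \<times> real \<Rightarrow> real"
  assumes "smooth_within half_plane F" "0 < t"
  shows "continuous_on S (\<lambda>x. F (t, x))"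
  using has_real_derivative_deriv_x[OF assms] DERIV_isCont continuous_at_imp_continuous_on by blast

lemma leibniz_half_plane:
  assumes "smooth_within half_plane F" "0 < t"
  shows "((\<lambda>s. integral {a..b} (\<lambda>x. F (s, x))) has_real_derivative
    integral {a..b} (\<lambda>x. deriv_t F (t, x))) (at t)"
proof -
  have "((\<lambda>s. integral (cbox a b) (\<lambda>x. F (s, x))) has_real_derivative
    integral (cbox a b) (\<lambda>x. deriv_t F (t, x))) (at t within {0<..})"
  proof (rule leibniz_rule_field_derivative)
    show "((\<lambda>s. F (s, x)) has_real_derivative deriv_t F (s, x)) (at s within {0<..})"
      if "s \<in> {0<..}" for s x
      using has_field_derivative_at_within[OF has_real_derivative_deriv_t[OF assms(1)]] that by simp
    show "(\<lambda>x. F (s, x)) integrable_on cbox a b" if "s \<in> {0<..}" for s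
      using that by (intro integrable_continuous smooth_continuous_on_slice assms) simp
    have "continuous_on ({0<..} \<times> cbox a b) (deriv_t F)"
      by (rule continuous_on_subset[OF smooth_continuous_on[OF smooth_deriv_t[OF assms(1)]]])
        (auto simp: half_plane_def)
    then show "continuous_on ({0<..} \<times> cbox a b) (\<lambda>(s, x). deriv_t F (s, x))"
      by (simp add: case_prod_beta)
  qed (use assms(2) in auto)
  then show ?thesis using assms(2) by (simp add: at_within_open[of t "{0<..}"])
qed

lemma integral_deriv_x:
  assumes "smooth_within half_plane F" "0 < t" "a \<le> b"
  shows "integral {a..b} (\<lambda>x. deriv_x F (t, x)) = F (t, b) - F (t, a)"
  by (rule integral_unique, rule fundamental_theorem_of_calculus[OF assms(3)])
    (use has_field_derivative_at_within[OF has_real_derivative_deriv_x[OF assms(1,2)]] in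
      \<open>simp flip: has_real_derivative_iff_has_vector_derivative\<close>)

text \<open>By the fundamental theorem, F (t, y) - F (t, a) is the integral of
  \<open>deriv_x F\<close> from a to y. Differentiating in t under the integral sign, and then in y
  at x, yields the two mixed derivatives.\<close>

lemma deriv_t_deriv_x_commute:
  assumes "smooth_within half_plane F" "0 < t"
  shows "deriv_t (deriv_x F) (t, x) = deriv_x (deriv_t F) (t, x)"
proof -
  \<comment> \<open>The identity \<open>*\<close> is available only to the right of
    \<open>a\<close>, so the base point must lie strictly to the left of \<open>x\<close>.\<close>
  define a where "a = x - 1"
  have sm: "smooth_within half_plane (deriv_t (deriv_x F))" by (intro smooth_deriv_t smooth_deriv_x assms)
  have *: "deriv_t F (t, y) = deriv_t F (t, a) + integral {a..y} (\<lambda>z. deriv_t (deriv_x F) (t, z))" if "a \<le> y" for y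
  proof -
    have "((\<lambda>s. integral {a..y} (\<lambda>z. deriv_x F (s, z))) has_real_derivative deriv_t F (t, y) - deriv_t F (t, a)) (at t)"
    proof (rule has_field_derivative_transform_within_open[where S = "{0<..}"])
      show "((\<lambda>s. F (s, y) - F (s, a)) has_real_derivative deriv_t F (t, y) - deriv_t F (t, a)) (at t)"
        by (intro derivative_intros has_real_derivative_deriv_t assms)
    qed (use assms integral_deriv_x[OF assms(1) _ that] in auto)
    from DERIV_unique[OF leibniz_half_plane[OF smooth_deriv_x[OF assms(1)] assms(2)] this]
    show ?thesis by simp
  qed
  have "((\<lambda>y. integral {a..y} (\<lambda>z. deriv_t (deriv_x F) (t, z))) has_real_derivative deriv_t (deriv_x F) (t, x))
      (at x within {a..x+1})"
    by (rule integral_has_real_derivative[OF smooth_continuous_on_slice[OF sm assms(2)]])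
      (auto simp: a_def)
  then have "((\<lambda>y. integral {a..y} (\<lambda>z. deriv_t (deriv_x F) (t, z))) has_real_derivative deriv_t (deriv_x F) (t, x)) (at x)"
    by (subst (asm) at_within_interior) (auto simp: a_def)
  from DERIV_add[OF DERIV_const[of "deriv_t F (t, a)"] this]
  have "((\<lambda>y. deriv_t F (t, a) + integral {a..y} (\<lambda>z. deriv_t (deriv_x F) (t, z))) has_real_derivative
      deriv_t (deriv_x F) (t, x)) (at x)"
    by simp
  then have "((\<lambda>y. deriv_t F (t, y)) has_real_derivative deriv_t (deriv_x F) (t, x)) (at x)"
  proof (rule has_field_derivative_transform_within_open[where S = "{a<..}"])
    show "deriv_t F (t, a) + integral {a..y} (\<lambda>z. deriv_t (deriv_x F) (t, z)) = deriv_t F (t, y)" if "y \<in> {a<..}" for y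
      using *[of y] that by simp
  qed (auto simp: a_def)
  from deriv_x_eqI[OF smooth_deriv_t[OF assms(1)] assms(2) this] show ?thesis by simp
qed

section \<open>Calculus of smooth periodic functions\<close>

lemma smooth_periodic_smooth: "smooth_periodic F \<Longrightarrow> smooth_within half_plane F"
  and smooth_periodic_periodic: "smooth_periodic F \<Longrightarrow> 0 < t \<Longrightarrow> F (t, x + 2 * pi) = F (t, x)"
  unfolding smooth_periodic_def by auto

lemma smooth_periodic_deriv_x:
  assumes "smooth_periodic F"
  shows "smooth_periodic (deriv_x F)"
  unfolding smooth_periodic_def
proof (intro conjI allI impI smooth_deriv_x smooth_periodic_smooth assms)
  fix t x :: real assume t: "0 < t"
  have "((\<lambda>y. F (t, y + 2 * pi)) has_real_derivative deriv_x F (t, x + 2 * pi)) (at x)"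
    using has_real_derivative_deriv_x[OF smooth_periodic_smooth[OF assms] t, of "x + 2 * pi"] by (simp add: DERIV_shift)
  then have "((\<lambda>y. F (t, y)) has_real_derivative deriv_x F (t, x + 2 * pi)) (at x)"
    by (simp add: smooth_periodic_periodic[OF assms t])
  from deriv_x_eqI[OF smooth_periodic_smooth[OF assms] t this] show "deriv_x F (t, x + 2 * pi) = deriv_x F (t, x)" by simp
qed

lemma smooth_periodic_const: "smooth_periodic (\<lambda>p. c)"
  unfolding smooth_periodic_def by (simp add: smooth_within_const open_half_plane)

lemma smooth_periodic_add: "smooth_periodic F \<Longrightarrow> smooth_periodic G \<Longrightarrow> smooth_periodic (\<lambda>p. F p + G p)"
  unfolding smooth_periodic_def by (simp add: smooth_within_add open_half_plane)

lemma smooth_periodic_diff: "smooth_periodic F \<Longrightarrow> smooth_periodic G \<Longrightarrow> smooth_periodic (\<lambda>p. F p - G p)"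
  unfolding smooth_periodic_def by (simp add: smooth_within_diff open_half_plane)

lemma smooth_periodic_mult: "smooth_periodic F \<Longrightarrow> smooth_periodic G \<Longrightarrow> smooth_periodic (\<lambda>p. F p * G p)"
  unfolding smooth_periodic_def by (simp add: smooth_within_mult open_half_plane)

lemma smooth_periodic_power: "smooth_periodic F \<Longrightarrow> smooth_periodic (\<lambda>p. F p ^ n)"
  by (induction n) (simp_all add: smooth_periodic_const smooth_periodic_mult)

lemma smooth_periodic_sum: "(\<And>i. i \<in> I \<Longrightarrow> smooth_periodic (F i)) \<Longrightarrow> smooth_periodic (\<lambda>p. \<Sum>i\<in>I. F i p)"
  unfolding smooth_periodic_def by (simp add: smooth_within_sum open_half_plane)

lemma smooth_periodic_exp: "smooth_periodic F \<Longrightarrow> smooth_periodic (\<lambda>p. exp (F p))"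
  unfolding smooth_periodic_def by (simp add: smooth_within_exp open_half_plane)

lemma smooth_periodic_inverse:
  assumes "smooth_periodic F" "\<And>t x. 0 < t \<Longrightarrow> F (t, x) \<noteq> 0"
  shows "smooth_periodic (\<lambda>p. inverse (F p))"
proof -
  have "smooth_within half_plane (\<lambda>p. inverse (F p))"
    by (rule smooth_within_inverse[OF open_half_plane smooth_periodic_smooth[OF assms(1)]])
      (use assms(2) in \<open>auto simp: half_plane_def\<close>)
  then show ?thesis using assms(1) unfolding smooth_periodic_def by simp
qed

lemma smooth_periodic_ln:
  assumes "smooth_periodic F" "\<And>t x. 0 < t \<Longrightarrow> F (t, x) > 0"
  shows "smooth_periodic (\<lambda>p. ln (F p))"
proof -
  have "smooth_within half_plane (\<lambda>p. ln (F p))"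
    by (rule smooth_within_ln[OF open_half_plane smooth_periodic_smooth[OF assms(1)]])
      (use assms(2) in \<open>auto simp: half_plane_def\<close>)
  then show ?thesis using assms(1) unfolding smooth_periodic_def by simp
qed

lemma smooth_periodic_cong:
  assumes "\<And>t x. 0 < t \<Longrightarrow> F (t, x) = G (t, x)" "smooth_periodic F"
  shows "smooth_periodic G"
  using smooth_within_cong[OF open_half_plane _ smooth_periodic_smooth[OF assms(2)], of G] assms
  unfolding smooth_periodic_def by (auto simp: half_plane_def)

lemma deriv_x_cong:
  assumes "\<And>t x. 0 < t \<Longrightarrow> F (t, x) = G (t, x)" "0 < t"
  shows "deriv_x F (t, x) = deriv_x G (t, x)"
  unfolding deriv_x_def using frechet_derivative_transform[OF open_half_plane, of "(t, x)" F G] assms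
  by (auto simp: half_plane_def)

lemma deriv_x_const: "0 < t \<Longrightarrow> deriv_x (\<lambda>p. c) (t, x) = 0"
  by (rule deriv_x_eqI) (auto intro: smooth_within_const open_half_plane)

lemma deriv_x_add:
  assumes "smooth_periodic F" "smooth_periodic G" "0 < t"
  shows "deriv_x (\<lambda>p. F p + G p) (t, x) = deriv_x F (t, x) + deriv_x G (t, x)"
  by (rule deriv_x_eqI) (use assms in \<open>auto intro!: smooth_periodic_smooth smooth_periodic_add DERIV_add has_real_derivative_deriv_x\<close>)

lemma deriv_x_diff:
  assumes "smooth_periodic F" "smooth_periodic G" "0 < t"
  shows "deriv_x (\<lambda>p. F p - G p) (t, x) = deriv_x F (t, x) - deriv_x G (t, x)"
  by (rule deriv_x_eqI) (use assms in \<open>auto intro!: smooth_periodic_smooth smooth_periodic_diff DERIV_diff has_real_derivative_deriv_x\<close>)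

lemma deriv_x_mult:
  assumes "smooth_periodic F" "smooth_periodic G" "0 < t"
  shows "deriv_x (\<lambda>p. F p * G p) (t, x) = deriv_x F (t, x) * G (t, x) + deriv_x G (t, x) * F (t, x)"
  by (rule deriv_x_eqI) (use assms in \<open>auto intro!: smooth_periodic_smooth smooth_periodic_mult DERIV_mult has_real_derivative_deriv_x\<close>)

lemma deriv_x_sum:
  assumes "\<And>i. i \<in> I \<Longrightarrow> smooth_periodic (F i)" "0 < t"
  shows "deriv_x (\<lambda>p. \<Sum>i\<in>I. F i p) (t, x) = (\<Sum>i\<in>I. deriv_x (F i) (t, x))"
  by (rule deriv_x_eqI) (use assms in \<open>auto intro!: smooth_periodic_smooth smooth_periodic_sum DERIV_sum has_real_derivative_deriv_x\<close>)

lemma deriv_x_exp: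
  assumes "smooth_periodic F" "0 < t"
  shows "deriv_x (\<lambda>p. exp (F p)) (t, x) = exp (F (t, x)) * deriv_x F (t, x)"
  by (rule deriv_x_eqI) (use assms in \<open>auto intro!: smooth_periodic_smooth smooth_periodic_exp DERIV_fun_exp has_real_derivative_deriv_x\<close>)

lemma deriv_t_diff:
  assumes "smooth_periodic F" "smooth_periodic G" "0 < t"
  shows "deriv_t (\<lambda>p. F p - G p) (t, x) = deriv_t F (t, x) - deriv_t G (t, x)"
  by (rule deriv_t_eqI) (use assms in \<open>auto intro!: smooth_periodic_smooth smooth_periodic_diff DERIV_diff has_real_derivative_deriv_t\<close>)

lemma deriv_t_mult:
  assumes "smooth_periodic F" "smooth_periodic G" "0 < t"
  shows "deriv_t (\<lambda>p. F p * G p) (t, x) = deriv_t F (t, x) * G (t, x) + deriv_t G (t, x) * F (t, x)"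
  by (rule deriv_t_eqI) (use assms in \<open>auto intro!: smooth_periodic_smooth smooth_periodic_mult DERIV_mult has_real_derivative_deriv_t\<close>)

lemma deriv_t_sum:
  assumes "\<And>i. i \<in> I \<Longrightarrow> smooth_periodic (F i)" "0 < t"
  shows "deriv_t (\<lambda>p. \<Sum>i\<in>I. F i p) (t, x) = (\<Sum>i\<in>I. deriv_t (F i) (t, x))"
  by (rule deriv_t_eqI) (use assms in \<open>auto intro!: smooth_periodic_smooth smooth_periodic_sum DERIV_sum has_real_derivative_deriv_t\<close>)

lemma deriv_t_exp:
  assumes "smooth_periodic F" "0 < t"
  shows "deriv_t (\<lambda>p. exp (F p)) (t, x) = exp (F (t, x)) * deriv_t F (t, x)"
  by (rule deriv_t_eqI) (use assms in \<open>auto intro!: smooth_periodic_smooth smooth_periodic_exp DERIV_fun_exp has_real_derivative_deriv_t\<close>)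

lemma deriv_t_ln:
  assumes "smooth_periodic F" "\<And>t x. 0 < t \<Longrightarrow> F (t, x) > 0" "0 < t"
  shows "deriv_t (\<lambda>p. ln (F p)) (t, x) = deriv_t F (t, x) / F (t, x)"
proof (rule deriv_t_eqI)
  have "((\<lambda>s. ln (F (s, x))) has_real_derivative inverse (F (t, x)) * deriv_t F (t, x)) (at t)"
    using DERIV_chain2[OF DERIV_ln[OF assms(2)[OF assms(3)]] has_real_derivative_deriv_t[OF smooth_periodic_smooth[OF assms(1)] assms(3)]] .
  then show "((\<lambda>s. ln (F (s, x))) has_real_derivative deriv_t F (t, x) / F (t, x)) (at t)"
    by (simp add: divide_inverse mult.commute)
qed (use assms in \<open>auto intro!: smooth_periodic_smooth smooth_periodic_ln\<close>)

lemma integral_deriv_x_periodic: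
  assumes "smooth_periodic F" "0 < t"
  shows "integral {0..2 * pi} (\<lambda>x. deriv_x F (t, x)) = 0"
  using integral_deriv_x[OF smooth_periodic_smooth[OF assms(1)] assms(2), of 0 "2 * pi"]
    smooth_periodic_periodic[OF assms(1,2), of 0] by simp

section \<open>Evolution of the logarithms of the metric coefficients\<close>

text \<open>The integral of (f - s g)^2 w is a nonnegative quadratic polynomial in s, so its
  discriminant cannot be positive.\<close>

lemma cauchy_schwarz_weighted:
  fixes f g w :: "real \<Rightarrow> real"
  assumes cont: "continuous_on {a..b} f" "continuous_on {a..b} g" "continuous_on {a..b} w"
    and w: "\<And>x. x \<in> {a..b} \<Longrightarrow> 0 \<le> w x"
  shows "(integral {a..b} (\<lambda>x. f x * g x * w x))\<^sup>2
    \<le> integral {a..b} (\<lambda>x. (f x)\<^sup>2 * w x) * integral {a..b} (\<lambda>x. (g x)\<^sup>2 * w x)"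
proof -
  define p q r where "p = integral {a..b} (\<lambda>x. (f x)\<^sup>2 * w x)"
    and "q = integral {a..b} (\<lambda>x. f x * g x * w x)"
    and "r = integral {a..b} (\<lambda>x. (g x)\<^sup>2 * w x)"
  have int: "(\<lambda>x. (f x)\<^sup>2 * w x) integrable_on {a..b}" "(\<lambda>x. f x * g x * w x) integrable_on {a..b}"
    "(\<lambda>x. (g x)\<^sup>2 * w x) integrable_on {a..b}"
    by (intro integrable_continuous_real continuous_intros cont)+
  have *: "0 \<le> p - 2 * s * q + s\<^sup>2 * r" for s
  proof -
    have "0 \<le> integral {a..b} (\<lambda>x. (f x - s * g x)\<^sup>2 * w x)"
      by (rule integral_nonneg)
        (auto intro!: integrable_continuous_real continuous_intros cont mult_nonneg_nonneg w)
    also have "(\<lambda>x. (f x - s * g x)\<^sup>2 * w x) =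
        (\<lambda>x. (f x)\<^sup>2 * w x - (2 * s) * (f x * g x * w x) + s\<^sup>2 * ((g x)\<^sup>2 * w x))"
      by (auto simp: power2_eq_square algebra_simps)
    also have "integral {a..b} \<dots> = p - (2 * s) * q + s\<^sup>2 * r"
      unfolding p_def q_def r_def
      by (simp add: integral_add integral_diff int integrable_diff integrable_on_mult_right)
    finally show ?thesis .
  qed
  have r0: "0 \<le> r"
    unfolding r_def by (rule integral_nonneg[OF int(3)]) (simp add: w)
  have "q\<^sup>2 \<le> p * r"
  proof (cases "r = 0")
    case True
    have "q = 0"
    proof (rule ccontr)
      assume "q \<noteq> 0"
      \<comment> \<open>With r = 0 the polynomial is affine in s; this choice gives it the value
        -1.\<close>
      then show False using *[of "(p + 1) / (2 * q)"] True by (simp add: field_simps)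
    qed
    then show ?thesis using True by simp
  next
    case False
    then have "0 < r" using r0 by simp
    \<comment> \<open>The minimizer of the polynomial.\<close>
    then show ?thesis using *[of "q / r"]
      by (simp add: power2_eq_square field_simps)
  qed
  then show ?thesis unfolding p_def q_def r_def .
qed

text \<open>Gronwall: once the inequality holds, \<open>f t * exp (c * t)\<close> is nonincreasing.
  It is required only eventually, because the energy inequalities become dissipative only after the
  lower energies have become small.\<close>

lemma tendsto_zero_of_decay:
  fixes f :: "real \<Rightarrow> real"
  assumes "c > 0" and nonneg: "\<And>t. 0 < t \<Longrightarrow> 0 \<le> f t"
    and ev: "eventually (\<lambda>t. \<exists>d. (f has_real_derivative d) (at t) \<and> d \<le> - c * f t) at_top"
  shows "(f \<longlongrightarrow> 0) at_top"
proof -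
  obtain T0 where T0: "\<And>t. T0 \<le> t \<Longrightarrow> \<exists>d. (f has_real_derivative d) (at t) \<and> d \<le> - c * f t"
    using ev unfolding eventually_at_top_linorder by blast
  define T where "T = max T0 1"
  have bound: "f t \<le> f T * exp (c * T) * exp (- c * t)" if "T \<le> t" for t
  proof -
    have "f t * exp (c * t) \<le> f T * exp (c * T)"
    proof (rule DERIV_nonpos_imp_nonincreasing[OF that])
      fix s assume "T \<le> s" "s \<le> t"
      then obtain d where d: "(f has_real_derivative d) (at s)" "d \<le> - c * f s"
        using T0[of s] unfolding T_def by auto
      have "((\<lambda>s. f s * exp (c * s)) has_real_derivative d * exp (c * s) + exp (c * s) * c * f s) (at s)"
        by (rule derivative_eq_intros d(1) refl | simp)+
      moreover have "d * exp (c * s) + exp (c * s) * c * f s \<le> 0"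
      proof -
        have "(d + c * f s) * exp (c * s) \<le> 0"
          using d(2) by (intro mult_nonpos_nonneg) auto
        then show ?thesis by (simp add: algebra_simps)
      qed
      ultimately show "\<exists>y. ((\<lambda>s. f s * exp (c * s)) has_real_derivative y) (at s) \<and> y \<le> 0" by blast
    qed
    then have "f t * exp (c * t) * exp (- c * t) \<le> f T * exp (c * T) * exp (- c * t)"
      by (rule mult_right_mono) simp
    then show ?thesis by (simp add: mult.assoc flip: exp_add)
  qed
  have "filterlim (\<lambda>t. - c * t) at_bot at_top"
    by (rule filterlim_tendsto_neg_mult_at_bot[OF tendsto_const _ filterlim_ident]) (use assms(1) in simp)
  then have "((\<lambda>t. exp (- c * t)) \<longlongrightarrow> 0) at_top"
    by (rule filterlim_compose[OF exp_at_bot])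
  then have lim: "((\<lambda>t. f T * exp (c * T) * exp (- c * t)) \<longlongrightarrow> 0) at_top"
    by (rule tendsto_mult_right_zero)
  show ?thesis
  proof (rule tendsto_sandwich[OF _ _ tendsto_const lim])
    show "eventually (\<lambda>t. 0 \<le> f t) at_top"
      using eventually_gt_at_top[of 0] by eventually_elim (rule nonneg)
    show "eventually (\<lambda>t. f t \<le> f T * exp (c * T) * exp (- c * t)) at_top"
      using eventually_ge_at_top[of T] by eventually_elim (rule bound)
  qed
qed

section \<open>The flow in logarithmic variables\<close>

definition logvol :: "(3 \<Rightarrow> real \<times> real \<Rightarrow> real) \<Rightarrow> real \<times> real \<Rightarrow> real"
  where "logvol A p = (\<Sum>i\<in>UNIV. ln (A i p)) / 3"

definition logratio :: "(3 \<Rightarrow> real \<times> real \<Rightarrow> real) \<Rightarrow> 3 \<Rightarrow> real \<times> real \<Rightarrow> real"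
  where "logratio A i p = ln (A i p) - logvol A p"

text \<open>Separated from \<open>simple_flow\<close> so that \<open>W\<close> and \<open>u\<close>
  are known to be smooth while the flow equation, which is formulated with them, is still being
  derived.\<close>

locale simple_functions =
  fixes A :: "3 \<Rightarrow> real \<times> real \<Rightarrow> real"
  assumes smooth_periodic_A: "smooth_periodic (A i)"
    and A_pos: "0 < t \<Longrightarrow> 0 < A i (t, x)"
begin

abbreviation "W \<equiv> logvol A"
abbreviation "u \<equiv> logratio A"

lemma smooth_periodic_W: "smooth_periodic W"
proof -
  have "smooth_periodic (\<lambda>p. (\<Sum>i\<in>UNIV. ln (A i p)) * (1 / 3))"
    by (intro smooth_periodic_mult smooth_periodic_sum smooth_periodic_ln smooth_periodic_A smooth_periodic_const A_pos)
  then show ?thesis unfolding logvol_def[abs_def] by simp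
qed

lemma smooth_periodic_u: "smooth_periodic (u i)"
  unfolding logratio_def[abs_def] by (intro smooth_periodic_diff smooth_periodic_ln smooth_periodic_A smooth_periodic_W A_pos)

end

text \<open>As A_i = V exp u_i, the function under \<open>deriv_x\<close> is (log (A_i / V))' A_i /
  V^2, the coefficient of the torsion form. \<open>A_integral\<close> reflects A_i = 1 + phi_i''
  with phi_i periodic.\<close>

locale simple_flow = simple_functions +
  assumes A_integral: "0 < t \<Longrightarrow> integral {0..2 * pi} (\<lambda>x. A i (t, x)) = 2 * pi"
    and flow: "0 < t \<Longrightarrow> deriv_t (A i) (t, x) =
      deriv_x (\<lambda>p. exp (u i p) * (exp (- W p) * deriv_x (u i) p)) (t, x)"
begin

definition V :: "real \<times> real \<Rightarrow> real"
  where "V p = exp (W p)"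

text \<open>\<open>D\<close> is the derivative with respect to arclength on the circle.\<close>

definition D :: "(real \<times> real \<Rightarrow> real) \<Rightarrow> real \<times> real \<Rightarrow> real"
  where "D F p = exp (- W p) * deriv_x F p"

definition U :: "3 \<Rightarrow> nat \<Rightarrow> real \<times> real \<Rightarrow> real"
  where "U i k = (D ^^ k) (u i)"

definition r :: "real \<times> real \<Rightarrow> real"
  where "r p = (\<Sum>i\<in>UNIV. (U i 1 p)\<^sup>2) * (1 / 3)"

lemma U_0: "U i 0 = u i" and U_Suc: "U i (Suc k) = D (U i k)"
  unfolding U_def by simp_all

lemma U_1: "U i 1 = D (u i)" and U_2: "U i 2 = D (D (u i))"
  unfolding U_def by (simp_all add: numeral_2_eq_2)

lemma V_pos: "0 < V p"
  unfolding V_def by simp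

lemma deriv_x_eq: "deriv_x F p = D F p * V p"
  unfolding D_def V_def by (simp flip: exp_add add: algebra_simps)

lemma smooth_periodic_V: "smooth_periodic V"
  unfolding V_def[abs_def] by (intro smooth_periodic_exp smooth_periodic_W)

lemma smooth_periodic_D: "smooth_periodic F \<Longrightarrow> smooth_periodic (D F)"
  unfolding D_def[abs_def] using smooth_periodic_mult[OF smooth_periodic_exp[OF smooth_periodic_mult[OF smooth_periodic_const[of "-1"] smooth_periodic_W]] smooth_periodic_deriv_x[of F]]
  by simp

lemma smooth_periodic_D_power: "smooth_periodic F \<Longrightarrow> smooth_periodic ((D ^^ k) F)"
  by (induction k) (simp_all add: smooth_periodic_D)

lemma smooth_periodic_U: "smooth_periodic (U i k)"
  unfolding U_def by (intro smooth_periodic_D_power smooth_periodic_u)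

lemma smooth_periodic_r: "smooth_periodic r"
  unfolding r_def[abs_def] by (intro smooth_periodic_mult smooth_periodic_sum smooth_periodic_power smooth_periodic_U smooth_periodic_const)

lemma D_cong:
  assumes "\<And>t x. 0 < t \<Longrightarrow> F (t, x) = G (t, x)" "0 < t"
  shows "D F (t, x) = D G (t, x)"
  unfolding D_def using deriv_x_cong[of F G, OF assms] by simp

lemma D_const: "0 < t \<Longrightarrow> D (\<lambda>p. c) (t, x) = 0"
  unfolding D_def by (simp add: deriv_x_const)

lemma D_add:
  "smooth_periodic F \<Longrightarrow> smooth_periodic G \<Longrightarrow> 0 < t \<Longrightarrow> D (\<lambda>p. F p + G p) (t, x) = D F (t, x) + D G (t, x)"
  unfolding D_def by (simp add: deriv_x_add algebra_simps)

lemma D_diff: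
  "smooth_periodic F \<Longrightarrow> smooth_periodic G \<Longrightarrow> 0 < t \<Longrightarrow> D (\<lambda>p. F p - G p) (t, x) = D F (t, x) - D G (t, x)"
  unfolding D_def by (simp add: deriv_x_diff algebra_simps)

lemma D_mult:
  "smooth_periodic F \<Longrightarrow> smooth_periodic G \<Longrightarrow> 0 < t \<Longrightarrow>
    D (\<lambda>p. F p * G p) (t, x) = D F (t, x) * G (t, x) + F (t, x) * D G (t, x)"
  unfolding D_def by (simp add: deriv_x_mult algebra_simps)

lemma D_sum:
  "(\<And>i. i \<in> I \<Longrightarrow> smooth_periodic (F i)) \<Longrightarrow> 0 < t \<Longrightarrow>
    D (\<lambda>p. \<Sum>i\<in>I. F i p) (t, x) = (\<Sum>i\<in>I. D (F i) (t, x))"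
  unfolding D_def by (simp add: deriv_x_sum sum_distrib_left)

lemma D_exp:
  "smooth_periodic F \<Longrightarrow> 0 < t \<Longrightarrow> D (\<lambda>p. exp (F p)) (t, x) = exp (F (t, x)) * D F (t, x)"
  unfolding D_def by (simp add: deriv_x_exp)

lemma sum_U: "0 < t \<Longrightarrow> (\<Sum>i\<in>UNIV. U i k (t, x)) = 0"
proof (induction k arbitrary: t x)
  case 0
  show ?case by (simp add: U_0 logratio_def logvol_def sum_subtractf)
next
  case (Suc k)
  have "(\<Sum>i\<in>UNIV. U i (Suc k) (t, x)) = D (\<lambda>p. \<Sum>i\<in>UNIV. U i k p) (t, x)"
    by (simp add: U_Suc D_sum smooth_periodic_U Suc.prems)
  also have "\<dots> = D (\<lambda>p. 0) (t, x)"
    by (rule D_cong) (simp_all add: Suc)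
  finally show ?case by (simp add: D_const Suc.prems)
qed

lemma A_eq: "0 < t \<Longrightarrow> A i (t, x) = exp (u i (t, x)) * V (t, x)"
  unfolding V_def logratio_def by (simp add: A_pos flip: exp_add)

text \<open>Since \<open>deriv_x\<close> is \<open>V\<close> times \<open>D\<close>, the flow
  equates the time derivative of A_i with V D (exp u_i D u_i); dividing by A_i = V exp u_i removes
  both factors.\<close>

lemma deriv_t_ln_A:
  assumes "0 < t"
  shows "deriv_t (\<lambda>p. ln (A i p)) (t, x) = U i 2 (t, x) + (U i 1 (t, x))\<^sup>2"
proof -
  have "deriv_t (A i) (t, x) = deriv_x (\<lambda>p. exp (u i p) * U i 1 p) (t, x)"
    using flow[OF assms, of i x] unfolding U_def D_def[abs_def] by simp
  also have "\<dots> = D (\<lambda>p. exp (u i p) * U i 1 p) (t, x) * V (t, x)"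
    by (rule deriv_x_eq)
  also have "\<dots> = A i (t, x) * (U i 2 (t, x) + (U i 1 (t, x))\<^sup>2)"
    unfolding D_mult[OF smooth_periodic_exp[OF smooth_periodic_u] smooth_periodic_D[OF smooth_periodic_u] assms] D_exp[OF smooth_periodic_u assms] A_eq[OF assms] U_1 U_2
    by (simp add: power2_eq_square algebra_simps)
  finally show ?thesis
    using A_pos[OF assms, of i x] by (simp add: deriv_t_ln[OF smooth_periodic_A A_pos assms])
qed

text \<open>In the mean over i the second derivatives cancel, because the u_i sum to zero. This is
  why the volume changes at a rate of first order only.\<close>

lemma deriv_t_W:
  assumes "0 < t"
  shows "deriv_t W (t, x) = r (t, x)"
proof -
  have "deriv_t (\<lambda>p. (\<Sum>i\<in>UNIV. ln (A i p)) * (1 / 3)) (t, x) = (\<Sum>i\<in>UNIV. deriv_t (\<lambda>p. ln (A i p)) (t, x)) * (1 / 3)"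
    using assms by (simp only: deriv_t_mult deriv_t_sum smooth_periodic_sum smooth_periodic_ln smooth_periodic_A A_pos smooth_periodic_const)
      (simp add: deriv_t_eqI[OF smooth_periodic_smooth[OF smooth_periodic_const]])
  also have "\<dots> = r (t, x)"
    by (simp add: deriv_t_ln_A assms sum.distrib sum_U r_def)
  finally show ?thesis unfolding logvol_def[abs_def] by simp
qed

lemma deriv_t_u: "0 < t \<Longrightarrow> deriv_t (u i) (t, x) = U i 2 (t, x) + ((U i 1 (t, x))\<^sup>2 - r (t, x))"
  unfolding logratio_def[abs_def]
  by (simp add: deriv_t_diff smooth_periodic_ln smooth_periodic_A A_pos smooth_periodic_W deriv_t_ln_A deriv_t_W)

lemma deriv_t_D:
  assumes "smooth_periodic F" "0 < t"
  shows "deriv_t (D F) (t, x) = D (deriv_t F) (t, x) - r (t, x) * D F (t, x)"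
proof -
  have s: "smooth_periodic (\<lambda>p. (-1) * W p)" by (intro smooth_periodic_mult smooth_periodic_const smooth_periodic_W)
  have "deriv_t (\<lambda>p. (-1) * W p) (t, x) = - r (t, x)"
    by (rule deriv_t_eqI[OF smooth_periodic_smooth[OF s] assms(2)])
      (use has_real_derivative_deriv_t[OF smooth_periodic_smooth[OF smooth_periodic_W] assms(2)] in
        \<open>auto intro!: derivative_eq_intros simp: deriv_t_W assms\<close>)
  then have "deriv_t (\<lambda>p. exp ((-1) * W p)) (t, x) = - exp (- W (t, x)) * r (t, x)"
    by (simp only: deriv_t_exp[OF s assms(2)]) simp
  then have "deriv_t (\<lambda>p. exp ((-1) * W p) * deriv_x F p) (t, x) =
      - exp (- W (t, x)) * r (t, x) * deriv_x F (t, x) + deriv_x (deriv_t F) (t, x) * exp (- W (t, x))"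
    by (simp only: deriv_t_mult[OF smooth_periodic_exp[OF s] smooth_periodic_deriv_x[OF assms(1)] assms(2)]
        deriv_t_deriv_x_commute[OF smooth_periodic_smooth[OF assms(1)] assms(2)]) simp
  then show ?thesis unfolding D_def[abs_def] by (simp add: algebra_simps)
qed

text \<open>The lower-order part of the evolution of the iterated derivatives, in divergence form and with
  the index shifted by one.\<close>

primrec X :: "3 \<Rightarrow> nat \<Rightarrow> real \<times> real \<Rightarrow> real"
  where
    "X i 0 = (\<lambda>p. (U i 1 p)\<^sup>2 - r p)"
  | "X i (Suc k) = (\<lambda>p. D (X i k) p - r p * U i (Suc k) p)"

lemma smooth_periodic_X: "smooth_periodic (X i k)"
  by (induction k) (simp_all add: smooth_periodic_diff smooth_periodic_power smooth_periodic_U smooth_periodic_r smooth_periodic_D smooth_periodic_mult)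

text \<open>The commutator term left outside at one order slips under the next \<open>D\<close> and
  becomes the term with \<open>r\<close> in \<open>X i (Suc k)\<close>; only the newest one remains
  outside.\<close>

lemma deriv_t_U:
  "0 < t \<Longrightarrow> deriv_t (U i (Suc k)) (t, x) =
    D (\<lambda>p. U i (k + 2) p + X i k p) (t, x) - r (t, x) * U i (Suc k) (t, x)"
proof (induction k arbitrary: t x)
  case 0
  have "deriv_t (D (u i)) (t, x) = D (deriv_t (u i)) (t, x) - r (t, x) * D (u i) (t, x)"
    by (rule deriv_t_D[OF smooth_periodic_u 0])
  also have "D (deriv_t (u i)) (t, x) = D (\<lambda>p. U i (0 + 2) p + X i 0 p) (t, x)"
    by (rule D_cong[OF _ 0]) (simp add: deriv_t_u numeral_2_eq_2)
  finally show ?case by (simp only: U_Suc U_0)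
next
  case (Suc k)
  have "deriv_t (D (U i (Suc k))) (t, x) = D (deriv_t (U i (Suc k))) (t, x) - r (t, x) * D (U i (Suc k)) (t, x)"
    by (rule deriv_t_D[OF smooth_periodic_U Suc.prems])
  also have "D (deriv_t (U i (Suc k))) (t, x) = D (\<lambda>p. U i (Suc k + 2) p + X i (Suc k) p) (t, x)"
    by (rule D_cong[OF _ Suc.prems]) (simp add: Suc.IH D_add smooth_periodic_U smooth_periodic_X flip: U_Suc)
  finally show ?case by (simp only: U_Suc)
qed

end

section \<open>Energy estimates\<close>

context simple_flow
begin

section \<open>Integration with respect to arclength\<close>

definition wint :: "(real \<times> real \<Rightarrow> real) \<Rightarrow> real \<Rightarrow> real"
  where "wint F t = integral {0..2 * pi} (\<lambda>x. F (t, x) * V (t, x))"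

lemma integrable_slice: "smooth_periodic F \<Longrightarrow> 0 < t \<Longrightarrow> (\<lambda>x. F (t, x)) integrable_on {a..b}"
  by (intro integrable_continuous_real smooth_continuous_on_slice smooth_periodic_smooth)

lemma integrable_weighted: "smooth_periodic F \<Longrightarrow> 0 < t \<Longrightarrow> (\<lambda>x. F (t, x) * V (t, x)) integrable_on {a..b}"
  using integrable_slice[OF smooth_periodic_mult[OF _ smooth_periodic_V]] .

lemma wint_add: "smooth_periodic F \<Longrightarrow> smooth_periodic G \<Longrightarrow> 0 < t \<Longrightarrow> wint (\<lambda>p. F p + G p) t = wint F t + wint G t"
  unfolding wint_def by (simp add: ring_distribs integral_add integrable_weighted)

lemma wint_cmult: "wint (\<lambda>p. c * F p) t = c * wint F t"
  unfolding wint_def by (simp add: mult.assoc)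

lemma wint_sum:
  assumes "\<And>i. i \<in> I \<Longrightarrow> smooth_periodic (F i)" "finite I" "0 < t"
  shows "wint (\<lambda>p. \<Sum>i\<in>I. F i p) t = (\<Sum>i\<in>I. wint (F i) t)"
  unfolding wint_def by (simp add: sum_distrib_right integral_sum integrable_weighted assms)

lemma wint_mono:
  assumes "smooth_periodic F" "smooth_periodic G" "0 < t" "\<And>x. F (t, x) \<le> G (t, x)"
  shows "wint F t \<le> wint G t"
  unfolding wint_def
  by (intro integral_le integrable_weighted assms mult_right_mono less_imp_le V_pos)

lemma wint_nonneg: "smooth_periodic F \<Longrightarrow> 0 < t \<Longrightarrow> (\<And>x. 0 \<le> F (t, x)) \<Longrightarrow> 0 \<le> wint F t"
  unfolding wint_def
  by (intro integral_nonneg integrable_weighted mult_nonneg_nonneg less_imp_le[OF V_pos]) auto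

lemma wint_cong:
  assumes "\<And>x. F (t, x) = G (t, x)"
  shows "wint F t = wint G t"
  unfolding wint_def by (simp add: assms)

lemma wint_D: "smooth_periodic F \<Longrightarrow> 0 < t \<Longrightarrow> wint (D F) t = 0"
  unfolding wint_def by (simp add: integral_deriv_x_periodic flip: deriv_x_eq)

lemma wint_by_parts:
  assumes "smooth_periodic F" "smooth_periodic G" "0 < t"
  shows "wint (\<lambda>p. F p * D G p) t = - wint (\<lambda>p. D F p * G p) t"
proof -
  have "wint (D (\<lambda>p. F p * G p)) t = wint (\<lambda>p. D F p * G p + F p * D G p) t"
    by (rule wint_cong) (rule D_mult[OF assms])
  then show ?thesis
    using assms by (simp add: wint_D wint_add smooth_periodic_mult smooth_periodic_D)
qed

lemma wint_cauchy_schwarz: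
  assumes "smooth_periodic F" "smooth_periodic G" "0 < t"
  shows "(wint (\<lambda>p. F p * G p) t)\<^sup>2 \<le> wint (\<lambda>p. (F p)\<^sup>2) t * wint (\<lambda>p. (G p)\<^sup>2) t"
  unfolding wint_def
  by (rule cauchy_schwarz_weighted)
    (use assms in \<open>auto intro!: smooth_continuous_on_slice smooth_periodic_smooth smooth_periodic_V less_imp_le[OF V_pos]\<close>)

text \<open>The second term arises because the arclength element \<open>V\<close> dx grows at the
  rate \<open>r\<close>.\<close>

lemma wint_deriv:
  assumes "smooth_periodic F" "0 < t"
  shows "(wint F has_real_derivative wint (\<lambda>p. deriv_t F p + r p * F p) t) (at t)"
proof -
  have "deriv_t (\<lambda>p. F p * V p) (t, x) = (deriv_t F (t, x) + r (t, x) * F (t, x)) * V (t, x)" for x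
    unfolding V_def using assms smooth_periodic_W deriv_t_W[OF assms(2)]
    by (simp add: deriv_t_mult smooth_periodic_exp deriv_t_exp algebra_simps)
  then show ?thesis
    using leibniz_half_plane[OF smooth_periodic_smooth[OF smooth_periodic_mult[OF assms(1) smooth_periodic_V]] assms(2), of 0 "2 * pi"]
    unfolding wint_def[abs_def] by simp
qed

text \<open>AM-GM in the form exp u_i >= 1 + u_i: as the u_i sum to zero, \<open>V\<close> is at
  most the mean of the A_i, each of which has integral 2 pi. The bound holds at all positive times
  with the same constant.\<close>

lemma length_le: "0 < t \<Longrightarrow> wint (\<lambda>p. 1) t \<le> 2 * pi"
proof -
  assume t: "0 < t"
  have "wint (\<lambda>p. 1) t \<le> integral {0..2 * pi} (\<lambda>x. (\<Sum>i\<in>UNIV. A i (t, x)) * (1 / 3))"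
    unfolding wint_def
  proof (rule integral_le)
    show "1 * V (t, x) \<le> (\<Sum>i\<in>UNIV. A i (t, x)) * (1 / 3)" for x
    proof -
      have "(\<Sum>i\<in>UNIV. (1 + u i (t, x)) * V (t, x)) \<le> (\<Sum>i\<in>UNIV. A i (t, x))"
        by (intro sum_mono) (simp add: A_eq t V_pos less_imp_le mult_right_mono)
      then show ?thesis
        using sum_U[OF t, of 0 x] by (simp add: U_0 sum.distrib flip: sum_distrib_right)
    qed
    show "(\<lambda>x. 1 * V (t, x)) integrable_on {0..2 * pi}"
      using integrable_slice[OF smooth_periodic_V t] by simp
    show "(\<lambda>x. (\<Sum>i\<in>UNIV. A i (t, x)) * (1 / 3)) integrable_on {0..2 * pi}"
      by (rule integrable_slice[OF _ t, of "\<lambda>p. (\<Sum>i\<in>UNIV. A i p) * (1 / 3)"])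
        (intro smooth_periodic_mult smooth_periodic_sum smooth_periodic_A smooth_periodic_const)
  qed
  also have "\<dots> = 2 * pi"
    by (simp add: integral_sum integrable_slice smooth_periodic_A t A_integral)
  finally show ?thesis .
qed

lemma periodic_representative:
  assumes "smooth_periodic F" "0 < t"
  shows "\<exists>y\<in>{0..2 * pi}. F (t, y) = F (t, x)"
proof -
  define n where "n = \<lfloor>x / (2 * pi)\<rfloor>"
  define y where "y = x - of_int n * (2 * pi)"
  have nat: "F (t, z + of_nat k * (2 * pi)) = F (t, z)" for k z
  proof (induction k)
    case (Suc k)
    have "z + of_nat (Suc k) * (2 * pi) = (z + of_nat k * (2 * pi)) + 2 * pi" by (simp add: algebra_simps)
    then show ?case using smooth_periodic_periodic[OF assms, of "z + of_nat k * (2 * pi)"] Suc by metis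
  qed simp
  have "F (t, y) = F (t, x)"
  proof (cases "0 \<le> n")
    case True
    then show ?thesis using nat[of y "nat n"] unfolding y_def by simp
  next
    case False
    then have "y = x + of_nat (nat (- n)) * (2 * pi)" unfolding y_def by simp
    then show ?thesis using nat[of x "nat (- n)"] by simp
  qed
  moreover have "of_int n \<le> x / (2 * pi)" "x / (2 * pi) < of_int n + 1"
    unfolding n_def by linarith+
  then have "y \<in> {0..2 * pi}" unfolding y_def by (simp add: field_simps)
  ultimately show ?thesis by blast
qed

text \<open>Starting from its zero, F changes by at most the arclength integral of |D F| over the
  circle; Cauchy-Schwarz against the constant 1 costs the length, which is at most 2 pi. No lower
  bound for \<open>V\<close> enters.\<close>

lemma sup_bound_of_zero:
  assumes "smooth_periodic F" "0 < t" "x0 \<in> {0..2 * pi}" "F (t, x0) = 0"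
  shows "(F (t, x))\<^sup>2 \<le> 2 * pi * wint (\<lambda>p. (D F p)\<^sup>2) t"
proof -
  obtain y where y: "y \<in> {0..2 * pi}" "F (t, y) = F (t, x)"
    using periodic_representative[OF assms(1,2)] by blast
  have cont: "continuous_on S (\<lambda>x. G (t, x))" if "smooth_periodic G" for G S
    using that by (intro smooth_continuous_on_slice smooth_periodic_smooth assms)
  define a b where "a = min x0 y" and "b = max x0 y"
  have ab: "a \<le> b" "{a..b} \<subseteq> {0..2 * pi}" using y(1) assms(3) unfolding a_def b_def by auto
  have int: "(\<lambda>z. \<bar>deriv_x F (t, z)\<bar>) integrable_on {c..d}" for c d
    by (intro integrable_continuous_real continuous_intros cont smooth_periodic_deriv_x assms)
  have "\<bar>F (t, x)\<bar> = \<bar>F (t, b) - F (t, a)\<bar>"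
    using assms(4) y(2) unfolding a_def b_def by (auto simp: min_def max_def)
  also have "\<dots> = \<bar>integral {a..b} (\<lambda>z. deriv_x F (t, z))\<bar>"
    using integral_deriv_x[OF smooth_periodic_smooth[OF assms(1)] assms(2) ab(1)] by simp
  also have "\<dots> \<le> integral {a..b} (\<lambda>z. \<bar>deriv_x F (t, z)\<bar>)"
    using integral_norm_bound_integral[OF integrable_slice[OF smooth_periodic_deriv_x[OF assms(1)] assms(2)] int] by simp
  also have "\<dots> \<le> integral {0..2 * pi} (\<lambda>z. \<bar>deriv_x F (t, z)\<bar>)"
    by (rule integral_subset_le[OF ab(2) int int]) simp
  also have "\<dots> = integral {0..2 * pi} (\<lambda>z. 1 * \<bar>D F (t, z)\<bar> * V (t, z))"
    by (simp add: deriv_x_eq abs_mult V_pos less_imp_le)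
  finally have "\<bar>F (t, x)\<bar>\<^sup>2 \<le> (integral {0..2 * pi} (\<lambda>z. 1 * \<bar>D F (t, z)\<bar> * V (t, z)))\<^sup>2"
    by (rule power_mono) simp
  also have "\<dots> \<le> integral {0..2 * pi} (\<lambda>z. 1\<^sup>2 * V (t, z)) *
      integral {0..2 * pi} (\<lambda>z. \<bar>D F (t, z)\<bar>\<^sup>2 * V (t, z))"
    by (rule cauchy_schwarz_weighted)
      (intro continuous_on_const continuous_on_rabs cont smooth_periodic_D smooth_periodic_V assms less_imp_le[OF V_pos])+
  also have "\<dots> = wint (\<lambda>p. 1) t * wint (\<lambda>p. (D F p)\<^sup>2) t"
    unfolding wint_def by simp
  also have "\<dots> \<le> 2 * pi * wint (\<lambda>p. (D F p)\<^sup>2) t"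
    by (intro mult_right_mono length_le wint_nonneg assms smooth_periodic_power smooth_periodic_D) simp
  finally show ?thesis by simp
qed

text \<open>Rolle's theorem on one period. It supplies the zero for \<open>sup_bound_of_zero\<close>
  at every order k >= 1.\<close>

lemma D_has_zero:
  assumes "smooth_periodic G" "0 < t"
  shows "\<exists>x0\<in>{0..2 * pi}. D G (t, x0) = 0"
proof -
  have d: "((\<lambda>y. G (t, y)) has_real_derivative deriv_x G (t, x)) (at x)" for x
    by (rule has_real_derivative_deriv_x[OF smooth_periodic_smooth[OF assms(1)] assms(2)])
  have "\<exists>z>0. z < 2 * pi \<and> ((\<lambda>y. G (t, y)) has_real_derivative 0) (at z)"
    by (rule Rolle) (use smooth_periodic_periodic[OF assms, of 0] d in
      \<open>auto intro!: smooth_continuous_on_slice smooth_periodic_smooth assms simp: real_differentiable_def\<close>)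
  then obtain z where z: "0 < z" "z < 2 * pi" "((\<lambda>y. G (t, y)) has_real_derivative 0) (at z)" by blast
  have "deriv_x G (t, z) = 0" using DERIV_unique[OF d z(3)] .
  then show ?thesis using z by (intro bexI[of _ z]) (simp_all add: D_def)
qed

section \<open>Energies and the inequalities between them\<close>

definition e :: "3 \<Rightarrow> nat \<Rightarrow> real \<Rightarrow> real"
  where "e i k t = wint (\<lambda>p. (U i k p)\<^sup>2) t"

definition E :: "nat \<Rightarrow> real \<Rightarrow> real"
  where "E k t = (\<Sum>i\<in>UNIV. e i k t)"

lemma e_nonneg: "0 < t \<Longrightarrow> 0 \<le> e i k t"
  unfolding e_def by (intro wint_nonneg smooth_periodic_power smooth_periodic_U) auto

lemma e_le_E: "0 < t \<Longrightarrow> e i k t \<le> E k t"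
  unfolding E_def by (rule member_le_sum) (auto simp: e_nonneg)

lemma E_nonneg: "0 < t \<Longrightarrow> 0 \<le> E k t"
  unfolding E_def by (intro sum_nonneg e_nonneg)

lemma U_bound:
  assumes "1 \<le> k" "0 < t"
  shows "(U i k (t, x))\<^sup>2 \<le> 2 * pi * e i (Suc k) t"
proof -
  obtain j where j: "k = Suc j" using assms(1) by (cases k) auto
  obtain x0 where "x0 \<in> {0..2 * pi}" "U i k (t, x0) = 0"
    using D_has_zero[OF smooth_periodic_U assms(2), of i j] unfolding j U_Suc by blast
  from sup_bound_of_zero[OF smooth_periodic_U assms(2) this, of x] show ?thesis
    unfolding e_def U_Suc .
qed

lemma U_bound_E:
  assumes "1 \<le> k" "0 < t"
  shows "(U i k (t, x))\<^sup>2 \<le> 2 * pi * E (Suc k) t"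
  by (rule order_trans[OF U_bound[OF assms]]) (simp add: e_le_E assms)

text \<open>Integrating the supremum bound over the circle costs the length a second time, whence
  the square of 2 pi.\<close>

lemma poincare:
  assumes "1 \<le> k" "0 < t"
  shows "E k t \<le> (2 * pi)\<^sup>2 * E (Suc k) t"
proof -
  have "e i k t \<le> (2 * pi)\<^sup>2 * e i (Suc k) t" for i
  proof -
    have "e i k t \<le> wint (\<lambda>p. (2 * pi * e i (Suc k) t) * 1) t"
      unfolding e_def[of i k]
      using U_bound[OF assms] by (intro wint_mono smooth_periodic_power smooth_periodic_U smooth_periodic_mult smooth_periodic_const assms) simp
    also have "\<dots> = 2 * pi * e i (Suc k) t * wint (\<lambda>p. 1) t"
      by (rule wint_cmult)
    also have "\<dots> \<le> 2 * pi * e i (Suc k) t * (2 * pi)"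
      by (intro mult_left_mono length_le assms mult_nonneg_nonneg e_nonneg) auto
    finally show ?thesis by (simp add: power2_eq_square algebra_simps)
  qed
  then show ?thesis unfolding E_def sum_distrib_left by (intro sum_mono)
qed

text \<open>Iterated Poincare inequality. It lets every factor of an error term be measured by the
  energy of one fixed order.\<close>

lemma E_mono:
  assumes "1 \<le> k" "k \<le> l"
  shows "\<exists>C\<ge>0. \<forall>t>0. E k t \<le> C * E l t"
  using assms(2)
proof (induction l rule: dec_induct)
  case base
  show ?case by (intro exI[of _ 1]) simp
next
  case (step l)
  then obtain C where C: "0 \<le> C" "\<And>t. 0 < t \<Longrightarrow> E k t \<le> C * E l t" by blast
  have "E k t \<le> (C * (2 * pi)\<^sup>2) * E (Suc l) t" if "0 < t" for t
  proof -
    have "1 \<le> l" using assms(1) step.hyps by simp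
    from mult_left_mono[OF poincare[OF this that] C(1)] show ?thesis
      using C(2)[OF that] by (simp add: mult.assoc)
  qed
  then show ?case using C(1) by (intro exI[of _ "C * (2 * pi)\<^sup>2"]) auto
qed

text \<open>Integration by parts replaces the square of U_(k+1) by - U_k U_(k+2), and Cauchy-Schwarz
  does the rest. The 3 comes from squaring a sum over three indices.\<close>

lemma interpolation:
  assumes "0 < t"
  shows "(E (Suc k) t)\<^sup>2 \<le> 3 * (E k t * E (k + 2) t)"
proof -
  have *: "(e i (Suc k) t)\<^sup>2 \<le> e i k t * e i (k + 2) t" for i
  proof -
    have "e i (Suc k) t = wint (\<lambda>p. U i (Suc k) p * D (U i k) p) t"
      unfolding e_def by (simp add: power2_eq_square U_Suc)
    also have "\<dots> = - wint (\<lambda>p. U i k p * U i (k + 2) p) t"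
      using wint_by_parts[OF smooth_periodic_U smooth_periodic_U assms, of i "Suc k" i k] by (simp add: U_Suc mult.commute)
    finally show ?thesis
      using wint_cauchy_schwarz[OF smooth_periodic_U smooth_periodic_U assms, of i k i "k + 2"] unfolding e_def by simp
  qed
  have "(E (Suc k) t)\<^sup>2 \<le> 3 * (\<Sum>i\<in>UNIV. (e i (Suc k) t)\<^sup>2)"
    unfolding E_def using sum_squared_le_sum_of_squares[of "\<lambda>i. e i (Suc k) t" "UNIV :: 3 set"]
    by simp
  also have "\<dots> \<le> 3 * (\<Sum>i\<in>UNIV. e i k t * E (k + 2) t)"
    by (intro mult_left_mono sum_mono order_trans[OF *] e_le_E e_nonneg assms) auto
  finally show ?thesis by (simp add: E_def[of k] sum_distrib_right)
qed

text \<open>In each generator all factors but one have order at most \<open>m\<close> and can be estimated in the supremum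
  norm by \<open>E (Suc m)\<close>.\<close>

inductive quad :: "nat \<Rightarrow> (real \<times> real \<Rightarrow> real) \<Rightarrow> bool" for m
  where
    quad2: "1 \<le> a \<Longrightarrow> a \<le> m \<Longrightarrow> 1 \<le> b \<Longrightarrow> b \<le> Suc m \<Longrightarrow> quad m (\<lambda>p. U i a p * U j b p)"
  | quad3: "1 \<le> a \<Longrightarrow> a \<le> m \<Longrightarrow> 1 \<le> b \<Longrightarrow> b \<le> m \<Longrightarrow> 1 \<le> c \<Longrightarrow> c \<le> m \<Longrightarrow>
      quad m (\<lambda>p. U i a p * (U j b p * U l c p))"
  | quad_add: "quad m F \<Longrightarrow> quad m G \<Longrightarrow> quad m (\<lambda>p. F p + G p)"
  | quad_cmult: "quad m F \<Longrightarrow> quad m (\<lambda>p. c * F p)"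
  | quad_cong: "quad m F \<Longrightarrow> (\<And>t x. 0 < t \<Longrightarrow> F (t, x) = G (t, x)) \<Longrightarrow> quad m G"

lemma quad_smooth_periodic: "quad m F \<Longrightarrow> smooth_periodic F"
proof (induction rule: quad.induct)
  case (quad_cong F G)
  show ?case by (rule smooth_periodic_cong[OF quad_cong.hyps(2) quad_cong.IH])
qed (auto intro!: smooth_periodic_mult smooth_periodic_U smooth_periodic_add smooth_periodic_const)

lemma quad_sum:
  fixes F :: "3 \<Rightarrow> real \<times> real \<Rightarrow> real"
  assumes "\<And>i. quad m (F i)"
  shows "quad m (\<lambda>p. \<Sum>i\<in>UNIV. F i p)"
  unfolding sum_3 by (intro quad_add assms)

lemma quad_diff: "quad m F \<Longrightarrow> quad m G \<Longrightarrow> quad m (\<lambda>p. F p - G p)"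
  using quad_add[OF _ quad_cmult[of m G "-1"]] by simp

text \<open>Each Leibniz term raises a single order by one, and the bounds for \<open>Suc m\<close>
  leave room for this: the exceptional factor may pass from m + 1 to m + 2, the others from m to m +
  1.\<close>

lemma quad_D: "quad m F \<Longrightarrow> quad (Suc m) (D F)"
proof (induction rule: quad.induct)
  case (quad2 a b i j)
  have "quad (Suc m) (\<lambda>p. U j b p * U i (Suc a) p + U i a p * U j (Suc b) p)"
    by (intro quad_add quad.quad2) (use quad2 in auto)
  then show ?case
    by (rule quad_cong) (simp add: D_mult smooth_periodic_U U_Suc)
next
  case (quad3 a b c i j l)
  have "quad (Suc m) (\<lambda>p. U i (Suc a) p * (U j b p * U l c p) +
      (U i a p * (U j (Suc b) p * U l c p) + U i a p * (U j b p * U l (Suc c) p)))"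
    by (intro quad_add quad.quad3) (use quad3 in auto)
  then show ?case
    by (rule quad_cong) (simp add: D_mult smooth_periodic_U smooth_periodic_mult U_Suc algebra_simps)
next
  case (quad_add F G)
  from quad.quad_add[OF quad_add.IH] show ?case
    by (rule quad_cong) (simp add: D_add quad_smooth_periodic[OF quad_add.hyps(1)] quad_smooth_periodic[OF quad_add.hyps(2)])
next
  case (quad_cmult F c)
  from quad.quad_cmult[OF quad_cmult.IH, of c] show ?case
    by (rule quad_cong) (simp add: D_mult D_const smooth_periodic_const quad_smooth_periodic[OF quad_cmult.hyps])
next
  case (quad_cong F G)
  from quad_cong.IH show ?case
    by (rule quad.quad_cong) (rule D_cong[of F G, OF quad_cong.hyps(2)])
qed

lemma quad_r_mult:
  assumes "1 \<le> c" "c \<le> m"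
  shows "quad m (\<lambda>p. r p * U l c p)"
proof -
  have "quad m (\<lambda>p. (1 / 3) * (\<Sum>i\<in>UNIV. U i 1 p * (U i 1 p * U l c p)))"
    by (intro quad_cmult quad_sum quad3) (use assms in auto)
  then show ?thesis
    by (rule quad_cong) (simp add: r_def power2_eq_square sum_distrib_right mult.assoc)
qed

lemma D_U_1: "D (U i (Suc 0)) = U i 2"
  by (simp add: U_def numeral_2_eq_2)

lemma D_square: "smooth_periodic F \<Longrightarrow> 0 < t \<Longrightarrow> D (\<lambda>p. (F p)\<^sup>2) (t, x) = 2 * (F (t, x) * D F (t, x))"
  unfolding power2_eq_square by (simp add: D_mult)

lemma D_r:
  assumes "0 < t"
  shows "D r (t, x) = (1 / 3) * (\<Sum>j\<in>UNIV. 2 * (U j 1 (t, x) * D (U j 1) (t, x)))"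
proof -
  have "D (\<lambda>p. (\<Sum>i\<in>UNIV. (U i 1 p)\<^sup>2) * (1 / 3)) (t, x) =
      D (\<lambda>p. \<Sum>i\<in>UNIV. (U i 1 p)\<^sup>2) (t, x) * (1 / 3)"
    by (subst D_mult) (auto intro!: smooth_periodic_sum smooth_periodic_power smooth_periodic_U smooth_periodic_const assms simp: D_const[OF assms])
  also have "D (\<lambda>p. \<Sum>i\<in>UNIV. (U i 1 p)\<^sup>2) (t, x) = (\<Sum>i\<in>UNIV. D (\<lambda>p. (U i 1 p)\<^sup>2) (t, x))"
    by (rule D_sum[OF _ assms]) (intro smooth_periodic_power smooth_periodic_U)
  finally show ?thesis unfolding r_def[abs_def] D_square[OF smooth_periodic_U assms] by simp
qed

text \<open>The induction starts at order 1: \<open>quad 0\<close> has no generators, whereas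
  \<open>D (X i 0)\<close> is a combination of products U_1 U_2. The energy belonging to
  \<open>X i 0\<close> is handled by exact cancellation in
  \<open>energy_inequality_1\<close>.\<close>

lemma quad_X: "quad (Suc k) (X i (Suc k))"
proof (induction k)
  case 0
  have "quad (Suc 0) (\<lambda>p. 2 * (U i 1 p * U i (Suc 1) p) - (1 / 3) * (\<Sum>j\<in>UNIV. 2 * (U j 1 p * U j (Suc 1) p)))"
    by (intro quad_diff quad_cmult quad_sum quad2) auto
  then have "quad (Suc 0) (D (X i 0))"
  proof (rule quad_cong)
    fix t x :: real assume t: "0 < t"
    show "2 * (U i 1 (t, x) * U i (Suc 1) (t, x)) - (1 / 3) * (\<Sum>j\<in>UNIV. 2 * (U j 1 (t, x) * U j (Suc 1) (t, x)))
        = D (X i 0) (t, x)"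
      by (simp add: D_diff smooth_periodic_power smooth_periodic_U smooth_periodic_r t D_square D_r D_U_1 flip: numeral_2_eq_2)
  qed
  then show ?case
    unfolding X.simps(2) by (intro quad_diff quad_r_mult) auto
next
  case (Suc k)
  then show ?case
    unfolding X.simps(2)[of i "Suc k"] by (intro quad_diff quad_r_mult quad_D) auto
qed

text \<open>With two factors, the supremum of one and the L2 norm of the other each contribute
  \<open>E (Suc m)\<close>. With three factors, two suprema already give its square, and the L2 norm
  of the third leaves \<open>E m\<close>; hence the factor 1 + \<open>E m\<close>. Being quadratic
  in \<open>E (Suc m)\<close> is what makes interpolation applicable.\<close>

lemma quad_bound:
  assumes "quad m F" "1 \<le> m"
  shows "\<exists>C\<ge>0. \<forall>t>0. wint (\<lambda>p. (F p)\<^sup>2) t \<le> C * (1 + E m t) * (E (Suc m) t)\<^sup>2"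
  using assms(1)
proof (induction rule: quad.induct)
  case (quad2 a b i j)
  obtain C1 where C1: "0 \<le> C1" "\<And>t. 0 < t \<Longrightarrow> E (Suc a) t \<le> C1 * E (Suc m) t"
    using E_mono[of "Suc a" "Suc m"] quad2 by auto
  obtain C2 where C2: "0 \<le> C2" "\<And>t. 0 < t \<Longrightarrow> E b t \<le> C2 * E (Suc m) t"
    using E_mono[of b "Suc m"] quad2 by auto
  show ?case
  proof (intro exI conjI allI impI)
    show "0 \<le> 2 * pi * C1 * C2" using C1 C2 by simp
    fix t :: real assume t: "0 < t"
    have "wint (\<lambda>p. (U i a p * U j b p)\<^sup>2) t \<le> wint (\<lambda>p. (2 * pi * E (Suc a) t) * (U j b p)\<^sup>2) t"
      by (intro wint_mono smooth_periodic_power smooth_periodic_mult smooth_periodic_U smooth_periodic_const t)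
        (simp add: power_mult_distrib mult_right_mono[OF U_bound_E[OF quad2(1) t]])
    also have "\<dots> = 2 * pi * E (Suc a) t * e j b t"
      unfolding wint_cmult e_def ..
    also have "\<dots> \<le> 2 * pi * (C1 * E (Suc m) t) * (C2 * E (Suc m) t)"
      by (intro mult_mono C1 order_trans[OF e_le_E C2(2)] mult_nonneg_nonneg e_nonneg E_nonneg t) (use C1 in auto)
    also have "\<dots> = 2 * pi * C1 * C2 * 1 * (E (Suc m) t)\<^sup>2"
      by (simp add: power2_eq_square)
    also have "\<dots> \<le> 2 * pi * C1 * C2 * (1 + E m t) * (E (Suc m) t)\<^sup>2"
      by (intro mult_right_mono mult_left_mono) (use C1 C2 E_nonneg[OF t] in auto)
    finally show "wint (\<lambda>p. (U i a p * U j b p)\<^sup>2) t \<le> 2 * pi * C1 * C2 * (1 + E m t) * (E (Suc m) t)\<^sup>2" .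
  qed
next
  case (quad3 a b c i j l)
  obtain C1 where C1: "0 \<le> C1" "\<And>t. 0 < t \<Longrightarrow> E (Suc a) t \<le> C1 * E (Suc m) t"
    using E_mono[of "Suc a" "Suc m"] quad3 by auto
  obtain C2 where C2: "0 \<le> C2" "\<And>t. 0 < t \<Longrightarrow> E (Suc b) t \<le> C2 * E (Suc m) t"
    using E_mono[of "Suc b" "Suc m"] quad3 by auto
  obtain C3 where C3: "0 \<le> C3" "\<And>t. 0 < t \<Longrightarrow> E c t \<le> C3 * E m t"
    using E_mono[of c m] quad3 by auto
  show ?case
  proof (intro exI conjI allI impI)
    let ?C = "2 * pi * C1 * (2 * pi * C2) * C3"
    show "0 \<le> ?C" using C1 C2 C3 by simp
    fix t :: real assume t: "0 < t"
    have "wint (\<lambda>p. (U i a p * (U j b p * U l c p))\<^sup>2) t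
        \<le> wint (\<lambda>p. (2 * pi * E (Suc a) t * (2 * pi * E (Suc b) t)) * (U l c p)\<^sup>2) t"
    proof (intro wint_mono smooth_periodic_power smooth_periodic_mult smooth_periodic_U smooth_periodic_const t)
      fix x
      have "(U i a (t, x))\<^sup>2 * (U j b (t, x))\<^sup>2 \<le> 2 * pi * E (Suc a) t * (2 * pi * E (Suc b) t)"
        by (intro mult_mono U_bound_E quad3 t mult_nonneg_nonneg E_nonneg[OF t]) auto
      from mult_right_mono[OF this, of "(U l c (t, x))\<^sup>2"]
      show "(U i a (t, x) * (U j b (t, x) * U l c (t, x)))\<^sup>2
          \<le> 2 * pi * E (Suc a) t * (2 * pi * E (Suc b) t) * (U l c (t, x))\<^sup>2"
        by (simp add: power_mult_distrib mult.assoc)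
    qed
    also have "\<dots> = 2 * pi * E (Suc a) t * (2 * pi * E (Suc b) t) * e l c t"
      unfolding wint_cmult e_def ..
    also have "\<dots> \<le> 2 * pi * (C1 * E (Suc m) t) * (2 * pi * (C2 * E (Suc m) t)) * (C3 * E m t)"
      by (intro mult_mono C1 C2 order_trans[OF e_le_E C3(2)] mult_nonneg_nonneg e_nonneg E_nonneg t)
        (use C1 C2 in auto)
    also have "\<dots> = ?C * E m t * (E (Suc m) t)\<^sup>2"
      by (simp add: power2_eq_square)
    also have "\<dots> \<le> ?C * (1 + E m t) * (E (Suc m) t)\<^sup>2"
      by (intro mult_right_mono mult_left_mono) (use C1 C2 C3 E_nonneg[OF t] in auto)
    finally show "wint (\<lambda>p. (U i a p * (U j b p * U l c p))\<^sup>2) t \<le> ?C * (1 + E m t) * (E (Suc m) t)\<^sup>2" .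
  qed
next
  case (quad_add F G)
  then obtain C1 C2 where C: "0 \<le> C1" "0 \<le> C2"
    "\<And>t. 0 < t \<Longrightarrow> wint (\<lambda>p. (F p)\<^sup>2) t \<le> C1 * (1 + E m t) * (E (Suc m) t)\<^sup>2"
    "\<And>t. 0 < t \<Longrightarrow> wint (\<lambda>p. (G p)\<^sup>2) t \<le> C2 * (1 + E m t) * (E (Suc m) t)\<^sup>2" by blast
  have smooth_periodic: "smooth_periodic F" "smooth_periodic G" using quad_add by (auto intro: quad_smooth_periodic)
  show ?case
  proof (intro exI conjI allI impI)
    show "0 \<le> 2 * (C1 + C2)" using C by simp
    fix t :: real assume t: "0 < t"
    have "wint (\<lambda>p. (F p + G p)\<^sup>2) t \<le> wint (\<lambda>p. 2 * ((F p)\<^sup>2 + (G p)\<^sup>2)) t"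
    proof (intro wint_mono smooth_periodic_power smooth_periodic_add smooth_periodic_mult smooth_periodic_const smooth_periodic t)
      show "(F (t, x) + G (t, x))\<^sup>2 \<le> 2 * ((F (t, x))\<^sup>2 + (G (t, x))\<^sup>2)" for x
        using sum_squares_bound[of "F (t, x)" "G (t, x)"] by (simp add: power2_sum)
    qed
    also have "\<dots> = 2 * (wint (\<lambda>p. (F p)\<^sup>2) t + wint (\<lambda>p. (G p)\<^sup>2) t)"
      unfolding wint_cmult by (simp add: wint_add smooth_periodic_power smooth_periodic t)
    also have "\<dots> \<le> 2 * (C1 + C2) * (1 + E m t) * (E (Suc m) t)\<^sup>2"
      using C(3,4)[OF t] by (simp add: algebra_simps)
    finally show "wint (\<lambda>p. (F p + G p)\<^sup>2) t \<le> 2 * (C1 + C2) * (1 + E m t) * (E (Suc m) t)\<^sup>2" .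
  qed
next
  case (quad_cmult F c)
  then obtain C where C: "0 \<le> C"
    "\<And>t. 0 < t \<Longrightarrow> wint (\<lambda>p. (F p)\<^sup>2) t \<le> C * (1 + E m t) * (E (Suc m) t)\<^sup>2" by blast
  show ?case
    by (intro exI[of _ "c\<^sup>2 * C"])
      (use C mult_left_mono[OF C(2), of _ "c\<^sup>2"] in \<open>auto simp: power_mult_distrib wint_cmult mult.assoc\<close>)
next
  case (quad_cong F G)
  have "wint (\<lambda>p. (G p)\<^sup>2) t = wint (\<lambda>p. (F p)\<^sup>2) t" if "0 < t" for t
    by (rule wint_cong) (simp add: quad_cong.hyps(2) that)
  then show ?case using quad_cong.IH by simp
qed

text \<open>The commutator contributes - 2 r U^2 and the growth of the arclength element + r U^2;
  what remains of the two has the favourable sign.\<close>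

lemma E_deriv:
  assumes "0 < t"
  shows "(E (Suc k) has_real_derivative
    (\<Sum>i\<in>UNIV. - 2 * wint (\<lambda>p. U i (k + 2) p * (U i (k + 2) p + X i k p)) t
      - wint (\<lambda>p. r p * (U i (Suc k) p)\<^sup>2) t)) (at t)"
  unfolding E_def[abs_def]
proof (rule DERIV_sum)
  fix i
  let ?Y = "\<lambda>p. U i (k + 2) p + X i k p" and ?U = "U i (Suc k)"
  have spY: "smooth_periodic ?Y" by (intro smooth_periodic_add smooth_periodic_U smooth_periodic_X)
  have "deriv_t (\<lambda>p. ?U p * ?U p) (t, x) + r (t, x) * (?U (t, x) * ?U (t, x)) =
      2 * (?U (t, x) * D ?Y (t, x)) + (-1) * (r (t, x) * (?U (t, x))\<^sup>2)" for x
    by (simp add: deriv_t_mult smooth_periodic_U assms deriv_t_U power2_eq_square algebra_simps)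
  then have "wint (\<lambda>p. deriv_t (\<lambda>p. ?U p * ?U p) p + r p * (?U p * ?U p)) t =
      wint (\<lambda>p. 2 * (?U p * D ?Y p) + (-1) * (r p * (?U p)\<^sup>2)) t"
    by (intro wint_cong)
  also have "\<dots> = 2 * wint (\<lambda>p. ?U p * D ?Y p) t - wint (\<lambda>p. r p * (?U p)\<^sup>2) t"
  proof -
    have "smooth_periodic (\<lambda>p. 2 * (?U p * D ?Y p))" "smooth_periodic (\<lambda>p. (-1) * (r p * (?U p)\<^sup>2))"
      by (intro smooth_periodic_mult smooth_periodic_const smooth_periodic_U smooth_periodic_D smooth_periodic_r smooth_periodic_power spY)+
    from wint_add[OF this assms] show ?thesis unfolding wint_cmult by simp
  qed
  also have "wint (\<lambda>p. ?U p * D ?Y p) t = - wint (\<lambda>p. U i (k + 2) p * ?Y p) t"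
    using wint_by_parts[OF smooth_periodic_U spY assms, of i "Suc k"] by (simp flip: U_Suc)
  finally show "(e i (Suc k) has_real_derivative
      - 2 * wint (\<lambda>p. U i (k + 2) p * ?Y p) t - wint (\<lambda>p. r p * (?U p)\<^sup>2) t) (at t)"
    using wint_deriv[OF smooth_periodic_mult[OF smooth_periodic_U smooth_periodic_U] assms, of i "Suc k" i "Suc k"]
    unfolding e_def[abs_def] power2_eq_square by simp
qed

lemma r_nonneg: "0 \<le> r p"
  unfolding r_def by (simp add: sum_nonneg)

lemma wint_r_nonneg: "0 < t \<Longrightarrow> 0 \<le> wint (\<lambda>p. r p * (U i k p)\<^sup>2) t"
  by (intro wint_nonneg smooth_periodic_mult smooth_periodic_r smooth_periodic_power smooth_periodic_U mult_nonneg_nonneg r_nonneg) auto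

text \<open>Pointwise - 2 a (a + b) = - a^2 + b^2 - (a + b)^2, with a the derivative of order k + 2
  and b the error \<open>X i k\<close>. Half of the dissipation pays for reducing the error to its
  square.\<close>

lemma energy_inequality:
  assumes "0 < t"
  shows "\<exists>d. (E (Suc k) has_real_derivative d) (at t) \<and>
    d \<le> - E (k + 2) t + (\<Sum>i\<in>UNIV. wint (\<lambda>p. (X i k p)\<^sup>2) t)"
proof (intro exI conjI, rule E_deriv[OF assms])
  have "- 2 * wint (\<lambda>p. U i (k + 2) p * (U i (k + 2) p + X i k p)) t
      - wint (\<lambda>p. r p * (U i (Suc k) p)\<^sup>2) t \<le> - e i (k + 2) t + wint (\<lambda>p. (X i k p)\<^sup>2) t" for i
  proof -
    have "wint (\<lambda>p. - 2 * (U i (k + 2) p * (U i (k + 2) p + X i k p))) t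
        \<le> wint (\<lambda>p. (-1) * (U i (k + 2) p)\<^sup>2 + (X i k p)\<^sup>2) t"
    proof (intro wint_mono smooth_periodic_add smooth_periodic_mult smooth_periodic_const smooth_periodic_power smooth_periodic_U smooth_periodic_X assms)
      fix x
      show "- 2 * (U i (k + 2) (t, x) * (U i (k + 2) (t, x) + X i k (t, x)))
          \<le> (-1) * (U i (k + 2) (t, x))\<^sup>2 + (X i k (t, x))\<^sup>2"
        using zero_le_power2[of "U i (k + 2) (t, x) + X i k (t, x)"]
        by (simp add: power2_eq_square algebra_simps)
    qed
    also have "\<dots> = - e i (k + 2) t + wint (\<lambda>p. (X i k p)\<^sup>2) t"
    proof -
      have "smooth_periodic (\<lambda>p. (-1) * (U i (k + 2) p)\<^sup>2)" "smooth_periodic (\<lambda>p. (X i k p)\<^sup>2)"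
        by (intro smooth_periodic_mult smooth_periodic_const smooth_periodic_U smooth_periodic_X smooth_periodic_power)+
      from wint_add[OF this assms] show ?thesis unfolding wint_cmult e_def by simp
    qed
    finally show ?thesis
      using wint_r_nonneg[OF assms, of i "Suc k"] unfolding wint_cmult by linarith
  qed
  then have "(\<Sum>i\<in>UNIV. - 2 * wint (\<lambda>p. U i (k + 2) p * (U i (k + 2) p + X i k p)) t
      - wint (\<lambda>p. r p * (U i (Suc k) p)\<^sup>2) t) \<le> (\<Sum>i\<in>UNIV. - e i (k + 2) t + wint (\<lambda>p. (X i k p)\<^sup>2) t)"
    by (intro sum_mono)
  also have "\<dots> = - E (k + 2) t + (\<Sum>i\<in>UNIV. wint (\<lambda>p. (X i k p)\<^sup>2) t)"
    by (simp only: E_def sum.distrib sum_negf)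
  finally show "(\<Sum>i\<in>UNIV. - 2 * wint (\<lambda>p. U i (k + 2) p * (U i (k + 2) p + X i k p)) t
      - wint (\<lambda>p. r p * (U i (Suc k) p)\<^sup>2) t) \<le> \<dots>" .
qed

text \<open>At the lowest order the cubic terms integrate to zero: \<open>r\<close> drops out because the \<open>u\<^sub>i\<close> sum to
  zero, and the rest is an exact derivative.\<close>

lemma energy_inequality_1:
  assumes "0 < t"
  shows "\<exists>d. (E 1 has_real_derivative d) (at t) \<and> d \<le> - 2 * E 2 t"
proof -
  have cubic: "wint (\<lambda>p. U i 2 p * (U i 1 p)\<^sup>2) t = 0" for i
  proof -
    have "D (\<lambda>p. U i 1 p * (U i 1 p * U i 1 p)) (t, x) = 3 * (U i 2 (t, x) * (U i 1 (t, x))\<^sup>2)" for x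
      unfolding D_mult[OF smooth_periodic_U smooth_periodic_mult[OF smooth_periodic_U smooth_periodic_U] assms] D_mult[OF smooth_periodic_U smooth_periodic_U assms]
      by (simp add: power2_eq_square D_U_1)
    then have "wint (D (\<lambda>p. U i 1 p * (U i 1 p * U i 1 p))) t = wint (\<lambda>p. 3 * (U i 2 p * (U i 1 p)\<^sup>2)) t"
      by (intro wint_cong)
    then show ?thesis
      unfolding wint_cmult by (simp add: wint_D smooth_periodic_mult smooth_periodic_U assms)
  qed
  have split: "wint (\<lambda>p. U i 2 p * (U i 2 p + X i 0 p)) t = e i 2 t - wint (\<lambda>p. U i 2 p * r p) t" for i
  proof -
    have "wint (\<lambda>p. U i 2 p * (U i 2 p + X i 0 p)) t =
        wint (\<lambda>p. (U i 2 p)\<^sup>2 + (U i 2 p * (U i 1 p)\<^sup>2 + (-1) * (U i 2 p * r p))) t"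
      by (rule wint_cong) (simp add: power2_eq_square algebra_simps)
    also have "\<dots> = e i 2 t + (wint (\<lambda>p. U i 2 p * (U i 1 p)\<^sup>2) t + wint (\<lambda>p. (-1) * (U i 2 p * r p)) t)"
      by (simp only: wint_add smooth_periodic_power smooth_periodic_U smooth_periodic_add smooth_periodic_mult smooth_periodic_const smooth_periodic_r assms e_def)
    finally show ?thesis unfolding wint_cmult cubic by simp
  qed
  have "(\<Sum>i\<in>UNIV. wint (\<lambda>p. U i 2 p * r p) t) = wint (\<lambda>p. \<Sum>i\<in>UNIV. U i 2 p * r p) t"
    by (simp add: wint_sum smooth_periodic_mult smooth_periodic_U smooth_periodic_r assms)
  also have "\<dots> = wint (\<lambda>p. 0) t"
    by (rule wint_cong) (simp add: sum_U assms flip: sum_distrib_right)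
  finally have zero: "(\<Sum>i\<in>UNIV. wint (\<lambda>p. U i 2 p * r p) t) = 0"
    by (simp add: wint_def)
  show ?thesis
  proof (intro exI conjI)
    show "(E 1 has_real_derivative
      (\<Sum>i\<in>UNIV. - 2 * wint (\<lambda>p. U i (0 + 2) p * (U i (0 + 2) p + X i 0 p)) t
        - wint (\<lambda>p. r p * (U i (Suc 0) p)\<^sup>2) t)) (at t)"
      using E_deriv[OF assms, of 0] by simp
    have "(\<Sum>i\<in>UNIV. - 2 * wint (\<lambda>p. U i (0 + 2) p * (U i (0 + 2) p + X i 0 p)) t
        - wint (\<lambda>p. r p * (U i (Suc 0) p)\<^sup>2) t) \<le> (\<Sum>i\<in>UNIV. - 2 * e i 2 t + 2 * wint (\<lambda>p. U i 2 p * r p) t)"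
    proof (rule sum_mono)
      fix i :: 3
      show "- 2 * wint (\<lambda>p. U i (0 + 2) p * (U i (0 + 2) p + X i 0 p)) t
        - wint (\<lambda>p. r p * (U i (Suc 0) p)\<^sup>2) t \<le> - 2 * e i 2 t + 2 * wint (\<lambda>p. U i 2 p * r p) t"
        using wint_r_nonneg[OF assms, of i "Suc 0"] split[of i] unfolding add_0 by linarith
    qed
    also have "\<dots> = - 2 * E 2 t"
      using zero by (simp add: E_def sum_subtractf flip: sum_distrib_left)
    finally show "(\<Sum>i\<in>UNIV. - 2 * wint (\<lambda>p. U i (0 + 2) p * (U i (0 + 2) p + X i 0 p)) t
        - wint (\<lambda>p. r p * (U i (Suc 0) p)\<^sup>2) t) \<le> - 2 * E 2 t" .
  qed
qed

lemma E_tendsto: "(E (Suc k) \<longlongrightarrow> 0) at_top"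
proof (induction k)
  case 0
  show ?case
  \<comment> \<open>The rate combines the dissipation 2 E_2 with the Poincare constant.\<close>
  proof (rule tendsto_zero_of_decay[of "2 / (2 * pi)\<^sup>2"])
    show "eventually (\<lambda>t. \<exists>d. (E (Suc 0) has_real_derivative d) (at t) \<and> d \<le> - (2 / (2 * pi)\<^sup>2) * E (Suc 0) t) at_top"
      using eventually_gt_at_top[of 0]
    proof eventually_elim
      case (elim t)
      have "E 1 t \<le> (2 * pi)\<^sup>2 * E 2 t" using poincare[of 1 t] elim by (simp add: numeral_2_eq_2)
      then have "- 2 * E 2 t \<le> - (2 / (2 * pi)\<^sup>2) * E 1 t" by (simp add: field_simps)
      then show ?case using energy_inequality_1[OF elim] by fastforce
    qed
  qed (auto simp: E_nonneg)
next
  case (Suc k)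
  have "\<exists>C\<ge>0. \<forall>t>0. wint (\<lambda>p. (X i (Suc k) p)\<^sup>2) t \<le> C * (1 + E (Suc k) t) * (E (Suc (Suc k)) t)\<^sup>2" for i
    by (rule quad_bound[OF quad_X]) simp
  then obtain C where C: "\<And>i. 0 \<le> C i"
    "\<And>i t. 0 < t \<Longrightarrow> wint (\<lambda>p. (X i (Suc k) p)\<^sup>2) t \<le> C i * (1 + E (Suc k) t) * (E (Suc (Suc k)) t)\<^sup>2"
    by metis
  define c where "c = (\<Sum>i\<in>UNIV. C i)"
  have c0: "0 \<le> c" unfolding c_def by (intro sum_nonneg C)
  have "((\<lambda>t. 3 * c * (1 + E (Suc k) t) * E (Suc k) t) \<longlongrightarrow> 3 * c * (1 + 0) * 0) at_top"
    by (intro tendsto_intros Suc.IH)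
  \<comment> \<open>The factor 3 anticipates the interpolation inequality. The threshold 1/2 keeps
    half of the dissipation \<open>E (Suc k + 2)\<close>, which Poincare's inequality turns into the
    rate used below.\<close>
  then have small: "eventually (\<lambda>t. 3 * c * (1 + E (Suc k) t) * E (Suc k) t < 1 / 2) at_top"
    by (rule order_tendstoD) simp
  show ?case
  proof (rule tendsto_zero_of_decay[of "1 / (2 * (2 * pi)\<^sup>2)"])
    show "eventually (\<lambda>t. \<exists>d. (E (Suc (Suc k)) has_real_derivative d) (at t) \<and>
        d \<le> - (1 / (2 * (2 * pi)\<^sup>2)) * E (Suc (Suc k)) t) at_top"
      using eventually_gt_at_top[of 0] small
    proof eventually_elim
      case (elim t)
      let ?E1 = "E (Suc k) t" and ?E2 = "E (Suc (Suc k)) t" and ?E3 = "E (Suc k + 2) t"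
      have "(\<Sum>i\<in>UNIV. wint (\<lambda>p. (X i (Suc k) p)\<^sup>2) t) \<le> (\<Sum>i\<in>UNIV. C i * (1 + ?E1) * ?E2\<^sup>2)"
        by (intro sum_mono C elim)
      also have "\<dots> = c * (1 + ?E1) * ?E2\<^sup>2"
        by (simp add: c_def sum_distrib_right)
      also have "\<dots> \<le> c * (1 + ?E1) * (3 * (?E1 * ?E3))"
        using interpolation[OF elim(1), of "Suc k"]
        by (intro mult_left_mono mult_nonneg_nonneg) (use c0 E_nonneg[OF elim(1)] in auto)
      also have "\<dots> = 3 * c * (1 + ?E1) * ?E1 * ?E3" by simp
      also have "\<dots> \<le> 1 / 2 * ?E3"
        using elim(2) by (intro mult_right_mono E_nonneg elim) simp
      finally have X: "(\<Sum>i\<in>UNIV. wint (\<lambda>p. (X i (Suc k) p)\<^sup>2) t) \<le> 1 / 2 * ?E3" .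
      have "?E2 \<le> (2 * pi)\<^sup>2 * ?E3"
        using poincare[of "Suc (Suc k)" t] elim(1) by simp
      then have "- (1 / 2) * ?E3 \<le> - (1 / (2 * (2 * pi)\<^sup>2)) * ?E2" by (simp add: field_simps)
      then show ?case using energy_inequality[OF elim(1), of "Suc k"] X by fastforce
    qed
  qed (auto simp: E_nonneg)
qed

end

section \<open>Uniform convergence and reparametrization of the circle\<close>

lemma continuous_antiderivative:
  fixes g :: "real \<Rightarrow> real"
  assumes "continuous_on UNIV g"
  shows "\<exists>G. G 0 = 0 \<and> (\<forall>x. (G has_real_derivative g x) (at x))"
proof -
  \<comment> \<open>For either sign of x one of the two integrals is over an empty or degenerate
    interval and vanishes.\<close>
  define G where "G x = integral {0..x} g - integral {x..0} g" for x
  have int: "g integrable_on {a..b}" for a b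
    by (intro integrable_continuous_real continuous_on_subset[OF assms]) simp
  have G: "G y = integral {- N..y} g - integral {- N..0} g" if "- N < y" "0 < N" for y N
  proof (cases "0 \<le> y")
    case True
    have "integral {- N..0} g + integral {0..y} g = integral {- N..y} g"
      by (rule Henstock_Kurzweil_Integration.integral_combine[OF _ _ int]) (use that True in auto)
    then show ?thesis using True unfolding G_def by (cases "y = 0") auto
  next
    case False
    have "integral {- N..y} g + integral {y..0} g = integral {- N..0} g"
      by (rule Henstock_Kurzweil_Integration.integral_combine[OF _ _ int]) (use that False in auto)
    then show ?thesis using False unfolding G_def by simp
  qed
  have "(G has_real_derivative g x) (at x)" for x
  proof -
    \<comment> \<open>Near \<open>x\<close> the function \<open>G\<close> is, up to a constant, the
      integral from \<open>- N\<close>, an endpoint to the left of both 0 and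
      \<open>x\<close>.\<close>
    define N where "N = \<bar>x\<bar> + 1"
    have N: "- N < x" "x < N" "0 < N" unfolding N_def by auto
    have "((\<lambda>y. integral {- N..y} g) has_real_derivative g x) (at x within {- N..N})"
      by (rule integral_has_real_derivative[OF continuous_on_subset[OF assms]]) (use N in auto)
    then have "((\<lambda>y. integral {- N..y} g) has_real_derivative g x) (at x)"
      using N by (simp add: at_within_interior[of x "{- N..N}"])
    from DERIV_diff[OF this DERIV_const[of "integral {- N..0} g"]]
    have "((\<lambda>y. integral {- N..y} g - integral {- N..0} g) has_real_derivative g x) (at x)" by simp
    then show ?thesis
      by (rule has_field_derivative_transform_within_open[where S = "{- N<..}"]) (use N G in auto)
  qed
  moreover have "G 0 = 0" unfolding G_def by simp
  ultimately show ?thesis by blast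
qed

text \<open>Rolle's theorem for an antiderivative, which takes equal values at the two ends.\<close>

lemma continuous_zero_of_integral_zero:
  fixes g :: "real \<Rightarrow> real"
  assumes "continuous_on UNIV g" "a < b" "integral {a..b} g = 0"
  shows "\<exists>x\<in>{a..b}. g x = 0"
proof -
  obtain G where G: "\<And>x. (G has_real_derivative g x) (at x)"
    using continuous_antiderivative[OF assms(1)] by blast
  have "(g has_integral G b - G a) {a..b}"
    by (rule fundamental_theorem_of_calculus)
      (use assms(2) has_field_derivative_at_within[OF G] in \<open>auto simp flip: has_real_derivative_iff_has_vector_derivative\<close>)
  then have eq: "G a = G b" using assms(3) by (simp add: integral_unique)
  have "\<exists>z>a. z < b \<and> (G has_real_derivative 0) (at z)"
    by (rule Rolle[OF assms(2) eq])
      (use G in \<open>auto intro!: continuous_at_imp_continuous_on DERIV_isCont simp: real_differentiable_def\<close>)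
  then obtain z where z: "a < z" "z < b" "(G has_real_derivative 0) (at z)" by blast
  then show ?thesis using DERIV_unique[OF G z(3)] by (intro bexI[of _ z]) auto
qed

text \<open>\<open>S\<close> is the antiderivative of \<open>g\<close> with S 0 = 0. It increases
  strictly, and since the total integral is exactly 2 pi it commutes with the shift by 2 pi; so
  \<open>S\<close> and its inverse \<open>h\<close> are lifts of circle maps.\<close>

lemma circle_reparametrization:
  fixes g :: "real \<Rightarrow> real"
  assumes cont: "continuous_on UNIV g" and pos: "\<And>x. 0 < g x"
    and per: "\<And>x. g (x + 2 * pi) = g x" and int: "integral {0..2 * pi} g = 2 * pi"
  shows "\<exists>S h. (\<forall>x. (S has_real_derivative g x) (at x)) \<and>
    (\<forall>y. (h has_real_derivative 1 / g (h y)) (at y)) \<and>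
    (\<forall>x. h (S x) = x) \<and> (\<forall>y. S (h y) = y) \<and>
    (\<forall>x. S (x + 2 * pi) = S x + 2 * pi) \<and> (\<forall>y. h (y + 2 * pi) = h y + 2 * pi)"
proof -
  obtain S where S: "S 0 = 0" "\<And>x. (S has_real_derivative g x) (at x)"
    using continuous_antiderivative[OF cont] by blast
  have "(g has_integral S (2 * pi) - S 0) {0..2 * pi}"
    by (rule fundamental_theorem_of_calculus)
      (use has_field_derivative_at_within[OF S(2)] in \<open>auto simp flip: has_real_derivative_iff_has_vector_derivative\<close>)
  then have S2pi: "S (2 * pi) = 2 * pi" using int S(1) by (simp add: integral_unique)
  have shift: "S (x + 2 * pi) = S x + 2 * pi" for x
  proof -
    have "((\<lambda>x. S (x + 2 * pi) - S x) has_real_derivative 0) (at x)" for x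
    proof -
      have "((\<lambda>x. S (x + 2 * pi)) has_real_derivative g (x + 2 * pi)) (at x)"
        using S(2)[of "x + 2 * pi"] by (simp add: DERIV_shift)
      from DERIV_diff[OF this S(2)] show ?thesis by (simp add: per)
    qed
    from DERIV_isconst_all[of "\<lambda>x. S (x + 2 * pi) - S x" x 0] this show ?thesis
      by (simp add: S(1) S2pi)
  qed
  have shift_nat: "S (x + of_nat n * (2 * pi)) = S x + of_nat n * (2 * pi)" for x n
  proof (induction n)
    case (Suc n)
    have "S (x + of_nat (Suc n) * (2 * pi)) = S ((x + of_nat n * (2 * pi)) + 2 * pi)"
      by (simp add: algebra_simps)
    also have "\<dots> = S x + of_nat (Suc n) * (2 * pi)"
      unfolding shift Suc by (simp add: algebra_simps)
    finally show ?case .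
  qed simp
  have mono: "S x < S y" if "x < y" for x y
    by (rule DERIV_pos_imp_increasing[OF that]) (use S(2) pos in blast)
  have contS: "continuous_on X S" for X
    using S(2) by (auto intro!: continuous_at_imp_continuous_on DERIV_isCont)
  have "\<exists>x. S x = y" for y
  proof -
    obtain n :: nat where n: "\<bar>y\<bar> / (2 * pi) \<le> of_nat n" using real_arch_simple by blast
    then have y: "\<bar>y\<bar> \<le> of_nat n * (2 * pi)" by (simp add: field_simps)
    \<comment> \<open>\<open>S\<close> fixes the integer multiples of 2 pi, which makes it unbounded
      in both directions; surjectivity then follows from the intermediate value theorem.\<close>
    have "S (of_nat n * (2 * pi)) = of_nat n * (2 * pi)" "S (- (of_nat n * (2 * pi))) = - (of_nat n * (2 * pi))"
      using shift_nat[of 0 n] shift_nat[of "- (of_nat n * (2 * pi))" n] S(1) by auto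
    then have "S (- (of_nat n * (2 * pi))) \<le> y" "y \<le> S (of_nat n * (2 * pi))"
      using y by auto
    then show ?thesis
      using IVT'[OF _ _ _ contS, of "- (of_nat n * (2 * pi))" y "of_nat n * (2 * pi)"] by auto
  qed
  then obtain h where Sh: "\<And>y. S (h y) = y" by metis
  have inj: "x = y" if "S x = S y" for x y
    using mono[of x y] mono[of y x] that by (cases x y rule: linorder_cases) auto
  have hS: "h (S x) = x" for x by (rule inj) (simp add: Sh)
  have h_shift: "h (y + 2 * pi) = h y + 2 * pi" for y
    by (rule inj) (simp add: Sh shift)
  have "isCont h (S x)" for x
    by (rule isCont_inverse_function[where d = 1 and f = S and g = h])
      (use hS DERIV_isCont[OF S(2)] in auto)
  then have conth: "isCont h y" for y using Sh by metis
  have "(h has_real_derivative inverse (g (h y))) (at y)" for y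
    by (rule DERIV_inverse_function[where f = S and a = "y - 1" and b = "y + 1"])
      (use S(2) pos[of "h y"] Sh conth in auto)
  then have "(h has_real_derivative 1 / g (h y)) (at y)" for y
    by (simp add: inverse_eq_divide)
  then show ?thesis using S(2) hS Sh shift h_shift by (intro exI[of _ S] exI[of _ h]) auto
qed

section \<open>Uniform decay as time tends to infinity\<close>

definition vanishing :: "(real \<times> real \<Rightarrow> real) \<Rightarrow> bool"
  where "vanishing F \<longleftrightarrow> uniform_limit UNIV (\<lambda>t x. F (t, x)) (\<lambda>x. 0) at_top"

lemma vanishing_iff:
  "vanishing F \<longleftrightarrow> (\<forall>\<epsilon>>0. eventually (\<lambda>t. \<forall>x. \<bar>F (t, x)\<bar> < \<epsilon>) at_top)"
  unfolding vanishing_def uniform_limit_iff by simp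

lemma vanishing_add: "vanishing F \<Longrightarrow> vanishing G \<Longrightarrow> vanishing (\<lambda>p. F p + G p)"
  unfolding vanishing_def by (drule (1) uniform_limit_add) simp

lemma vanishing_mult:
  assumes "vanishing F" "vanishing G"
  shows "vanishing (\<lambda>p. F p * G p)"
  unfolding vanishing_iff
proof (intro allI impI)
  fix \<epsilon> :: real assume "0 < \<epsilon>"
  then have "eventually (\<lambda>t. \<forall>x. \<bar>G (t, x)\<bar> < \<epsilon>) at_top" "eventually (\<lambda>t. \<forall>x. \<bar>F (t, x)\<bar> < 1) at_top"
    using assms unfolding vanishing_iff by auto
  then show "eventually (\<lambda>t. \<forall>x. \<bar>F (t, x) * G (t, x)\<bar> < \<epsilon>) at_top"
  proof eventually_elim
    case (elim t)
    show ?case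
    proof
      fix x
      have "\<bar>F (t, x)\<bar> * \<bar>G (t, x)\<bar> \<le> 1 * \<bar>G (t, x)\<bar>"
        by (rule mult_right_mono) (use elim(2) in \<open>auto simp: less_imp_le\<close>)
      then show "\<bar>F (t, x) * G (t, x)\<bar> < \<epsilon>"
        using elim(1) by (simp add: abs_mult le_less_trans)
    qed
  qed
qed

lemma vanishing_cmult:
  assumes "vanishing F"
  shows "vanishing (\<lambda>p. c * F p)"
  unfolding vanishing_iff
proof (intro allI impI)
  fix \<epsilon> :: real assume \<epsilon>: "0 < \<epsilon>"
  then have "eventually (\<lambda>t. \<forall>x. \<bar>F (t, x)\<bar> < \<epsilon> / (\<bar>c\<bar> + 1)) at_top"
    using assms unfolding vanishing_iff by simp
  then show "eventually (\<lambda>t. \<forall>x. \<bar>c * F (t, x)\<bar> < \<epsilon>) at_top"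
  proof eventually_elim
    case (elim t)
    show ?case
    proof
      fix x
      have "\<bar>c\<bar> * \<bar>F (t, x)\<bar> \<le> (\<bar>c\<bar> + 1) * \<bar>F (t, x)\<bar>" by (rule mult_right_mono) auto
      also have "\<dots> < \<epsilon>" using elim by (simp add: field_simps)
      finally show "\<bar>c * F (t, x)\<bar> < \<epsilon>" by (simp add: abs_mult)
    qed
  qed
qed

lemma vanishing_sum: "(\<And>i. i \<in> I \<Longrightarrow> vanishing (F i)) \<Longrightarrow> vanishing (\<lambda>p. \<Sum>i\<in>I. F i p)"
  by (induction I rule: infinite_finite_induct) (auto simp: vanishing_add vanishing_iff[of "\<lambda>p. 0"])

lemma vanishing_cong:
  assumes "\<And>t x. 0 < t \<Longrightarrow> F (t, x) = G (t, x)" "vanishing F"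
  shows "vanishing G"
  unfolding vanishing_iff
proof (intro allI impI)
  fix \<epsilon> :: real assume "0 < \<epsilon>"
  then have "eventually (\<lambda>t. \<forall>x. \<bar>F (t, x)\<bar> < \<epsilon>) at_top" using assms(2) unfolding vanishing_iff by blast
  then show "eventually (\<lambda>t. \<forall>x. \<bar>G (t, x)\<bar> < \<epsilon>) at_top"
    using eventually_gt_at_top[of 0] by eventually_elim (simp add: assms(1))
qed

lemma vanishing_of_square_bound:
  assumes "(b \<longlongrightarrow> 0) at_top" "\<And>t x. 0 < t \<Longrightarrow> (F (t, x))\<^sup>2 \<le> b t"
  shows "vanishing F"
  unfolding vanishing_iff
proof (intro allI impI)
  fix \<epsilon> :: real assume \<epsilon>: "0 < \<epsilon>"
  have "eventually (\<lambda>t. b t < \<epsilon>\<^sup>2) at_top"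
    by (rule order_tendstoD[OF assms(1)]) (use \<epsilon> in simp)
  then show "eventually (\<lambda>t. \<forall>x. \<bar>F (t, x)\<bar> < \<epsilon>) at_top"
    using eventually_gt_at_top[of 0]
  proof eventually_elim
    case (elim t)
    have "\<bar>F (t, x)\<bar>\<^sup>2 < \<epsilon>\<^sup>2" for x using elim assms(2)[of t x] by simp
    then show ?case using \<epsilon> by (blast intro: power2_less_imp_less less_imp_le)
  qed
qed

context simple_flow
begin

lemma vanishing_U: "vanishing (U i (Suc k))"
proof (rule vanishing_of_square_bound)
  show "((\<lambda>t. 2 * pi * E (Suc (Suc k)) t) \<longlongrightarrow> 0) at_top"
    by (rule tendsto_mult_right_zero[OF E_tendsto])
  show "(U i (Suc k) (t, x))\<^sup>2 \<le> 2 * pi * E (Suc (Suc k)) t" if "0 < t" for t x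
    by (rule U_bound_E) (use that in auto)
qed

text \<open>Since all \<open>A\<^sub>i\<close> have the same integral, any two of the \<open>u\<^sub>i\<close> agree somewhere.\<close>

lemma vanishing_u_diff: "vanishing (\<lambda>p. u i p - u j p)"
proof (rule vanishing_of_square_bound)
  show "((\<lambda>t. 8 * pi * E (Suc 0) t) \<longlongrightarrow> 0) at_top"
    by (rule tendsto_mult_right_zero[OF E_tendsto])
  fix t x :: real assume t: "0 < t"
  let ?F = "\<lambda>p. u i p - u j p"
  have spF: "smooth_periodic ?F" by (intro smooth_periodic_diff smooth_periodic_u)
  have "continuous_on UNIV (\<lambda>x. A i (t, x) - A j (t, x))"
    by (intro continuous_intros smooth_continuous_on_slice smooth_periodic_smooth smooth_periodic_A t)
  moreover have "integral {0..2 * pi} (\<lambda>x. A i (t, x) - A j (t, x)) = 0"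
    by (simp add: integral_diff integrable_slice smooth_periodic_A t A_integral)
  ultimately obtain x0 where x0: "x0 \<in> {0..2 * pi}" "A i (t, x0) - A j (t, x0) = 0"
    using continuous_zero_of_integral_zero[of "\<lambda>x. A i (t, x) - A j (t, x)" 0 "2 * pi"] by auto
  have "(?F (t, x))\<^sup>2 \<le> 2 * pi * wint (\<lambda>p. (D ?F p)\<^sup>2) t"
    by (rule sup_bound_of_zero[OF spF t x0(1)]) (use x0(2) in \<open>simp add: logratio_def\<close>)
  also have "wint (\<lambda>p. (D ?F p)\<^sup>2) t \<le> wint (\<lambda>p. 2 * ((U i 1 p)\<^sup>2 + (U j 1 p)\<^sup>2)) t"
  proof (intro wint_mono smooth_periodic_power smooth_periodic_D spF smooth_periodic_mult smooth_periodic_const smooth_periodic_add smooth_periodic_U t)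
    fix x
    show "(D ?F (t, x))\<^sup>2 \<le> 2 * ((U i 1 (t, x))\<^sup>2 + (U j 1 (t, x))\<^sup>2)"
      using zero_le_power2[of "U i 1 (t, x) + U j 1 (t, x)"]
      unfolding D_diff[OF smooth_periodic_u smooth_periodic_u t] U_1 by (simp add: power2_sum power2_diff)
  qed
  also have "\<dots> = 2 * (e i 1 t + e j 1 t)"
    unfolding wint_cmult e_def by (simp add: wint_add smooth_periodic_power smooth_periodic_U t)
  also have "\<dots> \<le> 4 * E 1 t"
    using e_le_E[OF t, of i 1] e_le_E[OF t, of j 1] by simp
  finally show "(?F (t, x))\<^sup>2 \<le> 8 * pi * E (Suc 0) t" by simp
qed

text \<open>As the u_j sum to zero, u_i is the mean over j of the differences u_i - u_j.\<close>

lemma vanishing_u: "vanishing (u i)"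
proof -
  have "vanishing (\<lambda>p. (1 / 3) * (\<Sum>j\<in>UNIV. u i p - u j p))"
    by (intro vanishing_cmult vanishing_sum vanishing_u_diff)
  then show ?thesis
  proof (rule vanishing_cong[rotated])
    show "(1 / 3) * (\<Sum>j\<in>UNIV. u i (t, x) - u j (t, x)) = u i (t, x)" if "0 < t" for t x
      using sum_U[OF that, of 0 x] by (simp add: U_0 sum_subtractf)
  qed
qed

text \<open>The constant speed at which the circle, parametrized over a period 2 pi, is
  traversed.\<close>

definition c :: "real \<Rightarrow> real"
  where "c t = wint (\<lambda>p. 1) t / (2 * pi)"

lemma c_pos:
  assumes "0 < t"
  shows "0 < c t"
proof -
  have "wint (\<lambda>p. 1) t \<noteq> 0"
  proof
    assume "wint (\<lambda>p. 1) t = 0"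
    then have "integral {0..2 * pi} (\<lambda>x. V (t, x)) = 0" unfolding wint_def by simp
    then obtain x where "V (t, x) = 0"
      using continuous_zero_of_integral_zero[OF smooth_continuous_on_slice[OF smooth_periodic_smooth[OF smooth_periodic_V] assms], of 0 "2 * pi"]
      by auto
    then show False using V_pos[of "(t, x)"] by simp
  qed
  then show ?thesis
    using wint_nonneg[OF smooth_periodic_const[of 1] assms] unfolding c_def by simp
qed

text \<open>From above, c <= 1 by \<open>length_le\<close>. From below, V = exp (- u_1) A_1 is at
  least (1 - \<epsilon>/2) A_1 once |u_1| < \<epsilon>/2, and A_1 has integral 2 pi; any index would
  serve.\<close>

lemma c_tendsto: "(c \<longlongrightarrow> 1) at_top"
proof (rule tendstoI)
  fix \<epsilon> :: real assume "0 < \<epsilon>"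
  then have "eventually (\<lambda>t. \<forall>x. \<bar>u 1 (t, x)\<bar> < \<epsilon> / 2) at_top"
    using vanishing_u[of 1] unfolding vanishing_iff by (meson half_gt_zero)
  then show "eventually (\<lambda>t. dist (c t) 1 < \<epsilon>) at_top"
    using eventually_gt_at_top[of 0]
  proof eventually_elim
    case (elim t)
    have "integral {0..2 * pi} (\<lambda>x. (1 - \<epsilon> / 2) * A 1 (t, x)) \<le> wint (\<lambda>p. 1) t"
      unfolding wint_def
    proof (rule integral_le)
      show "(\<lambda>x. (1 - \<epsilon> / 2) * A 1 (t, x)) integrable_on {0..2 * pi}"
        by (intro integrable_on_mult_right integrable_slice smooth_periodic_A elim)
      show "(\<lambda>x. 1 * V (t, x)) integrable_on {0..2 * pi}"
        using integrable_slice[OF smooth_periodic_V elim(2)] by simp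
      fix x
      have "(1 - \<epsilon> / 2) * A 1 (t, x) \<le> exp (- u 1 (t, x)) * A 1 (t, x)"
      proof (intro mult_right_mono less_imp_le[OF A_pos] elim)
        have "1 - \<epsilon> / 2 \<le> 1 + - u 1 (t, x)" using elim(1)[rule_format, of x] by linarith
        also have "\<dots> \<le> exp (- u 1 (t, x))" by (rule exp_ge_add_one_self)
        finally show "1 - \<epsilon> / 2 \<le> exp (- u 1 (t, x))" .
      qed
      also have "\<dots> = 1 * V (t, x)" unfolding A_eq[OF elim(2)] by (simp flip: exp_add mult.assoc)
      finally show "(1 - \<epsilon> / 2) * A 1 (t, x) \<le> 1 * V (t, x)" .
    qed
    then have "(1 - \<epsilon> / 2) * (2 * pi) \<le> wint (\<lambda>p. 1) t"
      by (simp add: A_integral elim)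
    then have "1 - \<epsilon> / 2 \<le> c t" unfolding c_def by (simp add: field_simps)
    moreover have "c t \<le> 1" using length_le[OF elim(2)] unfolding c_def by simp
    ultimately show ?case using \<open>0 < \<epsilon>\<close> by (simp add: dist_real_def)
  qed
qed

text \<open>Sums of products of the U_k with k >= 1, each product having at least one factor.
  Excluding constants makes every member vanish in the limit, and the class is stable under
  \<open>D\<close>.\<close>

inductive poly_U :: "(real \<times> real \<Rightarrow> real) \<Rightarrow> bool"
  where
    poly_U_base: "poly_U (U i (Suc k))"
  | poly_U_add: "poly_U F \<Longrightarrow> poly_U G \<Longrightarrow> poly_U (\<lambda>p. F p + G p)"
  | poly_U_mult: "poly_U F \<Longrightarrow> poly_U G \<Longrightarrow> poly_U (\<lambda>p. F p * G p)"
  | poly_U_cong: "poly_U F \<Longrightarrow> (\<And>t x. 0 < t \<Longrightarrow> F (t, x) = G (t, x)) \<Longrightarrow> poly_U G"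

lemma poly_U_smooth_periodic: "poly_U F \<Longrightarrow> smooth_periodic F"
proof (induction rule: poly_U.induct)
  case (poly_U_cong F G)
  show ?case by (rule smooth_periodic_cong[OF poly_U_cong.hyps(2) poly_U_cong.IH])
qed (auto intro!: smooth_periodic_mult smooth_periodic_U smooth_periodic_add)

lemma poly_U_vanishing: "poly_U F \<Longrightarrow> vanishing F"
proof (induction rule: poly_U.induct)
  case (poly_U_cong F G)
  show ?case by (rule vanishing_cong[OF poly_U_cong.hyps(2) poly_U_cong.IH])
qed (auto intro!: vanishing_mult vanishing_add vanishing_U)

lemma poly_U_D: "poly_U F \<Longrightarrow> poly_U (D F)"
proof (induction rule: poly_U.induct)
  case (poly_U_base i k)
  show ?case using poly_U.poly_U_base[of i "Suc k"] by (simp add: U_Suc)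
next
  case (poly_U_add F G)
  from poly_U.poly_U_add[OF poly_U_add.IH] show ?case
    by (rule poly_U.poly_U_cong) (simp add: D_add poly_U_add.hyps poly_U_smooth_periodic)
next
  case (poly_U_mult F G)
  have "poly_U (\<lambda>p. D F p * G p + F p * D G p)"
    by (intro poly_U.poly_U_add poly_U.poly_U_mult poly_U_mult)
  then show ?case
    by (rule poly_U.poly_U_cong) (simp add: D_mult poly_U_mult.hyps poly_U_smooth_periodic)
next
  case (poly_U_cong F G)
  from poly_U_cong.IH show ?case
    by (rule poly_U.poly_U_cong) (rule D_cong[of F G, OF poly_U_cong.hyps(2)])
qed

definition f :: "3 \<Rightarrow> real \<times> real \<Rightarrow> real"
  where "f i p = exp (u i p)"

lemma smooth_periodic_f: "smooth_periodic (f i)"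
  unfolding f_def[abs_def] by (intro smooth_periodic_exp smooth_periodic_u)

lemma D_f: "0 < t \<Longrightarrow> D (f i) (t, x) = f i (t, x) * U i 1 (t, x)"
  unfolding f_def[abs_def] by (simp add: D_exp smooth_periodic_u U_1 del: One_nat_def)

text \<open>As f_i = exp u_i, differentiating f_i Y gives f_i (U_1 Y + D Y); this recursion, started
  at U_1, stays within \<open>poly_U\<close>.\<close>

lemma D_power_f: "\<exists>Y. poly_U Y \<and> (\<forall>t>0. \<forall>x. (D ^^ Suc k) (f i) (t, x) = f i (t, x) * Y (t, x))"
proof (induction k)
  case 0
  show ?case
    by (rule exI[of _ "U i 1"]) (use poly_U_base[of i 0] D_f in simp)
next
  case (Suc k)
  then obtain Y where Y: "poly_U Y" "\<And>t x. 0 < t \<Longrightarrow> (D ^^ Suc k) (f i) (t, x) = f i (t, x) * Y (t, x)"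
    by blast
  show ?case
  proof (intro exI conjI allI impI)
    show "poly_U (\<lambda>p. U i (Suc 0) p * Y p + D Y p)"
      by (intro poly_U_add poly_U_mult poly_U_base poly_U_D Y)
    fix t x :: real assume t: "0 < t"
    have "(D ^^ Suc (Suc k)) (f i) (t, x) = D ((D ^^ Suc k) (f i)) (t, x)" by simp
    also have "\<dots> = D (\<lambda>p. f i p * Y p) (t, x)" by (rule D_cong[where G = "\<lambda>p. f i p * Y p", OF Y(2) t])
    also have "\<dots> = f i (t, x) * (U i (Suc 0) (t, x) * Y (t, x) + D Y (t, x))"
      by (simp add: D_mult smooth_periodic_f poly_U_smooth_periodic[OF Y(1)] t D_f algebra_simps)
    finally show "(D ^^ Suc (Suc k)) (f i) (t, x) = f i (t, x) * (U i (Suc 0) (t, x) * Y (t, x) + D Y (t, x))" .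
  qed
qed

lemma vanishing_f: "vanishing (\<lambda>p. f i p - 1)"
  unfolding vanishing_iff
proof (intro allI impI)
  fix \<epsilon> :: real assume "0 < \<epsilon>"
  then obtain \<delta> where \<delta>: "0 < \<delta>" "\<And>y. \<bar>y\<bar> < \<delta> \<Longrightarrow> \<bar>exp y - 1\<bar> < \<epsilon>"
    using isCont_exp[of "0::real", unfolded continuous_at_eps_delta, rule_format, of \<epsilon>]
    by (auto simp: dist_real_def)
  then have "eventually (\<lambda>t. \<forall>x. \<bar>u i (t, x)\<bar> < \<delta>) at_top"
    using vanishing_u unfolding vanishing_iff by blast
  then show "eventually (\<lambda>t. \<forall>x. \<bar>f i (t, x) - 1\<bar> < \<epsilon>) at_top"
    by eventually_elim (simp add: f_def \<delta>)
qed

lemma vanishing_D_power_f: "vanishing ((D ^^ Suc k) (f i))"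
proof -
  obtain Y where Y: "poly_U Y" "\<And>t x. 0 < t \<Longrightarrow> (D ^^ Suc k) (f i) (t, x) = f i (t, x) * Y (t, x)"
    using D_power_f by blast
  \<comment> \<open>The product f_i Y is split because f_i itself tends to 1, not to 0.\<close>
  have "vanishing (\<lambda>p. (f i p - 1) * Y p + Y p)"
    by (intro vanishing_add vanishing_mult vanishing_f poly_U_vanishing Y)
  then show ?thesis
    by (rule vanishing_cong[rotated]) (simp only: Y(2), simp add: algebra_simps)
qed

lemma vanishing_scaled:
  assumes "vanishing F" "(b \<longlongrightarrow> l) at_top"
  shows "vanishing (\<lambda>p. b (fst p) * F p)"
proof -
  have "vanishing (\<lambda>p. b (fst p) - l)"
    unfolding vanishing_iff using tendstoD[OF assms(2)] by (simp add: dist_real_def)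
  from vanishing_add[OF vanishing_mult[OF this assms(1)] vanishing_cmult[OF assms(1), of l]]
  show ?thesis by (simp add: algebra_simps)
qed

text \<open>The reparametrized coefficient is c f_i, and each derivative along the circle acts as c
  D. The 1 subtracted at order 0 is the coefficient in the standard triple.\<close>

lemma vanishing_rescaled_f:
  "vanishing (\<lambda>p. c (fst p) * (c (fst p) ^ k * (D ^^ k) (f i) p) - (if k = 0 then 1 else 0))"
proof (cases k)
  case 0
  have "vanishing (\<lambda>p. c (fst p) - 1)"
    unfolding vanishing_iff using tendstoD[OF c_tendsto] by (simp add: dist_real_def)
  from vanishing_add[OF vanishing_scaled[OF vanishing_f[of i] c_tendsto] this]
  show ?thesis using 0 by (simp add: algebra_simps)
next
  case (Suc j)
  have "((\<lambda>t. c t * c t ^ k) \<longlongrightarrow> 1 * 1 ^ k) at_top"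
    by (intro tendsto_intros c_tendsto)
  from vanishing_scaled[OF vanishing_D_power_f[of j i] this]
  show ?thesis using Suc by (simp add: mult.assoc)
qed

text \<open>\<open>h\<close> is the inverse of arclength scaled to total length \<open>2 * pi\<close>; a derivative of \<open>F (t, h y)\<close> is
  then \<open>c t\<close> times the arclength derivative \<open>D F\<close> at \<open>(t, h y)\<close>.\<close>

lemma reparametrization:
  assumes "0 < t"
  shows "\<exists>S h. (\<forall>x. (S has_real_derivative V (t, x) / c t) (at x)) \<and>
    (\<forall>y. (h has_real_derivative c t / V (t, h y)) (at y)) \<and>
    (\<forall>x. h (S x) = x) \<and> (\<forall>y. S (h y) = y) \<and>
    (\<forall>x. S (x + 2 * pi) = S x + 2 * pi) \<and> (\<forall>y. h (y + 2 * pi) = h y + 2 * pi)"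
proof -
  have "integral {0..2 * pi} (\<lambda>x. V (t, x) / c t) = integral {0..2 * pi} (\<lambda>x. V (t, x)) / c t"
    by simp
  also have "\<dots> = 2 * pi"
    using c_pos[OF assms] unfolding c_def wint_def by (auto simp: zero_less_divide_iff)
  finally have i: "integral {0..2 * pi} (\<lambda>x. V (t, x) / c t) = 2 * pi" .
  have "continuous_on UNIV (\<lambda>x. V (t, x) / c t)"
    using c_pos[OF assms]
    by (intro continuous_intros smooth_continuous_on_slice smooth_periodic_smooth smooth_periodic_V assms) simp
  from circle_reparametrization[OF this _ _ i] show ?thesis
    using c_pos[OF assms] by (simp add: V_pos smooth_periodic_periodic[OF smooth_periodic_V assms])
qed

end

section \<open>The metric and the torsion of a triple of simple type\<close>

text \<open>In the type \<open>4\<close> the numeral 4 equals 0; listing the elements as 0, 1, 2, 3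
  follows the order of the coordinates.\<close>

lemma UNIV_4': "UNIV = {0, 1, 2, 3 :: 4}"
  using UNIV_4 by auto

lemma sum_4': "sum f (UNIV :: 4 set) = f 0 + f 1 + f 2 + f 3"
  unfolding UNIV_4' by (simp add: ac_simps)

lemma prod_4': "prod f (UNIV :: 4 set) = f 0 * f 1 * f 2 * (f 3 :: 'a::comm_monoid_mult)"
  unfolding UNIV_4' by (simp add: ac_simps)

lemma exhaust_4': "b = 0 \<or> b = 1 \<or> b = 2 \<or> b = (3 :: 4)"
  using UNIV_4' by blast

lemma forall_4': "(\<forall>b::4. P b) \<longleftrightarrow> P 0 \<and> P 1 \<and> P 2 \<and> P 3"
  by (metis exhaust_4')

text \<open>For i = 3 the indices i + 1 and i + 2 simplify to the numerals 4 and 5, which stand for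
  1 and 2.\<close>

lemma cidx_simps [simp]: "cidx 1 = 1" "cidx 2 = 2" "cidx 3 = 3" "cidx 4 = 1" "cidx 5 = 2"
  unfolding cidx_def by simp_all

lemma fr_nth: "fr a $ b = (if a = b then 1 else 0)"
  by (simp add: fr_def axis_def)

lemma det_4:
  "det (A :: 'a::comm_ring_1^4^4) =
    A$0$0 * (A$1$1 * (A$2$2 * A$3$3 - A$2$3 * A$3$2) - A$1$2 * (A$2$1 * A$3$3 - A$2$3 * A$3$1) + A$1$3 * (A$2$1 * A$3$2 - A$2$2 * A$3$1))
  - A$0$1 * (A$1$0 * (A$2$2 * A$3$3 - A$2$3 * A$3$2) - A$1$2 * (A$2$0 * A$3$3 - A$2$3 * A$3$0) + A$1$3 * (A$2$0 * A$3$2 - A$2$2 * A$3$0))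
  + A$0$2 * (A$1$0 * (A$2$1 * A$3$3 - A$2$3 * A$3$1) - A$1$1 * (A$2$0 * A$3$3 - A$2$3 * A$3$0) + A$1$3 * (A$2$0 * A$3$1 - A$2$1 * A$3$0))
  - A$0$3 * (A$1$0 * (A$2$1 * A$3$2 - A$2$2 * A$3$1) - A$1$1 * (A$2$0 * A$3$2 - A$2$2 * A$3$0) + A$1$2 * (A$2$0 * A$3$1 - A$2$1 * A$3$0))"
proof -
  have f0: "finite {1, 2, 3 :: 4}" "0 \<notin> {1, 2, 3 :: 4}" by auto
  have f1: "finite {2, 3 :: 4}" "1 \<notin> {2, 3 :: 4}" by auto
  have f2: "finite {3 :: 4}" "2 \<notin> {3 :: 4}" by auto
  show ?thesis
    unfolding det_def UNIV_4'
    unfolding sum_over_permutations_insert[OF f0]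
    unfolding sum_over_permutations_insert[OF f1]
    unfolding sum_over_permutations_insert[OF f2]
    unfolding permutes_sing
    by (simp add: sign_swap_id permutation_swap_id permutation_compose sign_compose sign_id swap_id_eq algebra_simps)
qed

section \<open>Oriented frames and the Hodge star of a diagonal metric\<close>

definition diag_metric :: "(4 \<Rightarrow> real) \<Rightarrow> cov2"
  where "diag_metric d u v = (\<Sum>b\<in>UNIV. d b * u $ b * v $ b)"

definition rows4 :: "R4 \<Rightarrow> R4 \<Rightarrow> R4 \<Rightarrow> R4 \<Rightarrow> real ^ 4 ^ 4"
  where "rows4 p q r s = (\<chi> a. if a = 0 then p else if a = 1 then q else if a = 2 then r else s)"

lemma rows4_nth [simp]:
  "rows4 p q r s $ 0 = p" "rows4 p q r s $ 1 = q" "rows4 p q r s $ 2 = r" "rows4 p q r s $ 3 = s"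
  unfolding rows4_def by simp_all

lemma rows4_eta: "(\<chi> a. e a) = rows4 (e 0) (e 1) (e 2) (e 3)"
  by (simp add: vec_eq_iff forall_4' rows4_def)

text \<open>If \<open>E\<close> is the matrix of the frame and \<open>G\<close> that of the metric, then \<open>G E\<^sup>T\<close> is the inverse of \<open>E\<close>; the
  claim is Cramer's rule for its last column.\<close>

lemma oriented_orthonormal_minor:
  assumes e: "oriented_orthonormal (diag_metric d) m e" and m: "m\<^sup>2 = (\<Prod>b\<in>UNIV. d b)"
  shows "m * det (rows4 (e 0) (e 1) (e 2) (fr b)) = d b * e 3 $ b"
proof -
  let ?E = "\<chi> a. e a"
  define G :: "real ^ 4 ^ 4" where "G = (\<chi> a b. if a = b then d a else 0)"
  define K where "K = G ** transpose ?E"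
  have K: "K $ i $ a = d i * e a $ i" for i a
    unfolding K_def G_def matrix_matrix_mult_def transpose_def
    by (simp add: if_distrib[of "\<lambda>x. x * _"] cong: if_cong)
  have "?E ** K = mat 1"
    using e unfolding oriented_orthonormal_def diag_metric_def
    by (simp add: vec_eq_iff matrix_matrix_mult_def K mat_def mult_ac)
  then have KE: "K ** ?E = mat 1" by (rule matrix_left_right_inverse[THEN iffD1])
  have "det G = m\<^sup>2"
    unfolding m by (subst det_diagonal) (auto simp: G_def)
  then have "det K = m\<^sup>2 * det ?E"
    unfolding K_def by (simp add: det_mul det_transpose)
  moreover have "det K * det ?E = 1" using KE by (metis det_I det_mul)
  ultimately have "(m * det ?E)\<^sup>2 = 1" by (simp add: power2_eq_square algebra_simps)
  moreover have "0 < m * det ?E" using e unfolding oriented_orthonormal_def by blast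
  ultimately have mE: "m * det ?E = 1"
    using power2_eq_1_iff by fastforce
  let ?M = "rows4 (fr 0) (fr 1) (fr 2) (\<chi> a. K $ b $ a)"
  have "(\<Sum>a\<in>UNIV. K $ b $ a * e a $ j) = (if b = j then 1 else 0)" for j
    using KE by (simp add: vec_eq_iff matrix_matrix_mult_def mat_def)
  then have "?M ** ?E = rows4 (e 0) (e 1) (e 2) (fr b)"
    by (simp add: vec_eq_iff matrix_matrix_mult_def forall_4' fr_nth if_distrib[of "\<lambda>x. x * _"] cong: if_cong)
  then have "det (rows4 (e 0) (e 1) (e 2) (fr b)) = det ?M * det ?E"
    by (metis det_mul)
  moreover have "det ?M = d b * e 3 $ b"
    by (simp add: det_4 fr_nth K)
  ultimately show ?thesis using mE by (simp add: algebra_simps)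
qed

text \<open>The description of the Hodge star constrains a form only on last frame vectors. For
  uniqueness every coordinate direction must occur there.\<close>

lemma oriented_orthonormal_exists:
  assumes d: "\<And>b. 0 < d b" and m: "0 < m"
  shows "\<exists>e. oriented_orthonormal (diag_metric d) m e \<and> e 3 = (1 / sqrt (d b)) *\<^sub>R fr b"
proof -
  define n where "n = (\<lambda>b. (1 / sqrt (d b)) *\<^sub>R fr b)"
  have sq: "d b * (1 / sqrt (d b)) * (1 / sqrt (d b)) = 1" for b
    using d[of b] by (simp add: field_simps)
  have nn: "diag_metric d (n p) (n q) = (if p = q then 1 else 0)" for p q
    unfolding diag_metric_def n_def using sq
    by (simp add: fr_nth if_distrib[of "\<lambda>x. _ * x"] cong: if_cong)
  have pos: "0 < sqrt (d b)" for b using d by simp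
  \<comment> \<open>The identity for b = 3, otherwise a 3-cycle sending 3 to b: always an even
    permutation, so the orientation is preserved.\<close>
  define \<pi> :: "4 \<Rightarrow> 4" where "\<pi> = (\<lambda>a.
    if b = 3 then a
    else if b = 2 then (if a = 0 then 0 else if a = 1 then 3 else if a = 2 then 1 else 2)
    else if b = 1 then (if a = 0 then 0 else if a = 1 then 2 else if a = 2 then 3 else 1)
    else (if a = 0 then 2 else if a = 1 then 1 else if a = 2 then 3 else 0))"
  have "oriented_orthonormal (diag_metric d) m (\<lambda>a. n (\<pi> a))"
    unfolding oriented_orthonormal_def
  proof (intro conjI allI)
    have inj: "\<pi> p = \<pi> q \<longleftrightarrow> p = q" for p q
      using exhaust_4'[of b] exhaust_4'[of p] exhaust_4'[of q] unfolding \<pi>_def by auto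
    show "diag_metric d (n (\<pi> p)) (n (\<pi> q)) = (if p = q then 1 else 0)" for p q
      using inj by (simp add: nn)
    have "0 < det (rows4 (n (\<pi> 0)) (n (\<pi> 1)) (n (\<pi> 2)) (n (\<pi> 3)))"
      using exhaust_4'[of b] pos unfolding \<pi>_def n_def
      by (auto simp: det_4 fr_nth intro!: mult_pos_pos)
    then show "0 < m * det (\<chi> a. n (\<pi> a))"
      using m rows4_eta[of "\<lambda>a. n (\<pi> a)"] by simp
  qed
  moreover have "\<pi> 3 = b" using exhaust_4'[of b] unfolding \<pi>_def by auto
  ultimately show ?thesis unfolding n_def by (intro exI[of _ "\<lambda>a. n (\<pi> a)"]) (simp add: n_def)
qed

text \<open>The 3-form is the coordinate volume form with \<open>fr b\<close> in its last slot,
  times \<kappa>. Cramer's rule shows that the proposed form qualifies; frames ending in a multiple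
  of \<open>fr p\<close>, for each p, show that no other linear form does.\<close>

lemma hodge3_diag_metric:
  assumes d: "\<And>b. 0 < d b" and m: "0 < m" "m\<^sup>2 = (\<Prod>b\<in>UNIV. d b)"
    and \<beta>: "\<And>p q r. \<beta> p q r = \<kappa> * det (rows4 p q r (fr b))"
  shows "hodge3 (diag_metric d) m \<beta> = (\<lambda>u. \<kappa> * d b / m * u $ b)"
  unfolding hodge3_def
proof (rule the_equality)
  have *: "\<beta> (e 0) (e 1) (e 2) = \<kappa> * d b / m * e 3 $ b"
    if "oriented_orthonormal (diag_metric d) m e" for e
    using oriented_orthonormal_minor[OF that m(2), of b] m(1) by (simp add: \<beta> field_simps)
  have lin: "linear (\<lambda>u :: R4. \<kappa> * d b / m * u $ b)"
    by (intro linearI) (simp_all add: algebra_simps)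
  show "linear (\<lambda>u. \<kappa> * d b / m * u $ b) \<and>
    (\<forall>e. oriented_orthonormal (diag_metric d) m e \<longrightarrow> \<kappa> * d b / m * e 3 $ b = \<beta> (e 0) (e 1) (e 2))"
    using lin * by simp
  fix \<gamma> assume \<gamma>: "linear \<gamma> \<and> (\<forall>e. oriented_orthonormal (diag_metric d) m e \<longrightarrow> \<gamma> (e 3) = \<beta> (e 0) (e 1) (e 2))"
  have "\<gamma> (fr p) = \<kappa> * d b / m * fr p $ b" for p
  proof -
    obtain e where e: "oriented_orthonormal (diag_metric d) m e" "e 3 = (1 / sqrt (d p)) *\<^sub>R fr p"
      using oriented_orthonormal_exists[of d m p, OF d m(1)] by blast
    have "\<gamma> (e 3) = \<kappa> * d b / m * e 3 $ b" using \<gamma> * e(1) by simp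
    then have "(1 / sqrt (d p)) * \<gamma> (fr p) = (1 / sqrt (d p)) * (\<kappa> * d b / m * fr p $ b)"
      using \<gamma> unfolding e(2) by (simp add: linear_scale)
    moreover have "1 / sqrt (d p) \<noteq> 0" using d[of p] by simp
    ultimately show ?thesis using mult_left_cancel[of "1 / sqrt (d p)"] by blast
  qed
  then show "\<gamma> = (\<lambda>u. \<kappa> * d b / m * u $ b)"
    using \<gamma> lin
    by (intro linear_eq_stdbasis) (auto simp: Basis_vec_def fr_def)
qed

section \<open>The metric of a triple of simple type at one point\<close>

definition simple_covs :: "(3 \<Rightarrow> real) \<Rightarrow> 3 \<Rightarrow> cov2"
  where "simple_covs a i = (\<lambda>u v. a i * wedge11 (dx 0) (dx (cidx i)) u v
    + wedge11 (dx (cidx (i + 1))) (dx (cidx (i + 2))) u v)"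

lemma simple_triple_eq: "simple_triple A i x = simple_covs (\<lambda>i. A i (x $ 0)) i"
  unfolding simple_triple_def simple_covs_def ..

text \<open>For \<open>m\<close> = V these are the metric coefficients V^2, f_1, f_2, f_3.\<close>

definition simple_diag :: "(3 \<Rightarrow> real) \<Rightarrow> real \<Rightarrow> 4 \<Rightarrow> real"
  where "simple_diag a m b = (if b = 0 then m\<^sup>2 else if b = 1 then a 1 / m else if b = 2 then a 2 / m else a 3 / m)"

lemma simple_diag_cidx: "simple_diag a m (cidx i) = a i / m"
  using exhaust_3[of i] by (auto simp: simple_diag_def)

lemma wedge_matrix_simple: "wedge_matrix (simple_covs a) m = (\<chi> i j. if i = j then a i / m else 0)"
  by (simp add: vec_eq_iff forall_3 wedge_matrix_def simple_covs_def top4_def wedge22_def wedge11_def dx_def fr_nth)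

lemma sum_levi_civita:
  "(\<Sum>i\<in>UNIV. \<Sum>j\<in>UNIV. \<Sum>k\<in>UNIV. levi_civita i j k * T i j k) =
    T 1 2 3 + T 2 3 1 + T 3 1 2 - T 1 3 2 - T 2 1 3 - T 3 2 1"
  by (simp add: sum_3 levi_civita_def)

lemma top4_wedge22_simple:
  "top4 (wedge22 \<alpha> (simple_covs a 1)) = \<alpha> (fr 0) (fr 1) + a 1 * \<alpha> (fr 2) (fr 3)"
  "top4 (wedge22 \<alpha> (simple_covs a 2)) = \<alpha> (fr 0) (fr 2) - a 2 * \<alpha> (fr 1) (fr 3)"
  "top4 (wedge22 \<alpha> (simple_covs a 3)) = \<alpha> (fr 0) (fr 3) + a 3 * \<alpha> (fr 1) (fr 2)"
  by (simp_all add: top4_def wedge22_def simple_covs_def wedge11_def dx_def fr_nth)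

lemma simple_covs_fr:
  "simple_covs a 1 u (fr 0) = - a 1 * u $ 1" "simple_covs a 1 u (fr 1) = a 1 * u $ 0"
  "simple_covs a 1 u (fr 2) = - u $ 3" "simple_covs a 1 u (fr 3) = u $ 2"
  "simple_covs a 2 u (fr 0) = - a 2 * u $ 2" "simple_covs a 2 u (fr 1) = u $ 3"
  "simple_covs a 2 u (fr 2) = a 2 * u $ 0" "simple_covs a 2 u (fr 3) = - u $ 1"
  "simple_covs a 3 u (fr 0) = - a 3 * u $ 3" "simple_covs a 3 u (fr 1) = - u $ 2"
  "simple_covs a 3 u (fr 2) = u $ 1" "simple_covs a 3 u (fr 3) = a 3 * u $ 0"
  by (simp_all add: simple_covs_def wedge11_def dx_def fr_nth)

text \<open>The cubic relation says that \<open>m\<close> is V. It enters in the dx_0 component,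
  where the left side produces a_1 a_2 a_3 and the right side m * m^2.\<close>

lemma simple_metric_formula:
  assumes m: "m ^ 3 = a 1 * a 2 * a 3" "m \<noteq> 0"
  shows "1 / 6 * (\<Sum>i\<in>UNIV. \<Sum>j\<in>UNIV. \<Sum>k\<in>UNIV. levi_civita i j k *
      top4 (wedge22 (wedge11 (simple_covs a i u) (simple_covs a j v)) (simple_covs a k)))
    = m * diag_metric (simple_diag a m) u v"
proof -
  have "m * diag_metric (simple_diag a m) u v =
      m ^ 3 * u $ 0 * v $ 0 + a 1 * u $ 1 * v $ 1 + a 2 * u $ 2 * v $ 2 + a 3 * u $ 3 * v $ 3"
    using m(2) by (simp add: diag_metric_def sum_4' simple_diag_def field_simps power2_eq_square power3_eq_cube)
  then show ?thesis
    unfolding m(1)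
    unfolding sum_levi_civita top4_wedge22_simple wedge11_def simple_covs_fr
    by (simp add: algebra_simps)
qed

lemma prod_simple_diag:
  assumes "m ^ 3 = a 1 * a 2 * a 3" "m \<noteq> 0"
  shows "(\<Prod>b\<in>UNIV. simple_diag a m b) = m\<^sup>2"
proof -
  have "(\<Prod>b\<in>UNIV. simple_diag a m b) = m\<^sup>2 * ((a 1 * a 2 * a 3) / m ^ 3)"
    by (simp add: prod_4' simple_diag_def power3_eq_cube)
  then show ?thesis using assms(2) unfolding assms(1)[symmetric] by simp
qed

lemma simple_diag_pos: "(\<And>i. 0 < a i) \<Longrightarrow> 0 < m \<Longrightarrow> 0 < simple_diag a m b"
  by (simp add: simple_diag_def)

lemma posdef3_diag: "(\<And>i. 0 < l i) \<Longrightarrow> posdef3 (\<chi> i j. if i = j then l i else 0)"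
proof -
  assume l: "\<And>i. 0 < l i"
  have "v \<bullet> ((\<chi> i j. if i = j then l i else 0) *v v) = (\<Sum>i\<in>UNIV. l i * (v $ i)\<^sup>2)" for v :: "real ^ 3"
  proof -
    have "((\<chi> i j. if i = j then l i else 0) *v v) $ i = l i * v $ i" for i
      by (simp add: matrix_vector_mult_def if_distrib[of "\<lambda>x. x * _"] cong: if_cong)
    then show ?thesis by (simp add: inner_vec_def power2_eq_square mult_ac)
  qed
  moreover have "0 < (\<Sum>i\<in>UNIV. l i * (v $ i)\<^sup>2)" if "v \<noteq> 0" for v :: "real ^ 3"
  proof -
    obtain i where "v $ i \<noteq> 0" using \<open>v \<noteq> 0\<close> by (auto simp: vec_eq_iff)
    then show ?thesis using l by (intro sum_pos2[of _ i]) (auto simp: less_imp_le)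
  qed
  ultimately show ?thesis
    unfolding posdef3_def by (auto simp: transpose_def vec_eq_iff)
qed

lemma inner_prod_form_diag_metric:
  assumes "\<And>b. 0 < d b"
  shows "inner_prod_form (diag_metric d)"
  unfolding inner_prod_form_def
proof (intro conjI allI impI)
  show "bilinear (diag_metric d)"
    unfolding bilinear_def diag_metric_def
    by (auto intro!: linearI simp: sum.distrib sum_distrib_left algebra_simps)
  show "diag_metric d u v = diag_metric d v u" for u v
    unfolding diag_metric_def by (simp add: mult_ac)
  fix u :: R4 assume "u \<noteq> 0"
  then obtain b where b: "u $ b \<noteq> 0" by (auto simp: vec_eq_iff)
  have "0 < (\<Sum>b\<in>UNIV. d b * (u $ b)\<^sup>2)"
    by (rule sum_pos2[of _ b]) (use assms b in \<open>auto simp: less_imp_le\<close>)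
  then show "0 < diag_metric d u u" unfolding diag_metric_def by (simp add: power2_eq_square mult.assoc)
qed

lemma det_scaled_diag_metric:
  "det (\<chi> a b. k * diag_metric d (fr a) (fr b)) = k ^ 4 * (\<Prod>b\<in>UNIV. d b)"
proof -
  have "diag_metric d (fr a) (fr b) = (if a = b then d a else 0)" for a b
    unfolding diag_metric_def by (simp add: fr_nth if_distrib[of "\<lambda>x. _ * x"] cong: if_cong)
  then show ?thesis by (subst det_diagonal) (auto simp: prod.distrib)
qed

text \<open>The defining formula fixes g only up to the factor m / n. In dimension four this factor
  enters the determinant to the fourth power, so the volume condition gives n^6 = m^6; positive
  definiteness of the wedge matrix decides the sign of n.\<close>

lemma is_hs_metric_simple:
  assumes a: "\<And>i. 0 < a i" and m: "0 < m" "m ^ 3 = a 1 * a 2 * a 3"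
  shows "is_hs_metric (simple_covs a) g n \<longleftrightarrow> g = diag_metric (simple_diag a m) \<and> n = m"
proof
  let ?d = "simple_diag a m"
  have d: "0 < ?d b" for b using a m(1) by (rule simple_diag_pos)
  have prod: "(\<Prod>b\<in>UNIV. ?d b) = m\<^sup>2" using m by (intro prod_simple_diag) auto
  have formula: "1 / 6 * (\<Sum>i\<in>UNIV. \<Sum>j\<in>UNIV. \<Sum>k\<in>UNIV. levi_civita i j k *
      top4 (wedge22 (wedge11 (simple_covs a i u) (simple_covs a j v)) (simple_covs a k)))
    = m * diag_metric ?d u v" for u v
    using m by (intro simple_metric_formula) auto
  {
    assume hs: "is_hs_metric (simple_covs a) g n"
    \<comment> \<open>Testing the wedge matrix on one basis vector yields the positive number a_1 /
      n.\<close>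
    have "axis 1 1 \<noteq> (0 :: real ^ 3)" by simp
    then have "0 < axis 1 1 \<bullet> (wedge_matrix (simple_covs a) n *v axis 1 1)"
      using hs unfolding is_hs_metric_def posdef3_def by blast
    also have "\<dots> = a 1 / n"
      unfolding wedge_matrix_simple by (simp add: inner_axis' matrix_vector_mult_basis column_def)
    finally have n: "0 < n" using a[of 1] by (simp add: zero_less_divide_iff)
    have g: "g u v = m / n * diag_metric ?d u v" for u v
    proof -
      have "g u v * n = m * diag_metric ?d u v"
        using hs formula unfolding is_hs_metric_def by simp
      then show ?thesis using n by (simp add: field_simps)
    qed
    have "n = sqrt (det (\<chi> a b. g (fr a) (fr b)))"
      using hs n unfolding is_hs_metric_def volume_coeff_def by simp
    then have "n = sqrt ((m / n) ^ 4 * m\<^sup>2)"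
      unfolding g det_scaled_diag_metric prod .
    then have "n\<^sup>2 = (m / n) ^ 4 * m\<^sup>2"
      by (metis real_sqrt_pow2 zero_le_mult_iff zero_le_power2 zero_le_even_power even_numeral)
    then have "n ^ 6 = m ^ 6" using n by (simp add: field_simps flip: power_add)
    then have nm: "n = m"
      using n m(1) by (metis less_imp_le power_eq_imp_eq_base zero_less_numeral)
    then show "g = diag_metric ?d \<and> n = m" using g m(1) by auto
  }
  {
    assume gn: "g = diag_metric ?d \<and> n = m"
    have "volume_coeff (diag_metric ?d) m"
      unfolding volume_coeff_def using det_scaled_diag_metric[of 1 ?d] m(1) by (simp add: prod)
    moreover have "posdef3 (wedge_matrix (simple_covs a) m)"
      unfolding wedge_matrix_simple using a m(1) by (intro posdef3_diag) simp
    ultimately show "is_hs_metric (simple_covs a) g n"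
      unfolding is_hs_metric_def formula using gn inner_prod_form_diag_metric[OF d] by (simp add: mult.commute)
  }
qed

lemma hs_metric_simple:
  assumes a: "\<And>i. 0 < a i" and m: "0 < m" "m ^ 3 = a 1 * a 2 * a 3"
  shows "hs_metric (simple_covs a) = diag_metric (simple_diag a m)" "hs_vol (simple_covs a) = m"
  unfolding hs_metric_def hs_vol_def is_hs_metric_simple[OF assms] by simp_all

text \<open>Wedging with dx_0 kills the first summand of the i-th form and leaves dx_0 \<and> dx_j
  \<and> dx_k. As (0, j, k, i) is an even permutation, this is the volume form with the i-th
  coordinate vector in the last slot.\<close>

lemma E_op_simple:
  assumes a: "\<And>i. 0 < a i" and m: "0 < m" "m ^ 3 = a 1 * a 2 * a 3"
  shows "E_op (simple_covs a) i (\<lambda>u. \<kappa> * u $ 0) = (\<lambda>u. - (\<kappa> * a i / m\<^sup>2 * u $ cidx i))"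
proof -
  have "wedge12 (\<lambda>u. \<kappa> * u $ 0) (simple_covs a i) p q r = \<kappa> * det (rows4 p q r (fr (cidx i)))" for p q r
    using exhaust_3[of i]
    by (auto simp: det_4 fr_nth wedge12_def simple_covs_def wedge11_def dx_def algebra_simps)
  from hodge3_diag_metric[of "simple_diag a m" m "wedge12 (\<lambda>u. \<kappa> * u $ 0) (simple_covs a i)" \<kappa> "cidx i", OF _ m(1) _ this]
  have "hodge3 (diag_metric (simple_diag a m)) m (wedge12 (\<lambda>u. \<kappa> * u $ 0) (simple_covs a i)) =
      (\<lambda>u. \<kappa> * simple_diag a m (cidx i) / m * u $ cidx i)"
    using simple_diag_pos[OF a m(1)] prod_simple_diag[OF m(2)] m(1) by simp
  then show ?thesis
    unfolding E_op_def hs_metric_simple[OF assms] by (simp add: simple_diag_cidx power2_eq_square)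
qed

lemma matrix_inv_diag:
  fixes l :: "'n::finite \<Rightarrow> real"
  assumes "\<And>i. l i \<noteq> 0"
  shows "matrix_inv (\<chi> i j. if i = j then l i else 0) = (\<chi> i j. if i = j then 1 / l i else 0)"
proof -
  let ?A = "(\<chi> i j. if i = j then l i else 0) :: real ^ 'n ^ 'n"
  let ?B = "(\<chi> i j. if i = j then 1 / l i else 0) :: real ^ 'n ^ 'n"
  have AB: "?A ** ?B = mat 1"
    using assms by (simp add: vec_eq_iff matrix_matrix_mult_def mat_def if_distrib[of "\<lambda>x. x * _"] cong: if_cong)
  then have BA: "?B ** ?A = mat 1" by (simp add: matrix_left_right_inverse)
  have "?A ** matrix_inv ?A = mat 1"
    unfolding matrix_inv_def by (rule someI2[of _ ?B]) (use AB BA in auto)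
  then have "?B ** (?A ** matrix_inv ?A) = ?B" by (simp add: matrix_mul_rid)
  then show ?thesis unfolding matrix_mul_assoc BA by (simp add: matrix_mul_lid)
qed

section \<open>Torsion forms and their exterior derivatives\<close>

lemma frechet_derivative_coord:
  fixes x u :: R4
  assumes "(q has_real_derivative q') (at (x $ b))"
  shows "frechet_derivative (\<lambda>y. q (y $ b)) (at x) u = q' * u $ b"
proof -
  have "((\<lambda>y. q (y $ b)) has_derivative (\<lambda>u. q' * u $ b)) (at x)"
    using has_derivative_compose[OF bounded_linear_imp_has_derivative[OF bounded_linear_vec_nth]
        assms[unfolded has_field_derivative_def]] .
  from frechet_derivative_at[OF this] show ?thesis by (metis)
qed

text \<open>Here \<open>q i\<close> is f_i'. The matrix dQ Q^(-1) is diagonal with entries (f_i' /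
  f_i) dx_0, and the operator E_i multiplies by - A_i / V^2 while turning dx_0 into dx_i; with A_i =
  f_i V this leaves f_i' / V.\<close>

lemma torsion_simple_triple:
  fixes A :: "3 \<Rightarrow> real \<Rightarrow> real" and m :: "real \<Rightarrow> real"
  assumes A: "\<And>i s. 0 < A i s" and m: "\<And>s. 0 < m s" "\<And>s. m s ^ 3 = A 1 s * A 2 s * A 3 s"
    and q: "\<And>i s. ((\<lambda>s. A i s / m s) has_real_derivative q i s) (at s)"
  shows "torsion (simple_triple A) i x u = q i (x $ 0) / m (x $ 0) * u $ cidx i"
proof -
  let ?a = "\<lambda>i. A i (x $ 0)" and ?m = "m (x $ 0)"
  have Q: "Qmat (simple_triple A) y = (\<chi> i j. if i = j then A i (y $ 0) / m (y $ 0) else 0)" for y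
    unfolding Qmat_def simple_triple_eq
    by (simp add: hs_metric_simple(2)[of "\<lambda>i. A i (y $ 0)" "m (y $ 0)"] A m wedge_matrix_simple)
  have dQ: "frechet_derivative (\<lambda>y. Qmat (simple_triple A) y $ i $ k) (at x) u =
      (if i = k then q i (x $ 0) * u $ 0 else 0)" for i k u
    unfolding Q by (simp add: frechet_derivative_coord[OF q])
  have ne: "A i s / m s \<noteq> 0" for i s
    using A[of i s] m(1)[of s] by simp
  have dQQ: "dQ_Qinv (simple_triple A) x i j =
      (\<lambda>u. (if i = j then q i (x $ 0) * ?m / ?a i else 0) * u $ 0)" for i j
  proof -
    have inv: "matrix_inv (Qmat (simple_triple A) x) $ i $ j = (if i = j then ?m / ?a i else 0)" for i j
      unfolding Q using matrix_inv_diag[of "\<lambda>i. ?a i / ?m", OF ne] by simp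
    show ?thesis
      unfolding dQ_Qinv_def dQ inv
      by (rule ext) (simp add: if_distrib[of "\<lambda>x. x * _"] cong: if_cong)
  qed
  have "torsion (simple_triple A) i x u =
      (\<Sum>j\<in>UNIV. (if i = j then q i (x $ 0) * ?m / ?a i else 0) * ?a j / ?m\<^sup>2 * u $ cidx j)"
    unfolding torsion_def dQQ simple_triple_eq E_op_simple[of ?a ?m, OF A m]
    by (simp add: sum_negf)
  also have "\<dots> = q i (x $ 0) / ?m * u $ cidx i"
    using A[of i "x $ 0"] m(1)[of "x $ 0"]
    by (simp add: if_distrib[of "\<lambda>x. x * _"] if_distrib[of "\<lambda>x. x / _"] power2_eq_square cong: if_cong)
  finally show ?thesis .
qed

text \<open>This component suffices for the scalar equation: it is the one in which the i-th form of
  the triple has the coefficient A_i.\<close>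

lemma ext_d1_torsion_simple_triple:
  fixes A :: "3 \<Rightarrow> real \<Rightarrow> real" and m :: "real \<Rightarrow> real"
  assumes A: "\<And>i s. 0 < A i s" and m: "\<And>s. 0 < m s" "\<And>s. m s ^ 3 = A 1 s * A 2 s * A 3 s"
    and q: "\<And>i s. ((\<lambda>s. A i s / m s) has_real_derivative q i s) (at s)"
    and q': "((\<lambda>s. q i s / m s) has_real_derivative D) (at (x $ 0))"
  shows "ext_d1 (torsion (simple_triple A) i) x (fr 0) (fr (cidx i)) = D"
proof -
  have c: "cidx i \<noteq> 0" using exhaust_3[of i] by auto
  have t: "torsion (simple_triple A) i = (\<lambda>y u. q i (y $ 0) / m (y $ 0) * u $ cidx i)"
    using torsion_simple_triple[OF A m q] by (intro ext) blast
  show ?thesis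
    unfolding ext_d1_def t using c
    by (simp add: fr_nth frechet_derivative_coord[OF q'])
qed

section \<open>Flows of simple type and diffeomorphisms of the torus\<close>

text \<open>The flow is smooth on a set with boundary. At interior points derivatives within that
  set are ordinary ones, so smoothness passes to the open half-plane of times and circle
  points.\<close>

lemma diff_times_compose_linear:
  assumes "open T" "bounded_linear L" "\<And>x. x \<in> T \<Longrightarrow> L x \<in> interior S" "diff_times n S G"
  shows "diff_times n T (\<lambda>x. G (L x))"
  using assms(4)
proof (induction n arbitrary: G)
  case (Suc n)
  show ?case
  proof (rule diff_times_SucI[OF assms(1), of _ "\<lambda>x v. frechet_derivative G (at (L x) within S) (L v)"])
    show "((\<lambda>x. G (L x)) has_derivative (\<lambda>v. frechet_derivative G (at (L x) within S) (L v))) (at x)"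
      if "x \<in> T" for x
    proof (rule has_derivative_compose[OF bounded_linear_imp_has_derivative[OF assms(2)]])
      have "L x \<in> S" "at (L x) within S = at (L x)"
        using assms(3)[OF that] interior_subset at_within_interior by auto
      then show "(G has_derivative frechet_derivative G (at (L x) within S)) (at (L x))"
        using Suc.prems unfolding diff_times.simps differentiable_on_def frechet_derivative_works by metis
    qed
    show "diff_times n T (\<lambda>x. frechet_derivative G (at (L x) within S) (L v))" for v
      by (rule Suc.IH) (use Suc.prems in simp)
  qed
qed simp

lemma smooth_within_compose_linear:
  assumes "open T" "bounded_linear L" "\<And>x. x \<in> T \<Longrightarrow> L x \<in> interior S" "smooth_within S G"
  shows "smooth_within T (\<lambda>x. G (L x))"
  unfolding smooth_within_iff
proof
  show "diff_times n T (\<lambda>x. G (L x))" for n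
    by (rule diff_times_compose_linear[OF assms(1-3)]) (use assms(4) in \<open>auto simp: smooth_within_iff\<close>)
qed

text \<open>Reading A_i off as a component avoids the potentials phi_i, which are provided only
  existentially and separately for each time, with no regularity in time.\<close>

definition coeff :: "(real \<Rightarrow> triple) \<Rightarrow> 3 \<Rightarrow> real \<times> real \<Rightarrow> real"
  where "coeff \<omega> i p = \<omega> (fst p) i (snd p *\<^sub>R fr 0) (fr 0) (fr (cidx i))"

lemma cidx_nonzero: "cidx i \<noteq> 0"
  unfolding cidx_def by simp

lemma simple_triple_coeff: "simple_triple A i x (fr 0) (fr (cidx i)) = A i (x $ 0)"
  using cidx_nonzero unfolding simple_triple_def by (simp add: wedge11_def dx_def fr_nth)

lemma smooth_has_real_derivative:
  fixes \<phi> :: "real \<Rightarrow> real"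
  assumes "smooth_within UNIV \<phi>"
  shows "(\<phi> has_real_derivative deriv \<phi> x) (at x)" "smooth_within UNIV (deriv \<phi>)"
proof -
  have "(\<phi> has_derivative frechet_derivative \<phi> (at x)) (at x)" for x
    using frechet_derivative_worksI[OF open_UNIV UNIV_I smooth_within_differentiable[OF assms]] .
  then have "(\<phi> has_derivative (\<lambda>h. frechet_derivative \<phi> (at x) 1 * h)) (at x)" for x
    using linear_scale[OF has_derivative_linear, of \<phi> "frechet_derivative \<phi> (at x)" "at x" _ 1]
    by (metis (no_types, lifting) ext mult.commute mult.right_neutral real_scaleR_def)
  then have d: "(\<phi> has_real_derivative frechet_derivative \<phi> (at x) 1) (at x)" for x
    unfolding has_field_derivative_def .
  then have eq: "deriv \<phi> = (\<lambda>x. frechet_derivative \<phi> (at x) 1)"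
    by (intro ext DERIV_imp_deriv)
  show "(\<phi> has_real_derivative deriv \<phi> x) (at x)" unfolding eq by (rule d)
  show "smooth_within UNIV (deriv \<phi>)"
    unfolding eq using smooth_within_frechet_derivative[OF assms, of 1] .
qed

lemma integral_one_plus_second_derivative:
  fixes \<phi> :: "real \<Rightarrow> real"
  assumes "smooth_within UNIV \<phi>" "\<And>s. \<phi> (s + 2 * pi) = \<phi> s"
  shows "integral {0..2 * pi} (\<lambda>s. 1 + deriv (deriv \<phi>) s) = 2 * pi"
proof -
  note d = smooth_has_real_derivative[OF assms(1)]
  have "((\<lambda>s. \<phi> (s + 2 * pi)) has_real_derivative deriv \<phi> (0 + 2 * pi)) (at 0)"
    using d(1)[of "0 + 2 * pi"] by (simp only: DERIV_shift)
  then have per: "deriv \<phi> (2 * pi) = deriv \<phi> 0"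
    using DERIV_unique[OF _ d(1)[of 0]] by (simp add: assms(2))
  have "((\<lambda>s. s + deriv \<phi> s) has_real_derivative 1 + deriv (deriv \<phi>) s) (at s)" for s
    by (intro DERIV_add DERIV_ident smooth_has_real_derivative(1) d(2))
  then have "((\<lambda>s. 1 + deriv (deriv \<phi>) s) has_integral (2 * pi + deriv \<phi> (2 * pi)) - (0 + deriv \<phi> 0)) {0..2 * pi}"
    by (intro fundamental_theorem_of_calculus)
      (auto simp flip: has_real_derivative_iff_has_vector_derivative intro: has_field_derivative_at_within)
  then show ?thesis by (simp add: per integral_unique)
qed

lemma simple_typeD:
  assumes "simple_type \<omega>"
  shows "\<omega> = simple_triple (\<lambda>i s. \<omega> i (s *\<^sub>R fr 0) (fr 0) (fr (cidx i)))"
    and "0 < \<omega> i (s *\<^sub>R fr 0) (fr 0) (fr (cidx i))"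
    and "integral {0..2 * pi} (\<lambda>s. \<omega> i (s *\<^sub>R fr 0) (fr 0) (fr (cidx i))) = 2 * pi"
proof -
  have "\<exists>\<phi> :: 3 \<Rightarrow> real \<Rightarrow> real.
      (\<forall>i. smooth_within UNIV (\<phi> i) \<and> (\<forall>s. \<phi> i (s + 2 * pi) = \<phi> i s) \<and>
            (\<forall>s. 0 < 1 + deriv (deriv (\<phi> i)) s)) \<and>
      \<omega> = simple_triple (\<lambda>i s. 1 + deriv (deriv (\<phi> i)) s)"
    using assms unfolding simple_type_def by (rule conjunct2)
  then obtain \<phi> :: "3 \<Rightarrow> real \<Rightarrow> real" where
    "(\<forall>i. smooth_within UNIV (\<phi> i) \<and> (\<forall>s. \<phi> i (s + 2 * pi) = \<phi> i s) \<and>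
            (\<forall>s. 0 < 1 + deriv (deriv (\<phi> i)) s)) \<and>
      \<omega> = simple_triple (\<lambda>i s. 1 + deriv (deriv (\<phi> i)) s)" ..
  then have \<phi>: "\<And>i. smooth_within UNIV (\<phi> i)"
    "\<And>i s. \<phi> i (s + 2 * pi) = \<phi> i s" "\<And>i s. 0 < 1 + deriv (deriv (\<phi> i)) s"
    "\<omega> = simple_triple (\<lambda>i s. 1 + deriv (deriv (\<phi> i)) s)"
    by simp_all
  have eq: "\<omega> i (s *\<^sub>R fr 0) (fr 0) (fr (cidx i)) = 1 + deriv (deriv (\<phi> i)) s" for i s
    unfolding \<phi>(4) simple_triple_coeff by (simp add: fr_nth)
  show "\<omega> = simple_triple (\<lambda>i s. \<omega> i (s *\<^sub>R fr 0) (fr 0) (fr (cidx i)))"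
    unfolding eq by (rule \<phi>(4))
  show "0 < \<omega> i (s *\<^sub>R fr 0) (fr 0) (fr (cidx i))" unfolding eq by (rule \<phi>(3))
  show "integral {0..2 * pi} (\<lambda>s. \<omega> i (s *\<^sub>R fr 0) (fr 0) (fr (cidx i))) = 2 * pi"
    unfolding eq by (rule integral_one_plus_second_derivative[OF \<phi>(1,2)])
qed

lemma simple_flow_coeff:
  assumes flow: "hypersymplectic_flow \<omega>" and simple: "\<And>t. 0 \<le> t \<Longrightarrow> simple_type (\<omega> t)"
  shows "simple_flow (coeff \<omega>)"
proof -
  let ?A = "coeff \<omega>"
  have eq: "\<omega> t = simple_triple (\<lambda>i s. ?A i (t, s))" if "0 < t" for t
    using simple_typeD(1)[OF simple, of t] that unfolding coeff_def by simp
  have pos: "0 < ?A i (t, s)" if "0 < t" for i t s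
    using simple_typeD(2)[OF simple, of t] that unfolding coeff_def by simp
  have smooth_periodic: "smooth_periodic (?A i)" for i
    unfolding smooth_periodic_def
  proof (intro conjI allI impI)
    let ?L = "\<lambda>p :: real \<times> real. (fst p, snd p *\<^sub>R fr 0)"
    have "smooth_within half_plane (\<lambda>p. (\<lambda>(t, x). \<omega> t i x (fr 0) (fr (cidx i))) (?L p))"
    proof (rule smooth_within_compose_linear[OF open_half_plane, where S = "{0..} \<times> UNIV"])
      show "bounded_linear ?L"
        by (intro bounded_linear_Pair bounded_linear_fst bounded_linear_scaleR_const bounded_linear_snd)
      show "smooth_within ({0..} \<times> UNIV) (\<lambda>(t, x). \<omega> t i x (fr 0) (fr (cidx i)))"
        using flow unfolding hypersymplectic_flow_def by blast
      show "?L p \<in> interior ({0..} \<times> UNIV)" if "p \<in> half_plane" for p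
        using that by (auto simp: interior_Times half_plane_def)
    qed
    then show "smooth_within half_plane (?A i)"
      unfolding coeff_def[abs_def] by simp
    fix t x :: real assume "0 < t"
    then have "hypersymplectic (\<omega> t)" using flow unfolding hypersymplectic_flow_def by simp
    then have "periodic4 (\<omega> t i)" unfolding hypersymplectic_def two_form_def by blast
    then show "?A i (t, x + 2 * pi) = ?A i (t, x)"
      unfolding periodic4_def coeff_def by (simp add: scaleR_add_left)
  qed
  interpret simple_functions ?A
    by unfold_locales (rule smooth_periodic, rule pos)
  show ?thesis
  proof unfold_locales
    show "integral {0..2 * pi} (\<lambda>x. ?A i (t, x)) = 2 * pi" if "0 < t" for i t
      using simple_typeD(3)[OF simple, of t] that unfolding coeff_def by simp
    fix t s :: real and i assume t: "0 < t"
    let ?F = "\<lambda>i p. exp (u i p) * (exp (- W p) * deriv_x (u i) p)"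
    have spF: "smooth_periodic (?F i)" for i
      using smooth_periodic_mult[OF smooth_periodic_exp[OF smooth_periodic_u] smooth_periodic_mult[OF smooth_periodic_exp[OF smooth_periodic_mult[OF smooth_periodic_const[of "-1"] smooth_periodic_W]] smooth_periodic_deriv_x[OF smooth_periodic_u]]]
      by simp
    have *: "ext_d1 (torsion (simple_triple (\<lambda>i s. ?A i (t, s))) i) (s *\<^sub>R fr 0) (fr 0) (fr (cidx i)) = deriv_x (?F i) (t, s)"
    \<comment> \<open>The witnesses are V, whose cube is the product of the A_i because
      \<open>W\<close> is the mean of their logarithms, and the derivative of f_i = exp u_i.\<close>
    proof (rule ext_d1_torsion_simple_triple[where m = "\<lambda>s. exp (W (t, s))"
          and q = "\<lambda>i s. exp (u i (t, s)) * deriv_x (u i) (t, s)"])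
      show "exp (W (t, s)) ^ 3 = ?A 1 (t, s) * ?A 2 (t, s) * ?A 3 (t, s)" for s
      proof -
        have "exp (W (t, s)) ^ 3 = exp (3 * W (t, s))" by (simp add: exp_of_nat_mult[symmetric])
        also have "3 * W (t, s) = ln (?A 1 (t, s)) + ln (?A 2 (t, s)) + ln (?A 3 (t, s))"
          by (simp add: logvol_def sum_3)
        finally show ?thesis using pos[OF t] by (simp add: exp_add)
      qed
      show "((\<lambda>s. ?A i (t, s) / exp (W (t, s))) has_real_derivative exp (u i (t, s)) * deriv_x (u i) (t, s)) (at s)" for i s
      proof -
        have "?A i (t, s) / exp (W (t, s)) = exp (u i (t, s))" for s
          unfolding logratio_def using pos[OF t] by (simp add: exp_diff)
        then show ?thesis
          using DERIV_fun_exp[OF has_real_derivative_deriv_x[OF smooth_periodic_smooth[OF smooth_periodic_u] t]] by simp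
      qed
      have "((\<lambda>s. ?F i (t, s)) has_real_derivative deriv_x (?F i) (t, s)) (at s)"
        by (rule has_real_derivative_deriv_x[OF smooth_periodic_smooth[OF spF] t])
      then show "((\<lambda>s. exp (u i (t, s)) * deriv_x (u i) (t, s) / exp (W (t, s))) has_real_derivative deriv_x (?F i) (t, s))
          (at ((s *\<^sub>R fr 0) $ 0))"
        by (simp add: fr_nth exp_minus divide_inverse mult_ac)
    qed (use pos[OF t] in auto)
    have "((\<lambda>t. \<omega> t i (s *\<^sub>R fr 0) (fr 0) (fr (cidx i))) has_real_derivative deriv_x (?F i) (t, s)) (at t within {0..})"
    proof -
      have "((\<lambda>t. \<omega> t i (s *\<^sub>R fr 0) (fr 0) (fr (cidx i))) has_real_derivative
          ext_d1 (torsion (\<omega> t) i) (s *\<^sub>R fr 0) (fr 0) (fr (cidx i))) (at t within {0..})"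
        using flow t unfolding hypersymplectic_flow_def by simp
      with * show ?thesis by (simp only: eq[OF t, symmetric])
    qed
    then have "((\<lambda>t. ?A i (t, s)) has_real_derivative deriv_x (?F i) (t, s)) (at t)"
      unfolding coeff_def using t by (simp add: at_within_interior[of t "{0..}"])
    then show "deriv_t (?A i) (t, s) = deriv_x (?F i) (t, s)"
      by (rule deriv_t_eqI[OF smooth_periodic_smooth[OF smooth_periodic] t])
  qed
qed

text \<open>Written as the identity plus a multiple of \<open>fr 0\<close>, so that derivatives and
  smoothness follow from rules for sums and scalar multiples instead of componentwise
  arguments.\<close>

definition S1_lift :: "(real \<Rightarrow> real) \<Rightarrow> R4 \<Rightarrow> R4"
  where "S1_lift h x = x + (h (x $ 0) - x $ 0) *\<^sub>R fr 0"

lemma S1_lift_nth: "S1_lift h x $ a = (if a = 0 then h (x $ 0) else x $ a)"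
  unfolding S1_lift_def by (simp add: fr_nth)

lemma S1_lift_has_derivative:
  assumes "(h has_real_derivative h') (at (x $ 0))"
  shows "(S1_lift h has_derivative (\<lambda>v. v + ((h' - 1) * v $ 0) *\<^sub>R fr 0)) (at x)"
proof -
  have n: "((\<lambda>x :: R4. x $ 0) has_derivative (\<lambda>v. v $ 0)) (at x)"
    by (intro bounded_linear_imp_has_derivative bounded_linear_vec_nth)
  have h: "((\<lambda>x :: R4. h (x $ 0)) has_derivative (\<lambda>v. h' * v $ 0)) (at x)"
    using has_derivative_compose[OF n assms[unfolded has_field_derivative_def]] .
  have "(S1_lift h has_derivative (\<lambda>v. v + (h' * v $ 0 - v $ 0) *\<^sub>R fr 0)) (at x)"
    unfolding S1_lift_def[abs_def]
    by (intro has_derivative_add has_derivative_ident has_derivative_scaleR_left has_derivative_diff h n)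
  then show ?thesis by (simp add: algebra_simps)
qed

lemma S1_lift_smooth:
  assumes "smooth_within UNIV (\<lambda>x :: R4. h (x $ 0))"
  shows "smooth_within UNIV (S1_lift h)"
  unfolding S1_lift_def[abs_def]
  by (intro smooth_within_add smooth_within_scaleR_const smooth_within_diff assms smooth_within_linear
      bounded_linear_ident bounded_linear_vec_nth open_UNIV)

lemma S1_lift_descends:
  assumes "\<And>y. h (y + 2 * pi) = h y + 2 * pi"
  shows "descends (S1_lift h)"
  unfolding descends_def
proof (intro allI)
  fix x :: R4 and a b
  have "S1_lift h (x + (2 * pi) *\<^sub>R fr a) $ b - S1_lift h x $ b = 2 * pi * of_int (if a = b then 1 else 0)"
    by (auto simp: S1_lift_nth fr_nth assms)
  then show "\<exists>n. S1_lift h (x + (2 * pi) *\<^sub>R fr a) $ b - S1_lift h x $ b = 2 * pi * of_int n" by blast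
qed

lemma S1_lift_diffeo:
  assumes smooth: "smooth_within UNIV (\<lambda>x :: R4. h (x $ 0))" "smooth_within UNIV (\<lambda>x :: R4. S (x $ 0))"
    and deriv: "\<And>y. (h has_real_derivative h' y) (at y)" "\<And>y. 0 < h' y"
    and inverse: "\<And>x. h (S x) = x" "\<And>y. S (h y) = y"
    and shift: "\<And>y. h (y + 2 * pi) = h y + 2 * pi" "\<And>x. S (x + 2 * pi) = S x + 2 * pi"
  shows "torus_diffeo (S1_lift h) \<and> orientation_preserving (S1_lift h) \<and> acts_on_S1_only (S1_lift h)"
proof (intro conjI)
  have hS: "S1_lift h (S1_lift S x) = x" "S1_lift S (S1_lift h x) = x" for x
    by (simp_all add: vec_eq_iff S1_lift_nth inverse)
  have "bij (S1_lift h)" by (rule o_bij[of "S1_lift S"]) (simp_all add: fun_eq_iff hS)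
  moreover have "inv (S1_lift h) = S1_lift S" by (rule inv_equality) (simp_all add: hS)
  ultimately show "torus_diffeo (S1_lift h)"
    unfolding torus_diffeo_def by (simp add: S1_lift_smooth S1_lift_descends smooth shift)
  show "acts_on_S1_only (S1_lift h)"
    unfolding acts_on_S1_only_def by (intro exI[of _ h]) (simp add: vec_eq_iff S1_lift_nth)
  show "orientation_preserving (S1_lift h)"
    unfolding orientation_preserving_def
  proof
    fix x
    have D: "frechet_derivative (S1_lift h) (at x) = (\<lambda>v. v + ((h' (x $ 0) - 1) * v $ 0) *\<^sub>R fr 0)"
      using frechet_derivative_at[OF S1_lift_has_derivative[OF deriv(1)], of x] by simp
    have m: "matrix (frechet_derivative (S1_lift h) (at x)) $ a $ b =
        (if a = b then if a = 0 then h' (x $ 0) else 1 else 0)" for a b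
      unfolding D matrix_def by (auto simp: fr_nth axis_def)
    have "det (matrix (frechet_derivative (S1_lift h) (at x))) = (\<Prod>a\<in>UNIV. if a = (0 :: 4) then h' (x $ 0) else 1)"
      by (subst det_diagonal) (simp_all add: m)
    then show "0 < det (matrix (frechet_derivative (S1_lift h) (at x)))"
      using deriv(2) by simp
  qed
qed

text \<open>\<open>h\<close> solves the autonomous equation h' = \<kappa> H (t, h), so a derivative
  of G (t, h) is again a smooth periodic function evaluated at (t, h). Induction over all such G
  therefore closes without prior smoothness of \<open>h\<close>.\<close>

lemma smooth_along_reparametrization:
  fixes h :: "real \<Rightarrow> real"
  assumes t: "0 < t" and h: "\<And>y. (h has_real_derivative \<kappa> * H (t, h y)) (at y)" and H: "smooth_periodic H" and G: "smooth_periodic G"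
  shows "smooth_within UNIV (\<lambda>x :: R4. G (t, h (x $ 0)))"
proof -
  have "diff_times n UNIV (\<lambda>x :: R4. G (t, h (x $ 0)))" if "smooth_periodic G" for n G
    using that
  proof (induction n arbitrary: G)
    case (Suc n)
    show ?case
    proof (rule diff_times_SucI[OF open_UNIV, of _ "\<lambda>x v. (\<kappa> * v $ 0) * (deriv_x G (t, h (x $ 0)) * H (t, h (x $ 0)))"])
      fix x :: R4
      have n: "((\<lambda>x :: R4. x $ 0) has_derivative (\<lambda>v. v $ 0)) (at x)"
        by (intro bounded_linear_imp_has_derivative bounded_linear_vec_nth)
      have "((\<lambda>y. G (t, h y)) has_real_derivative deriv_x G (t, h (x $ 0)) * (\<kappa> * H (t, h (x $ 0)))) (at (x $ 0))"
        using DERIV_chain2[OF has_real_derivative_deriv_x[OF smooth_periodic_smooth[OF Suc.prems] t] h] .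
      from has_derivative_compose[OF n this[unfolded has_field_derivative_def]]
      show "((\<lambda>x. G (t, h (x $ 0))) has_derivative
          (\<lambda>v. (\<kappa> * v $ 0) * (deriv_x G (t, h (x $ 0)) * H (t, h (x $ 0))))) (at x)"
        by (simp add: mult_ac)
      show "diff_times n UNIV (\<lambda>x :: R4. (\<kappa> * v $ 0) * (deriv_x G (t, h (x $ 0)) * H (t, h (x $ 0))))" for v :: R4
      proof -
        have "smooth_periodic (\<lambda>p. (\<kappa> * v $ 0) * (deriv_x G p * H p))"
          by (intro smooth_periodic_mult smooth_periodic_const smooth_periodic_deriv_x Suc.prems H)
        from Suc.IH[OF this] show ?thesis .
      qed
    qed
  qed simp
  then show ?thesis using G unfolding smooth_within_iff by blast
qed

text \<open>The lifts \<open>h\<close> and \<open>S\<close> are not periodic themselves; their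
  smoothness is obtained from that of their derivatives.\<close>

lemma smooth_primitive:
  fixes h h' :: "real \<Rightarrow> real"
  assumes "\<And>y. (h has_real_derivative h' y) (at y)" "smooth_within UNIV (\<lambda>x :: R4. h' (x $ 0))"
  shows "smooth_within UNIV (\<lambda>x :: R4. h (x $ 0))"
proof (rule smooth_withinI[OF open_UNIV, of _ "\<lambda>x v. h' (x $ 0) * v $ 0"])
  fix x :: R4
  have "((\<lambda>x :: R4. x $ 0) has_derivative (\<lambda>v. v $ 0)) (at x)"
    by (intro bounded_linear_imp_has_derivative bounded_linear_vec_nth)
  from has_derivative_compose[OF this assms(1)[unfolded has_field_derivative_def]]
  show "((\<lambda>x. h (x $ 0)) has_derivative (\<lambda>v. h' (x $ 0) * v $ 0)) (at x)" .
  show "smooth_within UNIV (\<lambda>x :: R4. h' (x $ 0) * v $ 0)" for v :: R4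
    by (intro smooth_within_mult open_UNIV assms smooth_within_const)
qed

lemma iter_deriv_const:
  "iter_deriv UNIV vs (\<lambda>x :: 'a::real_normed_vector. k :: real) = (\<lambda>x. if vs = [] then k else 0)"
proof (induction vs)
  case (Cons v vs)
  then show ?case by (cases "vs = []") simp_all
qed simp

context simple_flow
begin

lemma reparametrization_diffeo:
  assumes t: "0 < t"
  shows "\<exists>h. (\<forall>y. (h has_real_derivative c t / V (t, h y)) (at y)) \<and>
    torus_diffeo (S1_lift h) \<and> orientation_preserving (S1_lift h) \<and> acts_on_S1_only (S1_lift h)"
proof -
  obtain S h where S: "\<And>x. (S has_real_derivative V (t, x) / c t) (at x)"
    and h: "\<And>y. (h has_real_derivative c t / V (t, h y)) (at y)"
    and inverse: "\<And>x. h (S x) = x" "\<And>y. S (h y) = y"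
    and shift: "\<And>y. h (y + 2 * pi) = h y + 2 * pi" "\<And>x. S (x + 2 * pi) = S x + 2 * pi"
    using reparametrization[OF t] by blast
  have inv: "smooth_periodic (\<lambda>p. inverse (V p))"
    by (rule smooth_periodic_inverse[OF smooth_periodic_V]) (use V_pos in \<open>metis less_irrefl\<close>)
  have "smooth_within UNIV (\<lambda>x :: R4. c t * inverse (V (t, h (x $ 0))))"
    by (rule smooth_along_reparametrization[OF t _ inv, where G = "\<lambda>p. c t * inverse (V p)" and \<kappa> = "c t"])
      (use h in \<open>auto simp: divide_inverse intro!: smooth_periodic_mult smooth_periodic_const inv\<close>)
  then have sh: "smooth_within UNIV (\<lambda>x :: R4. h (x $ 0))"
    by (intro smooth_primitive[of h "\<lambda>y. c t * inverse (V (t, h y))"]) (use h in \<open>auto simp: divide_inverse\<close>)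
  \<comment> \<open>For \<open>S\<close> the derivative is a function of the original coordinate, so
    the lemma is applied to the identity reparametrization.\<close>
  have "smooth_within UNIV (\<lambda>x :: R4. inverse (c t) * V (t, x $ 0))"
    by (rule smooth_along_reparametrization[OF t _ smooth_periodic_const[of 1], where G = "\<lambda>p. inverse (c t) * V p" and \<kappa> = 1 and h = "\<lambda>y. y"])
      (auto intro!: smooth_periodic_mult smooth_periodic_const smooth_periodic_V)
  then have sS: "smooth_within UNIV (\<lambda>x :: R4. S (x $ 0))"
    by (intro smooth_primitive[of S "\<lambda>y. inverse (c t) * V (t, y)"]) (use S in \<open>auto simp: divide_inverse mult.commute\<close>)
  have "torus_diffeo (S1_lift h) \<and> orientation_preserving (S1_lift h) \<and> acts_on_S1_only (S1_lift h)"
    by (rule S1_lift_diffeo[OF sh sS h _ inverse shift]) (simp add: c_pos[OF t] V_pos)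
  then show ?thesis using h by blast
qed

text \<open>The function depends on x_0 alone, so each direction contributes its component v_0. The
  chain rule gives \<open>deriv_x\<close> times c / V, which is c \<open>D\<close>: the weight
  \<open>V\<close> cancels at every order.\<close>

lemma iter_deriv_reparametrized:
  assumes t: "0 < t" and h: "\<And>y. (h has_real_derivative c t / V (t, h y)) (at y)" and G: "smooth_periodic G"
  shows "iter_deriv UNIV vs (\<lambda>x :: R4. \<alpha> * G (t, h (x $ 0)) + \<beta>) =
    (\<lambda>x. \<alpha> * (prod_list (map (\<lambda>v. v $ 0) vs) * (c t ^ length vs * (D ^^ length vs) G (t, h (x $ 0))))
      + (if vs = [] then \<beta> else 0))"
proof (induction vs)
  case (Cons v vs)
  let ?n = "length vs"
  let ?p = "prod_list (map (\<lambda>v. v $ 0) vs)"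
  let ?b = "if vs = [] then \<beta> else 0"
  have spG: "smooth_periodic ((D ^^ ?n) G)" by (intro smooth_periodic_D_power G)
  have "frechet_derivative (\<lambda>x. \<alpha> * (?p * (c t ^ ?n * (D ^^ ?n) G (t, h (x $ 0)))) + ?b) (at x) v =
      \<alpha> * (v $ 0 * ?p * (c t * c t ^ ?n * D ((D ^^ ?n) G) (t, h (x $ 0))))" for x
  proof -
    let ?y = "x $ 0"
    have "((\<lambda>y. (D ^^ ?n) G (t, h y)) has_real_derivative deriv_x ((D ^^ ?n) G) (t, h ?y) * (c t / V (t, h ?y))) (at ?y)"
      using DERIV_chain2[OF has_real_derivative_deriv_x[OF smooth_periodic_smooth[OF spG] t] h] .
    then have "((\<lambda>y. (D ^^ ?n) G (t, h y)) has_real_derivative c t * D ((D ^^ ?n) G) (t, h ?y)) (at ?y)"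
      using V_pos[of "(t, h ?y)"] by (simp add: deriv_x_eq mult.commute)
    then have "((\<lambda>y. \<alpha> * (?p * (c t ^ ?n * (D ^^ ?n) G (t, h y))) + ?b) has_real_derivative
        \<alpha> * (?p * (c t ^ ?n * (c t * D ((D ^^ ?n) G) (t, h ?y)))) + 0) (at ?y)"
      by (intro DERIV_add DERIV_cmult DERIV_const)
    from frechet_derivative_coord[OF this, of v] show ?thesis by (simp add: mult_ac)
  qed
  then show ?case using Cons by simp
qed simp

lemma prod_list_coord_le_1:
  "set vs \<subseteq> Basis \<Longrightarrow> \<bar>prod_list (map (\<lambda>v :: R4. v $ 0) vs)\<bar> \<le> 1"
proof (induction vs)
  case (Cons v vs)
  have "\<bar>v $ 0\<bar> \<le> 1" using Cons.prems by (auto simp: Basis_vec_def axis_def)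
  then have "\<bar>v $ 0\<bar> * \<bar>prod_list (map (\<lambda>v. v $ 0) vs)\<bar> \<le> 1 * 1"
    using Cons by (intro mult_mono) auto
  then show ?case by (simp add: abs_mult)
qed simp

text \<open>For fixed a and b, \<open>k1\<close> and \<open>k2\<close> are the constant values of
  dx_0 \<and> dx_i and of dx_j \<and> dx_k on the two frame vectors; their sum is the component of
  the standard triple.\<close>

lemma Ck_tendsto_reparametrized:
  assumes h: "\<And>t y. 0 < t \<Longrightarrow> (h t has_real_derivative c t / V (t, h t y)) (at y)"
    and F: "\<And>t x. 0 < t \<Longrightarrow> F t x = k1 * (c t * f i (t, h t (x $ 0))) + k2"
  shows "Ck_tendsto k F (\<lambda>x :: R4. k1 + k2)"
  unfolding Ck_tendsto_def
proof (intro allI impI, elim conjE)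
  fix vs :: "R4 list" assume vs: "set vs \<subseteq> Basis"
  let ?n = "length vs" and ?p = "prod_list (map (\<lambda>v. v $ 0) vs)"
  define Z where "Z p = c (fst p) * (c (fst p) ^ ?n * (D ^^ ?n) (f i) p) - (if ?n = 0 then 1 else 0)" for p
  have Z: "vanishing Z" unfolding Z_def[abs_def] by (rule vanishing_rescaled_f)
  show "uniform_limit UNIV (\<lambda>t. iter_deriv UNIV vs (F t)) (iter_deriv UNIV vs (\<lambda>x. k1 + k2)) at_top"
  proof (rule uniform_limitI)
    fix \<epsilon> :: real assume \<epsilon>: "0 < \<epsilon>"
    have "eventually (\<lambda>t. \<forall>x. \<bar>Z (t, x)\<bar> < \<epsilon> / (\<bar>k1\<bar> + 1)) at_top"
      using Z \<epsilon> unfolding vanishing_iff by simp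
    then show "eventually (\<lambda>t. \<forall>x\<in>UNIV. dist (iter_deriv UNIV vs (F t) x) (iter_deriv UNIV vs (\<lambda>x. k1 + k2) x) < \<epsilon>) at_top"
      using eventually_gt_at_top[of 0]
    proof eventually_elim
      case (elim t)
      show ?case
      proof
        fix x :: R4
        have "F t = (\<lambda>x. (k1 * c t) * f i (t, h t (x $ 0)) + k2)"
          by (rule ext) (simp add: F[OF elim(2)] mult.assoc)
        then have "iter_deriv UNIV vs (F t) x - iter_deriv UNIV vs (\<lambda>x. k1 + k2) x = k1 * (?p * Z (t, h t (x $ 0)))"
          using iter_deriv_reparametrized[OF elim(2) h[OF elim(2)] smooth_periodic_f, of vs "k1 * c t" i k2]
          by (cases "vs = []") (simp_all add: iter_deriv_const Z_def algebra_simps)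
        then have "dist (iter_deriv UNIV vs (F t) x) (iter_deriv UNIV vs (\<lambda>x. k1 + k2) x) =
            \<bar>k1\<bar> * (\<bar>?p\<bar> * \<bar>Z (t, h t (x $ 0))\<bar>)"
          by (simp add: dist_real_def abs_mult)
        also have "\<dots> \<le> (\<bar>k1\<bar> + 1) * (1 * \<bar>Z (t, h t (x $ 0))\<bar>)"
          by (intro mult_mono prod_list_coord_le_1 vs) auto
        also have "\<dots> < \<epsilon>" using elim(1) by (simp add: field_simps)
        finally show "dist (iter_deriv UNIV vs (F t) x) (iter_deriv UNIV vs (\<lambda>x. k1 + k2) x) < \<epsilon>" .
      qed
    qed
  qed
qed

text \<open>The factor h' = c / V from the pullback of dx_0 cancels \<open>V\<close> in A_i = f_i V,
  while dx_j \<and> dx_k is unchanged.\<close>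

lemma pullback_reparametrized:
  assumes t: "0 < t" and h: "\<And>y. (h has_real_derivative c t / V (t, h y)) (at y)"
  shows "pullback2 (S1_lift h) (simple_triple (\<lambda>i s. A i (t, s)) i) x v w =
    wedge11 (dx 0) (dx (cidx i)) v w * (c t * f i (t, h (x $ 0)))
    + wedge11 (dx (cidx (i + 1))) (dx (cidx (i + 2))) v w"
proof -
  let ?h' = "c t / V (t, h (x $ 0))"
  have D: "frechet_derivative (S1_lift h) (at x) = (\<lambda>v. v + ((?h' - 1) * v $ 0) *\<^sub>R fr 0)"
    using frechet_derivative_at[OF S1_lift_has_derivative[OF h], of x] by simp
  have nz: "cidx j \<noteq> 0" "0 \<noteq> cidx j" for j using cidx_nonzero[of j] by auto
  have "A i (t, h (x $ 0)) * ?h' = c t * f i (t, h (x $ 0))"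
    using V_pos[of "(t, h (x $ 0))"] by (simp add: A_eq t f_def)
  then have "A i (t, h (x $ 0)) * (?h' * wedge11 (dx 0) (dx (cidx i)) v w) =
      wedge11 (dx 0) (dx (cidx i)) v w * (c t * f i (t, h (x $ 0)))"
    by (metis mult.assoc mult.commute)
  then show ?thesis
    unfolding pullback2_def D simple_triple_def wedge11_def dx_def S1_lift_nth
    by (simp add: fr_nth nz algebra_simps)
qed

end

theorem theorem3p6:
  fixes \<omega>0 :: triple and \<omega> :: "real \<Rightarrow> triple"
  assumes "hypersymplectic \<omega>0" and "simple_type \<omega>0"
    and "hypersymplectic_flow \<omega>" and "\<And>t. t \<ge> 0 \<Longrightarrow> simple_type (\<omega> t)"
    and "\<omega> 0 = \<omega>0"
  shows "\<exists>F :: real \<Rightarrow> R4 \<Rightarrow> R4.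
    (\<forall>t\<ge>0. torus_diffeo (F t) \<and> orientation_preserving (F t) \<and> acts_on_S1_only (F t)) \<and>
    (\<forall>k i a b. Ck_tendsto k (\<lambda>t x. pullback2 (F t) (\<omega> t i) x (fr a) (fr b))
                            (\<lambda>x. standard_triple i x (fr a) (fr b)))"
proof -
  interpret simple_flow "coeff \<omega>"
    by (rule simple_flow_coeff[OF assms(3,4)])
  let ?good = "\<lambda>F. torus_diffeo F \<and> orientation_preserving F \<and> acts_on_S1_only F"
  have "\<exists>h. ?good (S1_lift h) \<and> (0 < t \<longrightarrow> (\<forall>y. (h has_real_derivative c t / V (t, h y)) (at y)))" for t
  proof (cases "0 < t")
    case True
    then show ?thesis using reparametrization_diffeo by blast
  next
    case False
    have "smooth_within UNIV (\<lambda>x :: R4. x $ 0)"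
      by (intro smooth_within_linear bounded_linear_vec_nth open_UNIV)
    \<comment> \<open>Arclength is set up for positive times only; at other times the identity
      serves, with no effect on the limit.\<close>
    then have "?good (S1_lift (\<lambda>y. y))"
      by (intro S1_lift_diffeo[where h' = "\<lambda>_. 1" and S = "\<lambda>y. y"]) auto
    then show ?thesis using False by blast
  qed
  then obtain h where h: "\<And>t. ?good (S1_lift (h t))"
    "\<And>t y. 0 < t \<Longrightarrow> (h t has_real_derivative c t / V (t, h t y)) (at y)" by metis
  have eq: "\<omega> t = simple_triple (\<lambda>i s. coeff \<omega> i (t, s))" if "0 < t" for t
    using simple_typeD(1)[OF assms(4), of t] that unfolding coeff_def by simp
  have "Ck_tendsto k (\<lambda>t x. pullback2 (S1_lift (h t)) (\<omega> t i) x (fr a) (fr b))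
      (\<lambda>x. standard_triple i x (fr a) (fr b))" for k i a b
    unfolding standard_triple_def
    by (rule Ck_tendsto_reparametrized[of h _ _ i, OF h(2)])
      (simp_all add: eq pullback_reparametrized[OF _ h(2)])
  then show ?thesis using h(1) by (intro exI[of _ "\<lambda>t. S1_lift (h t)"]) blast
qed

end
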